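(* Let $p$ be an odd prime number and let $E^{(p)}$ be the elliptic curve $y^2=x^3-p^2x$ over $\mathbb{Q}$. Then the $2$-Selmer group $S^2(E^{(p)}/\mathbb{Q})$ satisfies \[ \dim_{\mathbb{F}_2} S^2(E^{(p)}/\mathbb{Q})= \begin{cases} 4 & \text{if } p\equiv 1\bmod 8;\\ 2 & \text{if } p\equiv 3\bmod 8;\\ 3 & \text{if } p\equiv 5,7\bmod 8. \end{cases} \]
   Context: $S^2(E^{(p)}/\mathbb{Q})$ is the usual $2$-Selmer group (attached to multiplication by $2$), described as follows. Let $S=\{2,p,\infty\}$ and let $\mathbb{Q}(S)=\{x\in\mathbb{Q}^*/{\mathbb{Q}^*}^2 : v(x)\equiv 0\bmod 2 \text{ for all } v\notin S\}$, which is generated by the classes of $-1,2,p$. Let $H=\{(c_1,c_2,c_3)\in\mathbb{Q}(S)^3 : c_1c_2c_3=1\}$. The Kummer homomorphism $\delta\colon E^{(p)}(\mathbb{Q})\to H$, with kernel $2E^{(p)}(\mathbb{Q})$, is given (modulo squares) by $\delta(a,b)=(a+p,a,a-p)$ if $b\neq 0$, $\delta(-p,0)=(2,-p,-2p)$, $\delta(0,0)=(p,-1,-p)$, $\delta(p,0)=(2p,p,2)$, and the point at infinity maps to $(1,1,1)$. For each place $v$ the same formulas give the local map $\delta_v\colon E^{(p)}(\mathbb{Q}_v)\to H_v=\{(c_1,c_2,c_3)\in(\mathbb{Q}_v^*/{\mathbb{Q}_v^*}^2)^3 : c_1c_2c_3=1\}$, and $\iota_v\colon H\to H_v$ is the natural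 map. Then $S^2(E^{(p)}/\mathbb{Q})=\{c\in H : \iota_v(c)\in\delta_v(E^{(p)}(\mathbb{Q}_v)) \text{ for all } v\in S\}$, which is an $\mathbb{F}_2$-vector space. *)

theory Defs
  imports
    "HOL-Number_Theory.Number_Theory"
    "HOL-Algebra.QuotRing"
    "Jordan_Normal_Form.VS_Connect"
begin

section \<open>The field of p-adic numbers\<close>

definition padic_val :: "nat \<Rightarrow> rat \<Rightarrow> int" where
  "padic_val l x =
     int (multiplicity (int l) (fst (quotient_of x)))
       - int (multiplicity (int l) (snd (quotient_of x)))"

definition padic_abs :: "nat \<Rightarrow> rat \<Rightarrow> real" where
  "padic_abs l x = (if x = 0 then 0 else real l powi (- padic_val l x))"

definition padic_Cauchy :: "nat \<Rightarrow> (nat \<Rightarrow> rat) \<Rightarrow> bool" where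
  "padic_Cauchy l X \<longleftrightarrow>
     (\<forall>e>0. \<exists>N. \<forall>m\<ge>N. \<forall>n\<ge>N. padic_abs l (X m - X n) < e)"

definition padic_Cauchy_ring :: "nat \<Rightarrow> (nat \<Rightarrow> rat) ring" where
  "padic_Cauchy_ring l =
     \<lparr>carrier = {X. padic_Cauchy l X},
      mult = (\<lambda>X Y n. X n * Y n), one = (\<lambda>_. 1),
      zero = (\<lambda>_. 0), add = (\<lambda>X Y n. X n + Y n)\<rparr>"

definition padic_null :: "nat \<Rightarrow> (nat \<Rightarrow> rat) set" where
  "padic_null l = {X. (\<lambda>n. padic_abs l (X n)) \<longlonglongrightarrow> 0}"

text \<open>The completion of the rationals at \<open>l\<close>: Cauchy sequences modulo null sequences.
  The canonical embedding sends a rational number to the class of a constant sequence.\<close>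

definition padic_field :: "nat \<Rightarrow> (nat \<Rightarrow> rat) set ring" where
  "padic_field l = padic_Cauchy_ring l Quot padic_null l"

definition padic_of_rat :: "nat \<Rightarrow> rat \<Rightarrow> (nat \<Rightarrow> rat) set" where
  "padic_of_rat l q = padic_null l +>\<^bsub>padic_Cauchy_ring l\<^esub> (\<lambda>_. q)"


section \<open>Square classes\<close>

definition nonzero_squares :: "'a ring \<Rightarrow> 'a set" where
  "nonzero_squares K = {x \<otimes>\<^bsub>K\<^esub> x | x. x \<in> carrier (mult_of K)}"

definition sqclass_group :: "'a ring \<Rightarrow> 'a set monoid" where
  "sqclass_group K = mult_of K Mod nonzero_squares K"

definition sqclass :: "'a ring \<Rightarrow> 'a \<Rightarrow> 'a set" where
  "sqclass K x = nonzero_squares K #>\<^bsub>mult_of K\<^esub> x"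

text \<open>The map on square classes induced by a field embedding \<open>\<phi>\<close> of the rationals into \<open>K\<close>.\<close>

definition sqclass_map :: "'a ring \<Rightarrow> (rat \<Rightarrow> 'a) \<Rightarrow> rat set \<Rightarrow> 'a set" where
  "sqclass_map K \<phi> X = the_elem ((\<lambda>x. sqclass K (\<phi> x)) ` X)"

text \<open>Here \<open>S\<close> consists of the finite places only; the infinite place is always exempt.\<close>

definition rat_sqclasses_outside :: "nat set \<Rightarrow> rat set set" where
  "rat_sqclasses_outside S =
     {X \<in> carrier (sqclass_group class_ring).
        \<forall>l. prime l \<and> l \<notin> S \<longrightarrow> (\<forall>x\<in>X. even (padic_val l x))}"

definition selmer_ambient :: "nat \<Rightarrow> (rat set \<times> rat set \<times> rat set) set" where
  "selmer_ambient p =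
     (let Q = rat_sqclasses_outside {2, p}; G = sqclass_group (class_ring :: rat ring)
      in {(c1, c2, c3). c1 \<in> Q \<and> c2 \<in> Q \<and> c3 \<in> Q \<and>
            c1 \<otimes>\<^bsub>G\<^esub> c2 \<otimes>\<^bsub>G\<^esub> c3 = \<one>\<^bsub>G\<^esub>})"


section \<open>The curve and its Kummer map\<close>

datatype 'a curve_point = Infinity | Affine 'a 'a

text \<open>The points over \<open>K\<close> of the curve \<open>y\<^sup>2 = x\<^sup>3 - p\<^sup>2 x\<close>, where rational numbers
  are viewed in \<open>K\<close> via the embedding \<open>\<phi>\<close>.\<close>

definition curve_points :: "nat \<Rightarrow> 'a ring \<Rightarrow> (rat \<Rightarrow> 'a) \<Rightarrow> 'a curve_point set" where
  "curve_points p K \<phi> =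
     insert Infinity
       {Affine x y | x y. x \<in> carrier K \<and> y \<in> carrier K \<and>
          y [^]\<^bsub>K\<^esub> (2::nat) = x [^]\<^bsub>K\<^esub> (3::nat) \<ominus>\<^bsub>K\<^esub> \<phi> (of_nat p ^ 2) \<otimes>\<^bsub>K\<^esub> x}"

text \<open>On a point of the curve, \<open>b = 0\<close> forces \<open>a\<close> to be one of \<open>-p\<close>, \<open>0\<close>, \<open>p\<close>,
  so the last branch is the point \<open>(p, 0)\<close>.\<close>

fun kummer :: "nat \<Rightarrow> 'a ring \<Rightarrow> (rat \<Rightarrow> 'a) \<Rightarrow> 'a curve_point \<Rightarrow>
    'a set \<times> 'a set \<times> 'a set" where
  "kummer p K \<phi> Infinity = (sqclass K \<one>\<^bsub>K\<^esub>, sqclass K \<one>\<^bsub>K\<^esub>, sqclass K \<one>\<^bsub>K\<^esub>)"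
| "kummer p K \<phi> (Affine a b) =
     (let \<pi> = of_nat p in
      if b \<noteq> \<zero>\<^bsub>K\<^esub> then
        (sqclass K (a \<oplus>\<^bsub>K\<^esub> \<phi> \<pi>), sqclass K a, sqclass K (a \<ominus>\<^bsub>K\<^esub> \<phi> \<pi>))
      else if a = \<phi> (- \<pi>) then
        (sqclass K (\<phi> 2), sqclass K (\<phi> (- \<pi>)), sqclass K (\<phi> (- 2 * \<pi>)))
      else if a = \<phi> 0 then
        (sqclass K (\<phi> \<pi>), sqclass K (\<phi> (- 1)), sqclass K (\<phi> (- \<pi>)))
      else
        (sqclass K (\<phi> (2 * \<pi>)), sqclass K (\<phi> \<pi>), sqclass K (\<phi> 2)))"


section \<open>The 2-Selmer group\<close>

definition locally_kummer ::
    "nat \<Rightarrow> 'a ring \<Rightarrow> (rat \<Rightarrow> 'a) \<Rightarrow> rat set \<times> rat set \<times> rat set \<Rightarrow> bool" where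
  "locally_kummer p K \<phi> =
     (\<lambda>(c1, c2, c3). (sqclass_map K \<phi> c1, sqclass_map K \<phi> c2, sqclass_map K \<phi> c3)
        \<in> kummer p K \<phi> ` curve_points p K \<phi>)"

definition selmer_set :: "nat \<Rightarrow> (rat set \<times> rat set \<times> rat set) set" where
  "selmer_set p =
     {c \<in> selmer_ambient p.
        (\<forall>l\<in>{2, p}. locally_kummer p (padic_field l) (padic_of_rat l) c) \<and>
        locally_kummer p (class_ring :: real ring) of_rat c}"

definition selmer_group :: "nat \<Rightarrow> (rat set \<times> rat set \<times> rat set) monoid" where
  "selmer_group p =
     (let G = sqclass_group class_ring in (G \<times>\<times> G \<times>\<times> G)\<lparr>carrier := selmer_set p\<rparr>)"

text \<open>A multiplicatively written group of exponent 2 as a module over the field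
  \<^term>\<open>residue_ring 2\<close> with two elements, with powers as scalar multiples.
  The \<open>mult\<close> and \<open>one\<close> fields of a module record play no role.\<close>

definition F2_module :: "'a monoid \<Rightarrow> (int, 'a) module" where
  "F2_module G =
     \<lparr>carrier = carrier G, mult = undefined, one = undefined,
      zero = \<one>\<^bsub>G\<^esub>, add = mult G, smult = (\<lambda>k x. x [^]\<^bsub>G\<^esub> k)\<rparr>"

definition selmer_space :: "nat \<Rightarrow> (int, rat set \<times> rat set \<times> rat set) module" where
  "selmer_space p = F2_module (selmer_group p)"

end

theory Submission
  imports Defs "HOL-Computational_Algebra.Nth_Powers"
begin

text \<open>The 2-Selmer group is cut out of the finite group of triples \<open>(c\<^sub>1, c\<^sub>2, c\<^sub>3)\<close> of square classes
  with product 1, unramified outside \<open>2\<close> and \<open>p\<close>, by three local conditions, so the theorem follows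
  once the image of the local Kummer map is known at \<open>\<infinity>\<close>, \<open>p\<close> and \<open>2\<close>. Let \<open>T\<close> be the group of the
  classes of the four 2-torsion points: \<open>(1, 1, 1)\<close>, \<open>(2, -p, -2p)\<close>, \<open>(p, -1, -p)\<close> and \<open>(2p, p, 2)\<close>.

  \<^item> At \<open>\<infinity>\<close> the image is given by \<open>c\<^sub>1 > 0\<close> (\<open>kummer_image_real\<close>).
  \<^item> At \<open>p\<close> the image is \<open>T\<close> (\<open>kummer_image_odd\<close>).
  \<^item> At \<open>2\<close> the image is generated by \<open>T\<close> and \<open>(5, 1, 5)\<close>, which is the class of the point with
    \<open>x = 1/4\<close> (\<open>kummer_image_2\<close>).

  These images are found without the group law and without a count of local points. A point with
  \<open>y \<noteq> 0\<close> has the class \<open>(x + p, x, x - p)\<close>, and in each range of the valuation of \<open>x\<close> these numbers are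
  so close to \<open>x\<close> or to a small multiple of \<open>p\<close> that their square classes can be read off.
  The tool is that \<open>1 + 4 z\<close> is a square in \<open>\<rat>\<^sub>l\<close> for all \<open>z\<close> in the maximal ideal
  (\<open>square_near_1\<close>). It also shows that each nonzero element of \<open>\<rat>\<^sub>l\<close> has the square class of a good
  rational approximation, so that the whole analysis can be carried out with rational \<open>x\<close>
  (\<open>locally_kummer_padic_iff\<close>).

  A class unramified outside \<open>2\<close> and \<open>p\<close> has a unique representative \<open>\<plusminus>2\<^sup>j p\<^sup>k\<close> with \<open>j\<close> and \<open>k\<close> in
  \<open>{0, 1}\<close>. Whether such a number is a square in \<open>\<rat>\<^sub>p\<close> or in \<open>\<rat>\<^sub>2\<close> depends only on \<open>p\<close> modulo 8, by the
  quadratic characters of \<open>-1\<close> and \<open>2\<close> (\<open>QuadRes_minus_1_2\<close>). The three conditions thereby become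
  linear equations over the field with two elements for the exponents of \<open>c\<^sub>1\<close> and \<open>c\<^sub>2\<close>
  (\<open>triple_in_selmer_set_iff\<close>), which leave 4, 2, 3 and 3 exponents free for \<open>p \<equiv> 1, 3, 5, 7\<close> modulo 8.
  The dimension is then read off from the number of solutions.\<close>

section \<open>The \<open>l\<close>-adic valuation on the rationals\<close>

lemma padic_val_quotient:
  assumes "prime l" "a \<noteq> 0" "b \<noteq> 0"
  shows "padic_val l (of_int a / of_int b) = int (multiplicity (int l) a) - int (multiplicity (int l) b)"
proof -
  obtain c d where cd: "quotient_of (of_int a / of_int b) = (c, d)" by fastforce
  have d: "d > 0" and x: "of_int a / of_int b = (of_int c / of_int d :: rat)"
    using cd quotient_of_denom_pos quotient_of_div by auto
  have "c \<noteq> 0" using x assms d by auto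
  have "(of_int (a * d) :: rat) = of_int (c * b)"
    using x assms d by (simp add: field_simps)
  hence "a * d = c * b" using of_int_eq_iff by blast
  hence "multiplicity (int l) (a * d) = multiplicity (int l) (c * b)" by simp
  hence "multiplicity (int l) a + multiplicity (int l) d = multiplicity (int l) c + multiplicity (int l) b"
    using assms d \<open>c \<noteq> 0\<close> by (simp add: prime_elem_multiplicity_mult_distrib)
  thus ?thesis using cd by (simp add: padic_val_def)
qed

lemma rat_as_quotient:
  fixes x :: rat
  obtains a b :: int where "b > 0" "coprime a b" "x = of_int a / of_int b"
  by (metis quotient_of_coprime quotient_of_denom_pos quotient_of_div surj_pair)

lemma padic_val_of_int: "prime l \<Longrightarrow> a \<noteq> 0 \<Longrightarrow> padic_val l (of_int a) = int (multiplicity (int l) a)"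
  using padic_val_quotient[of l a 1] by simp

lemma padic_val_1 [simp]: "padic_val l 1 = 0"
  by (simp add: padic_val_def)

lemma padic_val_mult:
  assumes "prime l" "x \<noteq> 0" "y \<noteq> 0"
  shows "padic_val l (x * y) = padic_val l x + padic_val l y"
proof -
  obtain a b c d where ab: "b \<noteq> 0" "x = of_int a / of_int b" and cd: "d \<noteq> 0" "y = of_int c / of_int d"
    by (metis rat_as_quotient less_irrefl)
  have nz: "a \<noteq> 0" "c \<noteq> 0" using assms ab cd by auto
  have "x * y = of_int (a * c) / of_int (b * d)" using ab cd by simp
  hence "padic_val l (x * y) = int (multiplicity (int l) (a * c)) - int (multiplicity (int l) (b * d))"
    using padic_val_quotient[of l "a * c" "b * d"] ab cd nz assms by simp
  thus ?thesis using ab cd nz assms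
    by (simp add: padic_val_quotient prime_elem_multiplicity_mult_distrib)
qed

lemma padic_val_inverse:
  assumes "prime l" "x \<noteq> 0"
  shows "padic_val l (inverse x) = - padic_val l x"
  using padic_val_mult[of l x "inverse x"] assms by simp

lemma padic_val_divide:
  assumes "prime l" "x \<noteq> 0" "y \<noteq> 0"
  shows "padic_val l (x / y) = padic_val l x - padic_val l y"
  using assms by (simp add: divide_inverse padic_val_mult padic_val_inverse)

lemma padic_val_power:
  assumes "prime l" "x \<noteq> 0"
  shows "padic_val l (x ^ n) = int n * padic_val l x"
  using assms by (induction n) (auto simp: padic_val_mult algebra_simps)

lemma padic_val_powi:
  assumes "prime l" "x \<noteq> 0"
  shows "padic_val l (x powi n) = n * padic_val l x"
  using assms by (auto simp: power_int_def padic_val_power padic_val_inverse)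

lemma padic_val_uminus [simp]: "padic_val l (- x) = padic_val l x"
proof -
  have "multiplicity p (- a) = multiplicity p a" for p a :: int
    using multiplicity_normalize_right[of p "- a"] multiplicity_normalize_right[of p a] by simp
  thus ?thesis by (cases "quotient_of x") (simp add: padic_val_def rat_uminus_code)
qed

lemma padic_val_prime:
  assumes "prime l" shows "padic_val l (of_nat l) = 1"
  using padic_val_of_int[of l "int l"] assms by simp

text \<open>Membership in the fractional ideal generated by \<open>l\<^sup>k\<close> in the localisation at \<open>l\<close>;
  unlike an inequality between valuations it also makes sense at \<open>0\<close>.\<close>

definition padic_ideal :: "nat \<Rightarrow> int \<Rightarrow> rat set" where
  "padic_ideal l k = {x. x = 0 \<or> k \<le> padic_val l x}"

lemma padic_ideal_0_iff:
  assumes "prime l"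
  shows "x \<in> padic_ideal l 0 \<longleftrightarrow> (\<exists>a b. \<not> int l dvd b \<and> x = of_int a / of_int b)"
proof
  assume x: "x \<in> padic_ideal l 0"
  obtain a b where ab: "b > 0" "coprime a b" "x = of_int a / of_int b" by (rule rat_as_quotient)
  have "\<not> int l dvd b"
  proof
    assume b: "int l dvd b"
    have a: "\<not> int l dvd a"
      using ab(2) b assms by (meson coprime_common_divisor not_prime_unit prime_nat_int_transfer)
    hence "a \<noteq> 0" by auto
    have "multiplicity (int l) a = 0" by (rule not_dvd_imp_multiplicity_0[OF a])
    moreover have "multiplicity (int l) b > 0"
      using b ab(1) assms by (simp add: prime_multiplicity_gt_zero_iff)
    ultimately show False
      using x ab padic_val_quotient[OF assms \<open>a \<noteq> 0\<close>, of b] \<open>a \<noteq> 0\<close> by (auto simp: padic_ideal_def)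
  qed
  thus "\<exists>a b. \<not> int l dvd b \<and> x = of_int a / of_int b" using ab by blast
next
  assume "\<exists>a b. \<not> int l dvd b \<and> x = of_int a / of_int b"
  then obtain a b where ab: "\<not> int l dvd b" "x = of_int a / of_int b" by blast
  hence "b \<noteq> 0" by auto
  show "x \<in> padic_ideal l 0"
    using padic_val_quotient[OF assms, of a b] ab \<open>b \<noteq> 0\<close>
    by (cases "a = 0") (auto simp: padic_ideal_def not_dvd_imp_multiplicity_0)
qed

text \<open>Scaling by a power of \<open>l\<close> reduces the closure of these ideals under addition to the
  localisation at \<open>l\<close>, where it is the addition of fractions.\<close>

lemma padic_ideal_shift:
  assumes "prime l"
  shows "x \<in> padic_ideal l k \<longleftrightarrow> x / of_nat l powi k \<in> padic_ideal l 0"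
  using assms prime_gt_0_nat[OF assms]
  by (cases "x = 0") (simp_all add: padic_ideal_def padic_val_divide padic_val_powi padic_val_prime)

lemma zero_in_padic_ideal [simp]: "0 \<in> padic_ideal l k"
  by (simp add: padic_ideal_def)

lemma padic_ideal_add:
  assumes l: "prime l" and "x \<in> padic_ideal l k" "y \<in> padic_ideal l k"
  shows "x + y \<in> padic_ideal l k"
proof -
  have add: "x + y \<in> padic_ideal l 0" if x: "x \<in> padic_ideal l 0" and y: "y \<in> padic_ideal l 0" for x y
  proof -
    obtain a b c d where ab: "\<not> int l dvd b" "x = of_int a / of_int b"
      and cd: "\<not> int l dvd d" "y = of_int c / of_int d"
      using x y padic_ideal_0_iff[OF l] by metis
    have nz: "b \<noteq> 0" "d \<noteq> 0" using ab cd by auto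
    have "x + y = of_int (a * d + c * b) / of_int (b * d)"
      unfolding ab(2) cd(2) using nz by (simp add: field_simps)
    moreover have "\<not> int l dvd b * d" using ab cd l by (simp add: prime_dvd_mult_iff)
    ultimately show ?thesis using padic_ideal_0_iff[OF l] by blast
  qed
  show ?thesis
    using add[of "x / of_nat l powi k" "y / of_nat l powi k"] assms padic_ideal_shift[OF l]
    by (metis add_divide_distrib)
qed

lemma padic_ideal_uminus: "- x \<in> padic_ideal l k \<longleftrightarrow> x \<in> padic_ideal l k"
  by (auto simp: padic_ideal_def)

lemma padic_ideal_diff:
  assumes "prime l" and "x \<in> padic_ideal l k" "y \<in> padic_ideal l k"
  shows "x - y \<in> padic_ideal l k"
  using padic_ideal_add[of l x k "- y"] assms by (simp add: padic_ideal_uminus)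

lemma padic_ideal_mult:
  assumes "prime l" and "x \<in> padic_ideal l k" "y \<in> padic_ideal l m"
  shows "x * y \<in> padic_ideal l (k + m)"
  using assms by (cases "x = 0 \<or> y = 0") (auto simp: padic_ideal_def padic_val_mult)

lemma padic_ideal_divide:
  assumes "prime l" and "y \<noteq> 0" "x \<in> padic_ideal l (k + padic_val l y)"
  shows "x / y \<in> padic_ideal l k"
  using assms by (cases "x = 0") (auto simp: padic_ideal_def padic_val_divide)

lemma padic_ideal_mono: "x \<in> padic_ideal l k \<Longrightarrow> m \<le> k \<Longrightarrow> x \<in> padic_ideal l m"
  by (auto simp: padic_ideal_def)

lemma padic_ideal_val: "x \<in> padic_ideal l (padic_val l x)"
  by (simp add: padic_ideal_def)

lemma of_int_in_padic_ideal:
  assumes "prime l" shows "of_int a \<in> padic_ideal l 0"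
  using padic_val_of_int[OF assms, of a] by (cases "a = 0") (auto simp: padic_ideal_def)

lemma of_int_in_padic_ideal_iff:
  assumes "prime l"
  shows "of_int a \<in> padic_ideal l (int n) \<longleftrightarrow> int l ^ n dvd a"
proof (cases "a = 0")
  case False
  have "\<not> is_unit (int l)" using assms not_prime_unit prime_nat_int_transfer by blast
  thus ?thesis
    using padic_val_of_int[OF assms False] False
    by (simp add: padic_ideal_def power_dvd_iff_le_multiplicity)
qed auto

text \<open>If \<open>y\<close> is strictly smaller than \<open>x\<close>, adding it cannot change the valuation of \<open>x\<close>: otherwise
  \<open>x = (x + y) - y\<close> would lie in a smaller ideal than it does.\<close>

lemma padic_val_add_eq:
  assumes l: "prime l" and x: "x \<noteq> 0" and y: "y \<in> padic_ideal l (padic_val l x + 1)"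
  shows "x + y \<noteq> 0" "padic_val l (x + y) = padic_val l x"
proof -
  have not: "x \<notin> padic_ideal l (padic_val l x + 1)" using x by (simp add: padic_ideal_def)
  show nz: "x + y \<noteq> 0"
  proof
    assume "x + y = 0"
    hence "x = - y" by simp
    thus False using not y padic_ideal_uminus by metis
  qed
  have "x + y \<in> padic_ideal l (padic_val l x)"
    using l y by (intro padic_ideal_add padic_ideal_val) (auto elim: padic_ideal_mono)
  moreover have "x + y \<notin> padic_ideal l (padic_val l x + 1)"
    using not padic_ideal_diff[OF l _ y, of "x + y"] by auto
  ultimately show "padic_val l (x + y) = padic_val l x" using nz by (auto simp: padic_ideal_def)
qed

lemma padic_abs_le_iff:
  assumes "prime l"
  shows "padic_abs l x \<le> real l powi (- k) \<longleftrightarrow> x \<in> padic_ideal l k"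
proof (cases "x = 0")
  case False
  have l: "real l > 1" using prime_gt_1_nat[OF assms] by simp
  have "real l powi (- padic_val l x) \<le> real l powi (- k) \<longleftrightarrow> k \<le> padic_val l x"
    using power_int_strict_increasing[of "- k" "- padic_val l x" "real l"]
      power_int_increasing[of "- padic_val l x" "- k" "real l"] l by fastforce
  thus ?thesis using False by (simp add: padic_abs_def padic_ideal_def)
qed (auto simp: padic_abs_def padic_ideal_def)

lemma padic_abs_nonneg: "padic_abs l x \<ge> 0"
  by (simp add: padic_abs_def)

lemma exists_power_int_less:
  assumes "prime l" "e > 0"
  obtains k :: int where "real l powi (- k) < e"
proof -
  have "1 / real l < 1" "1 / real l \<ge> 0" using prime_gt_1_nat[OF assms(1)] by auto
  then obtain n where "(1 / real l) ^ n < e" using real_arch_pow_inv assms(2) by blast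
  hence "real l powi (- int n) < e" by (simp add: power_int_minus field_simps)
  thus ?thesis using that by blast
qed

lemma padic_Cauchy_iff:
  assumes l: "prime l"
  shows "padic_Cauchy l X \<longleftrightarrow> (\<forall>k. \<exists>N. \<forall>m\<ge>N. \<forall>n\<ge>N. X m - X n \<in> padic_ideal l k)"
proof
  assume "padic_Cauchy l X"
  moreover have "real l powi (- k) > 0" for k using prime_gt_0_nat[OF l] by auto
  ultimately show "\<forall>k. \<exists>N. \<forall>m\<ge>N. \<forall>n\<ge>N. X m - X n \<in> padic_ideal l k"
    unfolding padic_Cauchy_def padic_abs_le_iff[OF l, symmetric] by (meson less_imp_le)
next
  assume *: "\<forall>k. \<exists>N. \<forall>m\<ge>N. \<forall>n\<ge>N. X m - X n \<in> padic_ideal l k"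
  show "padic_Cauchy l X"
    unfolding padic_Cauchy_def
  proof (intro allI impI)
    fix e :: real assume "e > 0"
    then obtain k where "real l powi (- k) < e" using exists_power_int_less[OF l] by blast
    thus "\<exists>N. \<forall>m\<ge>N. \<forall>n\<ge>N. padic_abs l (X m - X n) < e"
      using * unfolding padic_abs_le_iff[OF l, symmetric] by (meson le_less_trans)
  qed
qed

lemma padic_null_iff:
  assumes l: "prime l"
  shows "X \<in> padic_null l \<longleftrightarrow> (\<forall>k. \<exists>N. \<forall>n\<ge>N. X n \<in> padic_ideal l k)"
proof -
  have "X \<in> padic_null l \<longleftrightarrow> (\<forall>e>0. \<exists>N. \<forall>n\<ge>N. padic_abs l (X n) < e)"
    by (auto simp: padic_null_def LIMSEQ_def padic_abs_nonneg)
  also have "\<dots> \<longleftrightarrow> (\<forall>k. \<exists>N. \<forall>n\<ge>N. X n \<in> padic_ideal l k)"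
  proof
    assume "\<forall>e>0. \<exists>N. \<forall>n\<ge>N. padic_abs l (X n) < e"
    moreover have "real l powi (- k) > 0" for k using prime_gt_0_nat[OF l] by auto
    ultimately show "\<forall>k. \<exists>N. \<forall>n\<ge>N. X n \<in> padic_ideal l k"
      unfolding padic_abs_le_iff[OF l, symmetric] by (meson less_imp_le)
  next
    assume *: "\<forall>k. \<exists>N. \<forall>n\<ge>N. X n \<in> padic_ideal l k"
    show "\<forall>e>0. \<exists>N. \<forall>n\<ge>N. padic_abs l (X n) < e"
    proof (intro allI impI)
      fix e :: real assume "e > 0"
      then obtain k where "real l powi (- k) < e" using exists_power_int_less[OF l] by blast
      thus "\<exists>N. \<forall>n\<ge>N. padic_abs l (X n) < e"
        using * unfolding padic_abs_le_iff[OF l, symmetric] by (meson le_less_trans)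
    qed
  qed
  finally show ?thesis .
qed

section \<open>Square classes and the Kummer map over a field containing the rationals\<close>

locale rat_extension = field R for R :: "'a ring" (structure) +
  fixes \<phi> :: "rat \<Rightarrow> 'a"
  assumes emb_closed [simp]: "\<phi> q \<in> carrier R"
    and emb_add: "\<phi> (q + r) = \<phi> q \<oplus> \<phi> r"
    and emb_mult: "\<phi> (q * r) = \<phi> q \<otimes> \<phi> r"
    and emb_1 [simp]: "\<phi> 1 = \<one>"
begin

lemma nonzero_squaresI:
  "x \<in> carrier R \<Longrightarrow> x \<noteq> \<zero> \<Longrightarrow> x \<otimes> x \<in> nonzero_squares R"
  by (auto simp: nonzero_squares_def)

lemma nonzero_squaresE:
  assumes "s \<in> nonzero_squares R"
  obtains x where "x \<in> carrier R" "x \<noteq> \<zero>" "s = x \<otimes> x"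
  using assms by (auto simp: nonzero_squares_def)

lemma nonzero_squares_carrier:
  "s \<in> nonzero_squares R \<Longrightarrow> s \<in> carrier R \<and> s \<noteq> \<zero>"
  by (auto simp: nonzero_squares_def integral_iff)

lemma nonzero_squares_mult:
  assumes "s \<in> nonzero_squares R" "t \<in> nonzero_squares R"
  shows "s \<otimes> t \<in> nonzero_squares R"
proof -
  obtain x y where "x \<in> carrier R" "x \<noteq> \<zero>" "s = x \<otimes> x" "y \<in> carrier R" "y \<noteq> \<zero>" "t = y \<otimes> y"
    using assms by (auto elim!: nonzero_squaresE)
  moreover from this have "s \<otimes> t = (x \<otimes> y) \<otimes> (x \<otimes> y)" by algebra
  ultimately show ?thesis using nonzero_squaresI[of "x \<otimes> y"] by (simp add: integral_iff)
qed

lemma nonzero_squares_cancel: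
  assumes "s \<in> nonzero_squares R" "t \<in> carrier R" "s \<otimes> t \<in> nonzero_squares R"
  shows "t \<in> nonzero_squares R"
proof -
  obtain x where x: "x \<in> carrier R" "x \<noteq> \<zero>" "s = x \<otimes> x" using assms by (auto elim!: nonzero_squaresE)
  obtain y where y: "y \<in> carrier R" "y \<noteq> \<zero>" "s \<otimes> t = y \<otimes> y" using assms by (auto elim!: nonzero_squaresE)
  have i: "inv x \<in> carrier R" "inv x \<otimes> x = \<one>" "inv x \<noteq> \<zero>"
    using x field_Units Units_inv_Units by auto
  have "t = (inv x \<otimes> x) \<otimes> (inv x \<otimes> x) \<otimes> t" using i assms(2) by simp
  also have "\<dots> = (inv x \<otimes> inv x) \<otimes> (x \<otimes> x \<otimes> t)" using i(1) x(1) assms(2) by algebra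
  also have "x \<otimes> x \<otimes> t = y \<otimes> y" using x y by simp
  also have "(inv x \<otimes> inv x) \<otimes> (y \<otimes> y) = (inv x \<otimes> y) \<otimes> (inv x \<otimes> y)" using i x y(1) by algebra
  finally have t: "t = (inv x \<otimes> y) \<otimes> (inv x \<otimes> y)" .
  show ?thesis
    by (subst t, rule nonzero_squaresI) (use i y in \<open>auto simp: integral_iff\<close>)
qed

lemma one_nonzero_square: "\<one> \<in> nonzero_squares R"
  using nonzero_squaresI[of \<one>] by simp

text \<open>Square classes have exponent 2, so equality of classes can be tested on a product
  instead of a quotient.\<close>

lemma sqclass_eq_iff:
  assumes x: "x \<in> carrier R" "x \<noteq> \<zero>" and y: "y \<in> carrier R" "y \<noteq> \<zero>"
  shows "sqclass R x = sqclass R y \<longleftrightarrow> x \<otimes> y \<in> nonzero_squares R"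
proof
  assume "sqclass R x = sqclass R y"
  moreover have "x \<in> sqclass R x"
    using x one_nonzero_square by (force simp: sqclass_def r_coset_def)
  ultimately obtain s where s: "s \<in> nonzero_squares R" "x = s \<otimes> y"
    by (auto simp: sqclass_def r_coset_def)
  have "x \<otimes> y = s \<otimes> (y \<otimes> y)"
    using s nonzero_squares_carrier[OF s(1)] y by (simp add: m_assoc)
  thus "x \<otimes> y \<in> nonzero_squares R"
    using nonzero_squares_mult[OF s(1) nonzero_squaresI[OF y]] by simp
next
  have *: "sqclass R x \<subseteq> sqclass R y"
    if x: "x \<in> carrier R" "x \<noteq> \<zero>" and y: "y \<in> carrier R" "y \<noteq> \<zero>"
      and xy: "x \<otimes> y \<in> nonzero_squares R" for x y
  proof
    fix z assume "z \<in> sqclass R x"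
    then obtain s where s: "s \<in> nonzero_squares R" "z = s \<otimes> x"
      by (auto simp: sqclass_def r_coset_def)
    have sc: "s \<in> carrier R" using s nonzero_squares_carrier by auto
    have i: "inv y \<in> carrier R" "inv y \<otimes> y = \<one>"
      using y field_Units by (auto simp: Units_inv_closed Units_l_inv)
    have "y \<otimes> y \<otimes> (s \<otimes> x \<otimes> inv y) = s \<otimes> (x \<otimes> y) \<otimes> (inv y \<otimes> y)"
      using sc x y i(1) by algebra
    hence "y \<otimes> y \<otimes> (s \<otimes> x \<otimes> inv y) \<in> nonzero_squares R"
      using i s xy sc x y nonzero_squares_mult by simp
    hence "s \<otimes> x \<otimes> inv y \<in> nonzero_squares R"
      using nonzero_squares_cancel[OF nonzero_squaresI[OF y]] sc x i by simp
    moreover have "z = (s \<otimes> x \<otimes> inv y) \<otimes> y"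
      using s sc x y i by (simp add: m_assoc)
    ultimately show "z \<in> sqclass R y" by (auto simp: sqclass_def r_coset_def)
  qed
  assume "x \<otimes> y \<in> nonzero_squares R"
  thus "sqclass R x = sqclass R y"
    using *[OF x y] *[OF y x] x y by (simp add: m_comm)
qed

lemma emb_0 [simp]: "\<phi> 0 = \<zero>"
  using emb_add[of 0 0] by (metis add_0 emb_closed add.r_cancel_one')

lemma emb_uminus: "\<phi> (- q) = \<ominus> \<phi> q"
  using emb_add[of "- q" q] by (simp add: minus_equality)

lemma emb_diff: "\<phi> (q - r) = \<phi> q \<ominus> \<phi> r"
  using emb_add[of q "- r"] by (simp add: emb_uminus a_minus_def)

lemma emb_eq_0_iff [simp]: "\<phi> q = \<zero> \<longleftrightarrow> q = 0"
proof
  assume "\<phi> q = \<zero>"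
  hence "\<phi> (q * inverse q) = \<zero>" by (simp add: emb_mult)
  thus "q = 0" by (metis emb_1 one_not_zero right_inverse)
qed simp

lemma emb_eq_iff [simp]: "\<phi> q = \<phi> r \<longleftrightarrow> q = r"
  using emb_eq_0_iff[of "q - r"] by (auto simp: emb_diff r_right_minus_eq)

definition local_square :: "rat \<Rightarrow> bool" where
  "local_square q \<longleftrightarrow> \<phi> q \<in> nonzero_squares R"

lemma local_square_nonzero: "local_square q \<Longrightarrow> q \<noteq> 0"
  using nonzero_squares_carrier[of "\<phi> q"] by (auto simp: local_square_def)

lemma local_square_square: "q \<noteq> 0 \<Longrightarrow> local_square (q * q)"
  by (simp add: local_square_def emb_mult nonzero_squaresI)

lemma local_square_mult: "local_square q \<Longrightarrow> local_square r \<Longrightarrow> local_square (q * r)"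
  by (simp add: local_square_def emb_mult nonzero_squares_mult)

lemma local_square_cancel: "local_square q \<Longrightarrow> local_square (q * r) \<Longrightarrow> local_square r"
  using nonzero_squares_cancel by (auto simp: local_square_def emb_mult)

text \<open>Multiplicative relations between square classes are exploited in this form: a product of known
  local squares is recognised as \<open>w\<^sup>2 q\<close>, so \<open>q\<close> is a local square too.\<close>

lemma local_square_mod_square:
  assumes "local_square r" "r = w * w * q" shows "local_square q"
proof -
  have "w \<noteq> 0" using local_square_nonzero assms by force
  thus ?thesis using local_square_cancel[OF local_square_square, of w q] assms by simp
qed

lemma local_square_trans:
  assumes "local_square (q * r)" "local_square (r * s)" shows "local_square (q * s)"
  by (rule local_square_mod_square[OF local_square_mult[OF assms], of r]) (simp add: algebra_simps)

lemma sqclass_emb_eq_iff: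
  "q \<noteq> 0 \<Longrightarrow> r \<noteq> 0 \<Longrightarrow> sqclass R (\<phi> q) = sqclass R (\<phi> r) \<longleftrightarrow> local_square (q * r)"
  by (simp add: sqclass_eq_iff local_square_def emb_mult)

text \<open>All members of a rational square class have the same class over the extension field, which is
  what makes the induced map well defined.\<close>

lemma sqclass_map_sqclass:
  assumes "q \<noteq> 0"
  shows "sqclass_map R \<phi> (sqclass class_ring q) = sqclass R (\<phi> q)"
proof -
  have same: "sqclass R (\<phi> x) = sqclass R (\<phi> q)" if x: "x \<in> sqclass class_ring q" for x
  proof -
    obtain s where "s \<noteq> 0" "x = s * s * q"
      using x by (auto simp: sqclass_def r_coset_def nonzero_squares_def)
    moreover have "x * q = (s * q) * (s * q)" using \<open>x = s * s * q\<close> by (simp add: algebra_simps)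
    moreover have "local_square ((s * q) * (s * q))"
      using \<open>s \<noteq> 0\<close> assms by (intro local_square_square) simp
    moreover have "x \<noteq> 0" using \<open>s \<noteq> 0\<close> \<open>x = s * s * q\<close> assms by simp
    ultimately show ?thesis using assms sqclass_emb_eq_iff[of x q] by metis
  qed
  have "1 \<in> nonzero_squares (class_ring :: rat ring)"
    by (auto simp: nonzero_squares_def intro!: exI[of _ 1])
  hence q: "q \<in> sqclass class_ring q"
    by (auto simp: sqclass_def r_coset_def intro!: bexI[of _ 1])
  have "(\<lambda>x. sqclass R (\<phi> x)) ` sqclass class_ring q = (\<lambda>_. sqclass R (\<phi> q)) ` sqclass class_ring q"
    by (rule image_cong[OF refl same])
  also have "\<dots> = {sqclass R (\<phi> q)}" by (rule image_constant[OF q])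
  finally have "(\<lambda>x. sqclass R (\<phi> x)) ` sqclass class_ring q = {sqclass R (\<phi> q)}" .
  thus ?thesis by (simp add: sqclass_map_def)
qed

end

text \<open>The values of the Kummer map on the four points of order dividing 2.\<close>

definition torsion_classes :: "nat \<Rightarrow> (rat \<times> rat \<times> rat) set" where
  "torsion_classes p =
     {(1, 1, 1), (2, - of_nat p, - 2 * of_nat p), (of_nat p, - 1, - of_nat p),
      (2 * of_nat p, of_nat p, 2)}"

context rat_extension
begin

lemma curve_equation_iff:
  assumes x: "x \<in> carrier R" and y: "y \<in> carrier R"
  shows "Affine x y \<in> curve_points p R \<phi> \<longleftrightarrow>
    y \<otimes> y = (x \<oplus> \<phi> (of_nat p)) \<otimes> x \<otimes> (x \<ominus> \<phi> (of_nat p))"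
proof -
  have 1: "\<phi> (of_nat p ^ 2) = \<phi> (of_nat p) \<otimes> \<phi> (of_nat p)"
    by (simp add: power2_eq_square emb_mult)
  have 2: "y [^] (2::nat) = y \<otimes> y" "x [^] (3::nat) = x \<otimes> x \<otimes> x"
    using x y by (simp_all add: numeral_2_eq_2 numeral_3_eq_3)
  have 3: "x \<otimes> x \<otimes> x \<ominus> a \<otimes> a \<otimes> x = (x \<oplus> a) \<otimes> x \<otimes> (x \<ominus> a)" if "a \<in> carrier R" for a
    using x that by algebra
  show ?thesis
    using x y by (simp add: curve_points_def 1 2 3)
qed

text \<open>A triple with trivial product is in the image of a point outside the 2-torsion as soon as it
  is represented by \<open>x + p\<close>, \<open>x\<close>, \<open>x - p\<close>: the right-hand side of the curve equation is then
  automatically a square.\<close>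

lemma locally_kummer_iff:
  assumes p: "p \<noteq> 0" and abc: "a \<noteq> 0" "b \<noteq> 0" "c \<noteq> 0" "local_square (a * b * c)"
  shows "locally_kummer p R \<phi> (sqclass class_ring a, sqclass class_ring b, sqclass class_ring c) \<longleftrightarrow>
    (\<exists>(s, t, u) \<in> torsion_classes p. local_square (a * s) \<and> local_square (b * t) \<and> local_square (c * u)) \<or>
    (\<exists>x \<in> carrier R. \<phi> a \<otimes> (x \<oplus> \<phi> (of_nat p)) \<in> nonzero_squares R \<and>
       \<phi> b \<otimes> x \<in> nonzero_squares R \<and> \<phi> c \<otimes> (x \<ominus> \<phi> (of_nat p)) \<in> nonzero_squares R)"
    (is "?L \<longleftrightarrow> ?T \<or> ?X")
proof -
  let ?\<pi> = "\<phi> (of_nat p)"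
  let ?abc = "(sqclass R (\<phi> a), sqclass R (\<phi> b), sqclass R (\<phi> c))"
  have L: "?L \<longleftrightarrow> (\<exists>P \<in> curve_points p R \<phi>. ?abc = kummer p R \<phi> P)"
    using abc by (auto simp: locally_kummer_def sqclass_map_sqclass)
  have p': "(of_nat p :: rat) \<noteq> 0" "(of_nat p :: rat) \<noteq> - of_nat p" "(0 :: rat) \<noteq> - of_nat p" using p by auto
  have tor: "?abc = (sqclass R (\<phi> s), sqclass R (\<phi> t), sqclass R (\<phi> u)) \<longleftrightarrow>
      local_square (a * s) \<and> local_square (b * t) \<and> local_square (c * u)"
    if "s \<noteq> 0" "t \<noteq> 0" "u \<noteq> 0" for s t u
    using that abc by (simp add: sqclass_emb_eq_iff)
  have kummer_2: "kummer p R \<phi> (Affine (\<phi> (- of_nat p)) \<zero>) =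
      (sqclass R (\<phi> 2), sqclass R (\<phi> (- of_nat p)), sqclass R (\<phi> (- 2 * of_nat p)))"
    by (simp only: kummer.simps Let_def if_True if_False simp_thms)
  have kummer_0: "kummer p R \<phi> (Affine (\<phi> 0) \<zero>) =
      (sqclass R (\<phi> (of_nat p)), sqclass R (\<phi> (- 1)), sqclass R (\<phi> (- of_nat p)))"
    using p' by (simp only: kummer.simps Let_def if_True if_False simp_thms emb_eq_iff)
  have kummer_p: "kummer p R \<phi> (Affine x \<zero>) =
      (sqclass R (\<phi> (2 * of_nat p)), sqclass R (\<phi> (of_nat p)), sqclass R (\<phi> 2))"
    if "x \<noteq> \<phi> (- of_nat p)" "x \<noteq> \<phi> 0" for x
    using that by (simp only: kummer.simps Let_def if_True if_False simp_thms)
  have triple_iff: "?abc = (sqclass R (x \<oplus> ?\<pi>), sqclass R x, sqclass R (x \<ominus> ?\<pi>)) \<longleftrightarrow>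
      \<phi> a \<otimes> (x \<oplus> ?\<pi>) \<in> nonzero_squares R \<and> \<phi> b \<otimes> x \<in> nonzero_squares R \<and>
      \<phi> c \<otimes> (x \<ominus> ?\<pi>) \<in> nonzero_squares R"
    if "x \<in> carrier R" "x \<oplus> ?\<pi> \<noteq> \<zero>" "x \<noteq> \<zero>" "x \<ominus> ?\<pi> \<noteq> \<zero>" for x
    unfolding prod.inject using that abc by (intro arg_cong2[of _ _ _ _ "(\<and>)"] sqclass_eq_iff) simp_all
  have from_T: "?L" if T: ?T
  proof -
    obtain s t u where stu: "(s, t, u) \<in> torsion_classes p"
      and sq: "local_square (a * s)" "local_square (b * t)" "local_square (c * u)"
      using T by auto
    have *: "?abc = (sqclass R (\<phi> s), sqclass R (\<phi> t), sqclass R (\<phi> u))"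
      by (rule tor[THEN iffD2]) (use sq[THEN local_square_nonzero] sq in auto)
    have pts: "Affine (\<phi> (- of_nat p)) \<zero> \<in> curve_points p R \<phi>"
      "Affine (\<phi> 0) \<zero> \<in> curve_points p R \<phi>" "Affine (\<phi> (of_nat p)) \<zero> \<in> curve_points p R \<phi>"
      "Infinity \<in> curve_points p R \<phi>"
      by (simp_all only: curve_equation_iff emb_closed zero_closed)
         (simp_all add: emb_uminus l_neg curve_points_def a_minus_def r_neg)
    consider "(s, t, u) = (1, 1, 1)" | "(s, t, u) = (2, - of_nat p, - 2 * of_nat p)"
      | "(s, t, u) = (of_nat p, - 1, - of_nat p)" | "(s, t, u) = (2 * of_nat p, of_nat p, 2)"
      using stu by (auto simp: torsion_classes_def)
    then obtain P where "P \<in> curve_points p R \<phi>"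
      "kummer p R \<phi> P = (sqclass R (\<phi> s), sqclass R (\<phi> t), sqclass R (\<phi> u))"
    proof cases
      case 1 thus ?thesis using that[OF pts(4)] by simp
    next
      case 2 thus ?thesis using that[OF pts(1)] kummer_2 by (simp only: prod.inject)
    next
      case 3 thus ?thesis using that[OF pts(2)] kummer_0 by (simp only: prod.inject)
    next
      case 4 thus ?thesis using that[OF pts(3)] kummer_p[of "\<phi> (of_nat p)"] p' by (simp only: prod.inject emb_eq_iff simp_thms)
    qed
    thus ?L using * L by metis
  qed
  have from_X: "?L" if X: ?X
  proof -
    obtain x where x: "x \<in> carrier R" and sq: "\<phi> a \<otimes> (x \<oplus> ?\<pi>) \<in> nonzero_squares R"
      "\<phi> b \<otimes> x \<in> nonzero_squares R" "\<phi> c \<otimes> (x \<ominus> ?\<pi>) \<in> nonzero_squares R"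
      using X by auto
    have nz: "x \<oplus> ?\<pi> \<noteq> \<zero>" "x \<noteq> \<zero>" "x \<ominus> ?\<pi> \<noteq> \<zero>"
      using sq[THEN nonzero_squares_carrier] by (metis r_null emb_closed)+
    have "\<phi> a \<otimes> (x \<oplus> ?\<pi>) \<otimes> (\<phi> b \<otimes> x) \<otimes> (\<phi> c \<otimes> (x \<ominus> ?\<pi>)) \<in> nonzero_squares R"
      using sq nonzero_squares_mult by blast
    also have "\<phi> a \<otimes> (x \<oplus> ?\<pi>) \<otimes> (\<phi> b \<otimes> x) \<otimes> (\<phi> c \<otimes> (x \<ominus> ?\<pi>)) =
        (\<phi> a \<otimes> \<phi> b \<otimes> \<phi> c) \<otimes> ((x \<oplus> ?\<pi>) \<otimes> x \<otimes> (x \<ominus> ?\<pi>))"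
      using x emb_closed[of a] emb_closed[of b] emb_closed[of c] emb_closed[of "of_nat p"] by algebra
    finally have "(x \<oplus> ?\<pi>) \<otimes> x \<otimes> (x \<ominus> ?\<pi>) \<in> nonzero_squares R"
      using nonzero_squares_cancel[of "\<phi> a \<otimes> \<phi> b \<otimes> \<phi> c"] abc(4) x
      by (simp add: local_square_def emb_mult)
    then obtain y where y: "y \<in> carrier R" "y \<noteq> \<zero>" "(x \<oplus> ?\<pi>) \<otimes> x \<otimes> (x \<ominus> ?\<pi>) = y \<otimes> y"
      by (auto elim!: nonzero_squaresE)
    have "Affine x y \<in> curve_points p R \<phi>" using curve_equation_iff x y by simp
    moreover have "?abc = kummer p R \<phi> (Affine x y)"
      unfolding kummer.simps Let_def if_P[OF y(2)] using triple_iff[OF x nz] sq by blast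
    ultimately show ?L using L by metis
  qed
  have to_T_X: "?T \<or> ?X" if L': ?L
  proof -
    obtain P where P: "P \<in> curve_points p R \<phi>" "?abc = kummer p R \<phi> P" using L' L by blast
    show ?thesis
    proof (cases P)
      case Infinity
      have "?abc = (sqclass R (\<phi> 1), sqclass R (\<phi> 1), sqclass R (\<phi> 1))"
        using P(2) unfolding Infinity kummer.simps emb_1 .
      hence "?T" using tor[of 1 1 1] by (force simp: torsion_classes_def)
      thus ?thesis ..
    next
      case (Affine x y)
      have xy: "x \<in> carrier R" "y \<in> carrier R" using P Affine by (auto simp: curve_points_def)
      have eq: "y \<otimes> y = (x \<oplus> ?\<pi>) \<otimes> x \<otimes> (x \<ominus> ?\<pi>)" using P Affine curve_equation_iff xy by simp
      show ?thesis
      proof (cases "y = \<zero>")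
        case False
        hence "y \<otimes> y \<noteq> \<zero>" using xy by (simp add: integral_iff)
        hence nz: "x \<oplus> ?\<pi> \<noteq> \<zero>" "x \<noteq> \<zero>" "x \<ominus> ?\<pi> \<noteq> \<zero>"
          using eq xy by (metis l_null r_null m_closed minus_closed add.m_closed emb_closed)+
        have "?abc = (sqclass R (x \<oplus> ?\<pi>), sqclass R x, sqclass R (x \<ominus> ?\<pi>))"
          using P(2) unfolding Affine kummer.simps Let_def if_P[OF False] .
        hence "?X" using xy(1) triple_iff[OF xy(1) nz] by blast
        thus ?thesis ..
      next
        case True
        consider "x = \<phi> (- of_nat p)" | "x = \<phi> 0" | "x \<noteq> \<phi> (- of_nat p)" "x \<noteq> \<phi> 0" by blast
        hence "?T"
        proof cases
          case 1
          have "local_square (a * 2) \<and> local_square (b * - of_nat p) \<and> local_square (c * (- 2 * of_nat p))"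
            by (rule iffD1[OF tor P(2)[unfolded Affine True 1 kummer_2]]) (use p' in simp_all)
          thus ?thesis by (auto simp: torsion_classes_def)
        next
          case 2
          have "local_square (a * of_nat p) \<and> local_square (b * - 1) \<and> local_square (c * - of_nat p)"
            by (rule iffD1[OF tor P(2)[unfolded Affine True 2 kummer_0]]) (use p' in simp_all)
          thus ?thesis by (auto simp: torsion_classes_def)
        next
          case 3
          have "local_square (a * (2 * of_nat p)) \<and> local_square (b * of_nat p) \<and> local_square (c * 2)"
            by (rule iffD1[OF tor P(2)[unfolded Affine True kummer_p[OF 3]]]) (use p' in simp_all)
          thus ?thesis by (auto simp: torsion_classes_def)
        qed
        thus ?thesis ..
      qed
    qed
  qed
  show ?thesis
    by (rule iffI, erule to_T_X, erule disjE, erule from_T, erule from_X)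
qed

end

section \<open>The field of p-adic numbers\<close>

lemma padic_CauchyD:
  "prime l \<Longrightarrow> padic_Cauchy l X \<Longrightarrow> \<exists>N. \<forall>m\<ge>N. \<forall>n\<ge>N. X m - X n \<in> padic_ideal l k"
  by (simp add: padic_Cauchy_iff)

lemma padic_nullD:
  "prime l \<Longrightarrow> X \<in> padic_null l \<Longrightarrow> \<exists>N. \<forall>n\<ge>N. X n \<in> padic_ideal l k"
  by (simp add: padic_null_iff)

lemma padic_Cauchy_const [simp]: "prime l \<Longrightarrow> padic_Cauchy l (\<lambda>_. q)"
  by (simp add: padic_Cauchy_iff)

lemma padic_Cauchy_add:
  assumes l: "prime l" and X: "padic_Cauchy l X" and Y: "padic_Cauchy l Y"
  shows "padic_Cauchy l (\<lambda>n. X n + Y n)"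
  unfolding padic_Cauchy_iff[OF l]
proof
  fix k
  obtain M N where "\<forall>m\<ge>M. \<forall>n\<ge>M. X m - X n \<in> padic_ideal l k"
    "\<forall>m\<ge>N. \<forall>n\<ge>N. Y m - Y n \<in> padic_ideal l k"
    using padic_CauchyD[OF l X] padic_CauchyD[OF l Y] by meson
  hence "(X m - X n) + (Y m - Y n) \<in> padic_ideal l k" if "m \<ge> max M N" "n \<ge> max M N" for m n
    using that by (intro padic_ideal_add[OF l]) auto
  hence "\<forall>m\<ge>max M N. \<forall>n\<ge>max M N. X m + Y m - (X n + Y n) \<in> padic_ideal l k"
    by (simp add: algebra_simps)
  thus "\<exists>N. \<forall>m\<ge>N. \<forall>n\<ge>N. X m + Y m - (X n + Y n) \<in> padic_ideal l k" by blast
qed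

text \<open>Only finitely many terms lie outside the tail on which the sequence varies by integral amounts.\<close>

lemma padic_Cauchy_bounded:
  assumes l: "prime l" and X: "padic_Cauchy l X"
  obtains k where "\<And>n. X n \<in> padic_ideal l k"
proof -
  obtain N where N: "\<forall>m\<ge>N. \<forall>n\<ge>N. X m - X n \<in> padic_ideal l 0"
    using padic_CauchyD[OF l X] by meson
  define k where "k = Min (insert 0 ((\<lambda>n. padic_val l (X n)) ` {..N}))"
  have *: "X n \<in> padic_ideal l k" if "n \<le> N" for n
  proof -
    have "k \<le> padic_val l (X n)" unfolding k_def using that by (intro Min_le) auto
    thus ?thesis by (rule padic_ideal_mono[OF padic_ideal_val])
  qed
  have "X n \<in> padic_ideal l k" for n
  proof (cases "n \<le> N")
    case False
    have "X n - X N \<in> padic_ideal l k"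
      using N False by (intro padic_ideal_mono[of _ _ 0 k]) (auto simp: k_def)
    thus ?thesis using padic_ideal_add[OF l _ *[of N], of "X n - X N"] by simp
  qed (rule *)
  thus ?thesis by (rule that)
qed

lemma padic_null_mult:
  assumes l: "prime l" and X: "padic_Cauchy l X" and Y: "Y \<in> padic_null l"
  shows "(\<lambda>n. X n * Y n) \<in> padic_null l"
  unfolding padic_null_iff[OF l]
proof
  fix k
  obtain j where j: "\<And>n. X n \<in> padic_ideal l j" using padic_Cauchy_bounded[OF l X] by blast
  obtain N where "\<forall>n\<ge>N. Y n \<in> padic_ideal l (k - j)" using padic_nullD[OF l Y] by blast
  hence "\<forall>n\<ge>N. X n * Y n \<in> padic_ideal l k"
    using padic_ideal_mult[OF l j, of _ "k - j"] by auto
  thus "\<exists>N. \<forall>n\<ge>N. X n * Y n \<in> padic_ideal l k" by blast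
qed

lemma padic_Cauchy_mult:
  assumes l: "prime l" and X: "padic_Cauchy l X" and Y: "padic_Cauchy l Y"
  shows "padic_Cauchy l (\<lambda>n. X n * Y n)"
  unfolding padic_Cauchy_iff[OF l]
proof
  fix k
  obtain i j where ij: "\<And>n. X n \<in> padic_ideal l i" "\<And>n. Y n \<in> padic_ideal l j"
    using padic_Cauchy_bounded l X Y by metis
  obtain M N where M: "\<forall>m\<ge>M. \<forall>n\<ge>M. X m - X n \<in> padic_ideal l (k - j)"
    and N: "\<forall>m\<ge>N. \<forall>n\<ge>N. Y m - Y n \<in> padic_ideal l (k - i)"
    using padic_CauchyD[OF l X] padic_CauchyD[OF l Y] by meson
  have "X m * Y m - X n * Y n \<in> padic_ideal l k" if "m \<ge> max M N" "n \<ge> max M N" for m n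
  proof -
    have "X m * (Y m - Y n) \<in> padic_ideal l k"
      using padic_ideal_mult[OF l ij(1), of "Y m - Y n" "k - i" m] N that by auto
    moreover have "(X m - X n) * Y n \<in> padic_ideal l k"
      using padic_ideal_mult[OF l _ ij(2), of "X m - X n" "k - j" n] M that by auto
    ultimately show ?thesis
      using padic_ideal_add[OF l, of "X m * (Y m - Y n)" k "(X m - X n) * Y n"]
      by (simp add: algebra_simps)
  qed
  thus "\<exists>N. \<forall>m\<ge>N. \<forall>n\<ge>N. X m * Y m - X n * Y n \<in> padic_ideal l k" by blast
qed

lemma padic_Cauchy_uminus: "prime l \<Longrightarrow> padic_Cauchy l X \<Longrightarrow> padic_Cauchy l (\<lambda>n. - X n)"
  using padic_Cauchy_mult[of l "\<lambda>_. - 1" X] by simp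

lemma padic_Cauchy_null:
  assumes l: "prime l" and X: "X \<in> padic_null l" shows "padic_Cauchy l X"
  unfolding padic_Cauchy_iff[OF l]
proof
  fix k
  show "\<exists>N. \<forall>m\<ge>N. \<forall>n\<ge>N. X m - X n \<in> padic_ideal l k"
    using padic_nullD[OF l X, of k] padic_ideal_diff[OF l] by meson
qed

lemma padic_null_add:
  assumes l: "prime l" and X: "X \<in> padic_null l" and Y: "Y \<in> padic_null l"
  shows "(\<lambda>n. X n + Y n) \<in> padic_null l"
  unfolding padic_null_iff[OF l]
proof
  fix k
  obtain M N where "\<forall>n\<ge>M. X n \<in> padic_ideal l k" "\<forall>n\<ge>N. Y n \<in> padic_ideal l k"
    using padic_nullD[OF l X] padic_nullD[OF l Y] by meson
  hence "\<forall>n\<ge>max M N. X n + Y n \<in> padic_ideal l k" using padic_ideal_add[OF l] by auto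
  thus "\<exists>N. \<forall>n\<ge>N. X n + Y n \<in> padic_ideal l k" by blast
qed

lemma const_null_iff: "prime l \<Longrightarrow> (\<lambda>_. q) \<in> padic_null l \<longleftrightarrow> q = 0"
proof
  assume l: "prime l" and "(\<lambda>_. q) \<in> padic_null l"
  hence "q \<in> padic_ideal l (padic_val l q + 1)" using padic_nullD[OF l] by blast
  thus "q = 0" by (simp add: padic_ideal_def)
qed (simp add: padic_null_iff)

text \<open>The valuation of a Cauchy sequence that is not null becomes constant: some late term exceeds the
  variation of the tail, and then all later terms have its valuation.\<close>

lemma padic_Cauchy_nonnull:
  assumes l: "prime l" and X: "padic_Cauchy l X" "X \<notin> padic_null l"
  obtains k N where "\<And>n. n \<ge> N \<Longrightarrow> X n \<noteq> 0 \<and> padic_val l (X n) = k"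
proof -
  obtain k where k: "\<And>N. \<exists>n\<ge>N. X n \<notin> padic_ideal l k" using X(2) by (auto simp: padic_null_iff[OF l])
  obtain N where N: "\<forall>m\<ge>N. \<forall>n\<ge>N. X m - X n \<in> padic_ideal l k" using padic_CauchyD[OF l X(1)] by blast
  obtain n0 where n0: "n0 \<ge> N" "X n0 \<notin> padic_ideal l k" using k by blast
  hence 0: "X n0 \<noteq> 0" "padic_val l (X n0) + 1 \<le> k" by (auto simp: padic_ideal_def)
  have "X n \<noteq> 0 \<and> padic_val l (X n) = padic_val l (X n0)" if "n \<ge> N" for n
  proof -
    have "X n - X n0 \<in> padic_ideal l (padic_val l (X n0) + 1)"
      using N that n0 0 padic_ideal_mono by blast
    from padic_val_add_eq[OF l 0(1) this] show ?thesis by simp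
  qed
  thus ?thesis by (rule that)
qed

text \<open>The eventually constant valuation \<open>k\<close> bounds the inverses, so in
  \<open>1/x - 1/y = (y - x) / (x y)\<close> only the fixed amount \<open>2 k\<close> of precision is lost. The finitely many
  terms that may vanish have the inverse \<open>0\<close>, which is irrelevant in the limit.\<close>

lemma padic_Cauchy_inverse:
  assumes l: "prime l" and X: "padic_Cauchy l X" "X \<notin> padic_null l"
  shows "padic_Cauchy l (\<lambda>n. inverse (X n))" "(\<lambda>n. X n * inverse (X n) - 1) \<in> padic_null l"
proof -
  obtain k N where N: "\<And>n. n \<ge> N \<Longrightarrow> X n \<noteq> 0 \<and> padic_val l (X n) = k"
    using padic_Cauchy_nonnull[OF l X] by blast
  show "padic_Cauchy l (\<lambda>n. inverse (X n))"
    unfolding padic_Cauchy_iff[OF l]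
  proof
    fix j
    obtain M where M: "\<forall>m\<ge>M. \<forall>n\<ge>M. X m - X n \<in> padic_ideal l (j + k + k)"
      using padic_CauchyD[OF l X(1)] by blast
    have "inverse (X m) - inverse (X n) \<in> padic_ideal l j" if "m \<ge> max M N" "n \<ge> max M N" for m n
    proof -
      have nz: "X m \<noteq> 0" "X n \<noteq> 0" using N that by auto
      have "inverse (X m) \<in> padic_ideal l (- k)" "inverse (X n) \<in> padic_ideal l (- k)"
        using N[of m] N[of n] that by (auto simp: padic_ideal_def padic_val_inverse[OF l])
      moreover have "X n - X m \<in> padic_ideal l (j + k + k)" using M that by auto
      ultimately have "(X n - X m) * inverse (X m) * inverse (X n) \<in> padic_ideal l (j + k + k + - k + - k)"
        by (intro padic_ideal_mult[OF l])
      also have "(X n - X m) * inverse (X m) * inverse (X n) = inverse (X m) - inverse (X n)"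
        using nz by (simp add: field_simps)
      finally show ?thesis by simp
    qed
    thus "\<exists>N. \<forall>m\<ge>N. \<forall>n\<ge>N. inverse (X m) - inverse (X n) \<in> padic_ideal l j" by blast
  qed
  show "(\<lambda>n. X n * inverse (X n) - 1) \<in> padic_null l"
    unfolding padic_null_iff[OF l]
  proof (intro allI exI[of _ N] impI)
    fix j n assume "N \<le> n"
    thus "X n * inverse (X n) - 1 \<in> padic_ideal l j" using N[of n] by simp
  qed
qed

lemma padic_Cauchy_ring_simps [simp]:
  "carrier (padic_Cauchy_ring l) = {X. padic_Cauchy l X}"
  "X \<otimes>\<^bsub>padic_Cauchy_ring l\<^esub> Y = (\<lambda>n. X n * Y n)" "X \<oplus>\<^bsub>padic_Cauchy_ring l\<^esub> Y = (\<lambda>n. X n + Y n)"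
  "\<one>\<^bsub>padic_Cauchy_ring l\<^esub> = (\<lambda>_. 1)" "\<zero>\<^bsub>padic_Cauchy_ring l\<^esub> = (\<lambda>_. 0)"
  by (simp_all add: padic_Cauchy_ring_def)

lemma cring_padic_Cauchy_ring:
  assumes l: "prime l" shows "cring (padic_Cauchy_ring l)"
proof (rule cringI)
  show "abelian_group (padic_Cauchy_ring l)"
  proof (rule abelian_groupI)
    fix X assume "X \<in> carrier (padic_Cauchy_ring l)"
    thus "\<exists>Y\<in>carrier (padic_Cauchy_ring l). Y \<oplus>\<^bsub>padic_Cauchy_ring l\<^esub> X = \<zero>\<^bsub>padic_Cauchy_ring l\<^esub>"
      using padic_Cauchy_uminus[OF l] by (intro bexI[of _ "\<lambda>n. - X n"]) auto
  qed (use l in \<open>auto simp: padic_Cauchy_add algebra_simps\<close>)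
  show "comm_monoid (padic_Cauchy_ring l)"
    by (rule comm_monoidI) (use l in \<open>auto simp: padic_Cauchy_mult algebra_simps\<close>)
qed (auto simp: algebra_simps)

lemma padic_Cauchy_ring_uminus:
  assumes l: "prime l" and X: "padic_Cauchy l X"
  shows "\<ominus>\<^bsub>padic_Cauchy_ring l\<^esub> X = (\<lambda>n. - X n)"
proof -
  interpret cring "padic_Cauchy_ring l" by (rule cring_padic_Cauchy_ring[OF l])
  show ?thesis by (rule minus_equality) (use X padic_Cauchy_uminus[OF l X] in auto)
qed

lemma ideal_padic_null:
  assumes l: "prime l" shows "ideal (padic_null l) (padic_Cauchy_ring l)"
proof -
  interpret cring "padic_Cauchy_ring l" by (rule cring_padic_Cauchy_ring[OF l])
  show ?thesis
  proof (rule idealI)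
    show "ring (padic_Cauchy_ring l)" ..
    show "subgroup (padic_null l) (add_monoid (padic_Cauchy_ring l))"
    proof (rule add.subgroupI)
      fix X assume X: "X \<in> padic_null l"
      thus "\<ominus>\<^bsub>padic_Cauchy_ring l\<^esub> X \<in> padic_null l"
        using padic_null_mult[OF l padic_Cauchy_const[OF l] X, of "- 1"]
        by (simp add: padic_Cauchy_ring_uminus[OF l padic_Cauchy_null[OF l X]])
    next
      show "padic_null l \<noteq> {}" using const_null_iff[OF l, of 0] by auto
    qed (use l in \<open>auto simp: padic_Cauchy_null padic_null_add\<close>)
  next
    fix X Y assume XY: "X \<in> padic_null l" "Y \<in> carrier (padic_Cauchy_ring l)"
    have "(\<lambda>n. Y n * X n) \<in> padic_null l" using XY padic_null_mult[OF l] by simp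
    thus "Y \<otimes>\<^bsub>padic_Cauchy_ring l\<^esub> X \<in> padic_null l" "X \<otimes>\<^bsub>padic_Cauchy_ring l\<^esub> Y \<in> padic_null l"
      by (simp_all add: mult.commute)
  qed
qed

definition padic_class :: "nat \<Rightarrow> (nat \<Rightarrow> rat) \<Rightarrow> (nat \<Rightarrow> rat) set" where
  "padic_class l X = padic_null l +>\<^bsub>padic_Cauchy_ring l\<^esub> X"

lemma padic_of_rat_class: "padic_of_rat l q = padic_class l (\<lambda>_. q)"
  by (simp add: padic_of_rat_def padic_class_def)

context
  fixes l :: nat
  assumes l: "prime l"
begin

lemma abelian_subgroup_padic_null: "abelian_subgroup (padic_null l) (padic_Cauchy_ring l)"
proof -
  interpret ideal "padic_null l" "padic_Cauchy_ring l" by (rule ideal_padic_null[OF l])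
  show ?thesis by (rule abelian_subgroupI3) unfold_locales
qed

lemma carrier_padic_field: "carrier (padic_field l) = {padic_class l X | X. padic_Cauchy l X}"
  by (auto simp: padic_field_def FactRing_def A_RCOSETS_def' padic_class_def a_r_coset_def')

lemma padic_class_closed [simp]: "padic_Cauchy l X \<Longrightarrow> padic_class l X \<in> carrier (padic_field l)"
  by (auto simp: carrier_padic_field)

lemma padic_class_mult:
  "padic_Cauchy l X \<Longrightarrow> padic_Cauchy l Y \<Longrightarrow>
   padic_class l X \<otimes>\<^bsub>padic_field l\<^esub> padic_class l Y = padic_class l (\<lambda>n. X n * Y n)"
  using ideal.rcoset_mult_add[OF ideal_padic_null[OF l], of X Y]
  by (simp add: padic_field_def FactRing_def padic_class_def)

lemma padic_class_add:
  "padic_Cauchy l X \<Longrightarrow> padic_Cauchy l Y \<Longrightarrow>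
   padic_class l X \<oplus>\<^bsub>padic_field l\<^esub> padic_class l Y = padic_class l (\<lambda>n. X n + Y n)"
  using abelian_subgroup.a_rcos_sum[OF abelian_subgroup_padic_null, of X Y]
  by (simp add: padic_field_def FactRing_def padic_class_def)

lemma padic_class_one: "\<one>\<^bsub>padic_field l\<^esub> = padic_class l (\<lambda>_. 1)"
  by (simp add: padic_field_def FactRing_def padic_class_def)

lemma padic_class_zero: "\<zero>\<^bsub>padic_field l\<^esub> = padic_class l (\<lambda>_. 0)"
proof -
  interpret ideal "padic_null l" "padic_Cauchy_ring l" by (rule ideal_padic_null[OF l])
  have "padic_null l +>\<^bsub>padic_Cauchy_ring l\<^esub> \<zero>\<^bsub>padic_Cauchy_ring l\<^esub> = padic_null l"
    by (rule a_coset_add_zero) (use padic_Cauchy_null[OF l] in auto)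
  thus ?thesis by (simp add: padic_field_def FactRing_def padic_class_def)
qed

lemma padic_class_eq_iff:
  assumes X: "padic_Cauchy l X" and Y: "padic_Cauchy l Y"
  shows "padic_class l X = padic_class l Y \<longleftrightarrow> (\<lambda>n. X n - Y n) \<in> padic_null l"
proof -
  interpret ideal "padic_null l" "padic_Cauchy_ring l" by (rule ideal_padic_null[OF l])
  have "padic_class l X = padic_class l Y \<longleftrightarrow> X \<ominus>\<^bsub>padic_Cauchy_ring l\<^esub> Y \<in> padic_null l"
    unfolding padic_class_def by (rule quotient_eq_iff_same_a_r_cos[symmetric]) (use X Y ideal_axioms in auto)
  thus ?thesis by (simp add: a_minus_def padic_Cauchy_ring_uminus[OF l Y])
qed

lemma padic_class_eq_0_iff:
  "padic_Cauchy l X \<Longrightarrow> padic_class l X = \<zero>\<^bsub>padic_field l\<^esub> \<longleftrightarrow> X \<in> padic_null l"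
  using padic_class_eq_iff[of X "\<lambda>_. 0"] l by (simp add: padic_class_zero)

lemma field_padic_field: "field (padic_field l)"
proof -
  have cr: "cring (padic_field l)"
    unfolding padic_field_def
    by (rule ideal.quotient_is_cring[OF ideal_padic_null[OF l] cring_padic_Cauchy_ring[OF l]])
  show ?thesis
  proof (rule cring.cring_fieldI2[OF cr])
    show "\<zero>\<^bsub>padic_field l\<^esub> \<noteq> \<one>\<^bsub>padic_field l\<^esub>"
      using padic_class_eq_0_iff[of "\<lambda>_. 1"] const_null_iff[OF l, of 1] l by (auto simp: padic_class_one)
  next
    fix x assume x: "x \<in> carrier (padic_field l)" "x \<noteq> \<zero>\<^bsub>padic_field l\<^esub>"
    then obtain X where X: "x = padic_class l X" "padic_Cauchy l X" by (auto simp: carrier_padic_field)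
    hence "X \<notin> padic_null l" using x padic_class_eq_0_iff by blast
    note inv = padic_Cauchy_inverse[OF l X(2) this]
    have "x \<otimes>\<^bsub>padic_field l\<^esub> padic_class l (\<lambda>n. inverse (X n)) = \<one>\<^bsub>padic_field l\<^esub>"
      using X inv l padic_Cauchy_mult[OF l X(2) inv(1)]
      by (simp add: padic_class_mult padic_class_one padic_class_eq_iff)
    thus "\<exists>y\<in>carrier (padic_field l). x \<otimes>\<^bsub>padic_field l\<^esub> y = \<one>\<^bsub>padic_field l\<^esub>"
      using inv(1) by auto
  qed
qed

lemma rat_extension_padic: "rat_extension (padic_field l) (padic_of_rat l)"
proof -
  show ?thesis
    by (intro rat_extension.intro rat_extension_axioms.intro field_padic_field) (use l in \<open>auto simp: padic_of_rat_class padic_class_one padic_class_add padic_class_mult\<close>)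
qed

end

section \<open>Local squares\<close>

locale finite_place =
  fixes l :: nat
  assumes l: "prime l"
begin

sublocale padic: rat_extension "padic_field l" "padic_of_rat l"
  by (rule rat_extension_padic[OF l])

text \<open>The substitution \<open>s = 1 + 2 t\<close> turns \<open>s\<^sup>2 = 1 + 4 z\<close> into \<open>t = z - t\<^sup>2\<close>, whose right-hand
  side contracts the maximal ideal whatever the residue characteristic is. The iteration can use
  the \<open>n\<close>-th approximation of \<open>z\<close> in its \<open>n\<close>-th step, which solves the equation for all
  \<open>l\<close>-adic \<open>z\<close> and not just for rational ones.\<close>

primrec hensel_iteration :: "(nat \<Rightarrow> rat) \<Rightarrow> nat \<Rightarrow> rat" where
  "hensel_iteration Z 0 = 0"
| "hensel_iteration Z (Suc n) = Z n - hensel_iteration Z n ^ 2"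

lemma hensel:
  assumes Z: "padic_Cauchy l Z" "\<And>n. Z n \<in> padic_ideal l 1"
  obtains T where "padic_Cauchy l T" "(\<lambda>n. T n ^ 2 + T n - Z n) \<in> padic_null l"
proof -
  define T where "T = hensel_iteration Z"
  have T_Suc: "T (Suc n) = Z n - T n ^ 2" for n by (simp add: T_def)
  have T_ideal: "T n \<in> padic_ideal l 1" for n
  proof (induction n)
    case (Suc n)
    have "T n ^ 2 \<in> padic_ideal l 1"
      using padic_ideal_mult[OF l Suc Suc] by (auto simp: power2_eq_square intro: padic_ideal_mono)
    thus ?case unfolding T_Suc by (intro padic_ideal_diff l Z)
  qed (simp add: T_def)
  have step: "\<exists>N. \<forall>n\<ge>N. T (Suc n) - T n \<in> padic_ideal l (int k)" for k
  proof (induction k)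
    case 0
    have "T (Suc n) - T n \<in> padic_ideal l 0" for n
      using padic_ideal_diff[OF l T_ideal T_ideal] by (rule padic_ideal_mono) simp
    thus ?case by simp
  next
    case (Suc k)
    obtain N where N: "\<forall>n\<ge>N. T (Suc n) - T n \<in> padic_ideal l (int k)" using Suc by blast
    obtain M where M: "\<forall>m\<ge>M. \<forall>n\<ge>M. Z m - Z n \<in> padic_ideal l (int (Suc k))"
      using padic_CauchyD[OF l Z(1)] by blast
    have "T (Suc n) - T n \<in> padic_ideal l (int (Suc k))" if n: "n \<ge> Suc (max M N)" for n
    proof -
      obtain m where m: "n = Suc m" "m \<ge> M" "m \<ge> N" using n by (cases n) auto
      have "(T (Suc m) - T m) * (T (Suc m) + T m) \<in> padic_ideal l (int k + 1)"
        using N m by (intro padic_ideal_mult padic_ideal_add l T_ideal) auto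
      moreover have "Z n - Z m \<in> padic_ideal l (int k + 1)" using M m by (simp add: add.commute)
      ultimately have "(Z n - Z m) - (T (Suc m) - T m) * (T (Suc m) + T m) \<in> padic_ideal l (int k + 1)"
        using padic_ideal_diff[OF l] by blast
      also have "(Z n - Z m) - (T (Suc m) - T m) * (T (Suc m) + T m) = T (Suc n) - T n"
      proof -
        have "Z m = T (Suc m) + T m * T m" using T_Suc[of m] by (simp add: power2_eq_square)
        moreover have "T (Suc n) = Z n - T (Suc m) * T (Suc m)"
          using T_Suc[of n] m(1) by (simp add: power2_eq_square)
        ultimately show ?thesis using m(1) by (simp add: algebra_simps)
      qed
      finally show ?thesis by (simp add: add.commute)
    qed
    thus ?case by blast
  qed
  have step': "\<exists>N. \<forall>n\<ge>N. T (Suc n) - T n \<in> padic_ideal l k" for k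
    using step[of "nat k"] padic_ideal_mono[of _ l "int (nat k)" k] by (meson int_nat_eq le_cases nat_le_iff order_refl)
  have "padic_Cauchy l T"
    unfolding padic_Cauchy_iff[OF l]
  proof
    fix k
    obtain N where N: "\<forall>n\<ge>N. T (Suc n) - T n \<in> padic_ideal l k" using step' by blast
    have *: "T (N + j) - T N \<in> padic_ideal l k" for j
    proof (induction j)
      case (Suc j)
      thus ?case using padic_ideal_add[OF l Suc, of "T (Suc (N + j)) - T (N + j)"] N by simp
    qed simp
    have "T m - T n \<in> padic_ideal l k" if "m \<ge> N" "n \<ge> N" for m n
      using padic_ideal_diff[OF l *[of "m - N"] *[of "n - N"]] that by simp
    thus "\<exists>N. \<forall>m\<ge>N. \<forall>n\<ge>N. T m - T n \<in> padic_ideal l k" by blast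
  qed
  moreover have "(\<lambda>n. T n ^ 2 + T n - Z n) \<in> padic_null l"
    unfolding padic_null_iff[OF l]
  proof
    fix k
    have "T n ^ 2 + T n - Z n = - (T (Suc n) - T n)" for n using T_Suc[of n] by simp
    thus "\<exists>N. \<forall>n\<ge>N. T n ^ 2 + T n - Z n \<in> padic_ideal l k"
      using step'[of k] by (simp only: padic_ideal_uminus)
  qed
  ultimately show ?thesis by (rule that)
qed

text \<open>The exponent of \<open>l\<close> in the ideal \<open>4 m\<close>, where \<open>m\<close> is the maximal ideal; it is 1 for odd
  \<open>l\<close> and 3 for \<open>l = 2\<close>.\<close>

definition hensel_depth :: int where
  "hensel_depth = padic_val l 4 + 1"

lemma hensel_depth_pos: "hensel_depth > 0"
  using of_int_in_padic_ideal[OF l, of 4] by (simp add: hensel_depth_def padic_ideal_def)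

text \<open>With \<open>X = 1 + 4 Z\<close> the solution \<open>T\<close> of \<open>T\<^sup>2 + T = Z\<close> gives \<open>(1 + 2 T)\<^sup>2 = X\<close>.\<close>

lemma square_near_1:
  assumes X: "padic_Cauchy l X" "\<And>n. X n - 1 \<in> padic_ideal l hensel_depth"
  shows "padic_class l X \<in> nonzero_squares (padic_field l)"
proof -
  define Z where "Z n = (X n - 1) / 4" for n
  have "padic_Cauchy l Z"
    using padic_Cauchy_mult[OF l padic_Cauchy_add[OF l X(1) padic_Cauchy_const[OF l, of "- 1"]]
        padic_Cauchy_const[OF l, of "1 / 4"]]
    by (simp add: Z_def[abs_def])
  moreover have "Z n \<in> padic_ideal l 1" for n
    unfolding Z_def using X(2)[of n]
    by (intro padic_ideal_divide[OF l]) (auto simp: hensel_depth_def add.commute)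
  ultimately obtain T where T: "padic_Cauchy l T" "(\<lambda>n. T n ^ 2 + T n - Z n) \<in> padic_null l"
    using hensel by blast
  define S where "S n = 1 + 2 * T n" for n
  have S: "padic_Cauchy l S"
    unfolding S_def by (intro padic_Cauchy_add padic_Cauchy_mult padic_Cauchy_const l T)
  have "(\<lambda>n. 4 * (T n ^ 2 + T n - Z n)) \<in> padic_null l"
    by (rule padic_null_mult[OF l padic_Cauchy_const[OF l] T(2)])
  also have "(\<lambda>n. 4 * (T n ^ 2 + T n - Z n)) = (\<lambda>n. S n * S n - X n)"
    by (simp add: S_def Z_def fun_eq_iff power2_eq_square field_simps)
  finally have "padic_class l X = padic_class l S \<otimes>\<^bsub>padic_field l\<^esub> padic_class l S"
    using S X(1) padic_Cauchy_mult[OF l S S] padic_class_eq_iff[OF l, of "\<lambda>n. S n * S n" X]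
    by (simp add: padic_class_mult[OF l])
  moreover have "padic_class l X \<noteq> \<zero>\<^bsub>padic_field l\<^esub>"
  proof
    assume "padic_class l X = \<zero>\<^bsub>padic_field l\<^esub>"
    hence "X \<in> padic_null l" using padic_class_eq_0_iff[OF l X(1)] by simp
    then obtain n where n: "X n \<in> padic_ideal l hensel_depth" using padic_nullD[OF l] by blast
    have "X n - (X n - 1) \<in> padic_ideal l hensel_depth" by (rule padic_ideal_diff[OF l n X(2)])
    thus False using hensel_depth_pos by (simp add: padic_ideal_def)
  qed
  ultimately show ?thesis
    using padic.nonzero_squaresI[OF padic_class_closed[OF l S]] padic.l_null[OF padic_class_closed[OF l S]]
    by metis
qed

text \<open>For large \<open>n\<close> the quotients \<open>X m / X n\<close> with \<open>m \<ge> n\<close> are so close to 1 that their limit is a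
  square. Hence the limit of the sequence has the square class of the rational number \<open>X n\<close>.\<close>

lemma sqclass_approximation:
  assumes X: "padic_Cauchy l X" "X \<notin> padic_null l"
  obtains N where "\<And>n. n \<ge> N \<Longrightarrow> padic_class l X \<otimes>\<^bsub>padic_field l\<^esub> padic_of_rat l (X n) \<in> nonzero_squares (padic_field l)"
proof -
  obtain k N where N: "\<And>n. n \<ge> N \<Longrightarrow> X n \<noteq> 0 \<and> padic_val l (X n) = k"
    using padic_Cauchy_nonnull[OF l X] by blast
  obtain M where M: "\<forall>m\<ge>M. \<forall>n\<ge>M. X m - X n \<in> padic_ideal l (k + hensel_depth)"
    using padic_CauchyD[OF l X(1)] by blast
  have "padic_class l X \<otimes>\<^bsub>padic_field l\<^esub> padic_of_rat l (X n) \<in> nonzero_squares (padic_field l)"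
    if n: "n \<ge> max M N" for n
  proof -
    have Xn: "X n \<noteq> 0" "padic_val l (X n) = k" using N n by auto
    have shift: "(\<lambda>m. X (m + n) - X m) \<in> padic_null l"
      unfolding padic_null_iff[OF l]
    proof
      fix j
      obtain L where "\<forall>m\<ge>L. \<forall>n\<ge>L. X m - X n \<in> padic_ideal l j" using padic_CauchyD[OF l X(1)] by blast
      thus "\<exists>L. \<forall>m\<ge>L. X (m + n) - X m \<in> padic_ideal l j" by (intro exI[of _ L]) simp
    qed
    have X': "padic_Cauchy l (\<lambda>m. X (m + n))"
      using padic_Cauchy_add[OF l padic_Cauchy_null[OF l shift] X(1)] by simp
    define Y where "Y m = X (m + n) / X n" for m
    have Y: "padic_Cauchy l Y"
      using padic_Cauchy_mult[OF l X' padic_Cauchy_const[OF l, of "1 / X n"]] by (simp add: Y_def[abs_def])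
    have "Y m - 1 \<in> padic_ideal l hensel_depth" for m
    proof -
      have "X (m + n) - X n \<in> padic_ideal l (k + hensel_depth)" using M n by simp
      moreover have "Y m - 1 = (X (m + n) - X n) / X n" using Xn by (simp add: Y_def field_simps)
      ultimately show ?thesis
        using Xn by (simp add: padic_ideal_divide[OF l] add.commute)
    qed
    hence Ysq: "padic_class l Y \<in> nonzero_squares (padic_field l)" by (rule square_near_1[OF Y])
    have Xn_sq: "padic_of_rat l (X n * X n) \<in> nonzero_squares (padic_field l)"
      using padic.local_square_square[OF Xn(1)] by (simp add: padic.local_square_def)
    have "(\<lambda>m. X n * (X (m + n) - X m)) \<in> padic_null l"
      by (rule padic_null_mult[OF l padic_Cauchy_const[OF l] shift])
    also have "(\<lambda>m. X n * (X (m + n) - X m)) = (\<lambda>m. Y m * (X n * X n) - X m * X n)"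
      using Xn by (simp add: Y_def fun_eq_iff field_simps)
    finally have "padic_class l Y \<otimes>\<^bsub>padic_field l\<^esub> padic_of_rat l (X n * X n) =
        padic_class l X \<otimes>\<^bsub>padic_field l\<^esub> padic_of_rat l (X n)"
      using X(1) Y l padic_Cauchy_mult[OF l X(1) padic_Cauchy_const[OF l]]
        padic_Cauchy_mult[OF l Y padic_Cauchy_const[OF l]]
      by (simp add: padic_of_rat_class padic_class_mult padic_class_eq_iff)
    thus ?thesis using padic.nonzero_squares_mult[OF Ysq Xn_sq] by simp
  qed
  thus ?thesis by (rule that)
qed

text \<open>Being an \<open>l\<close>-adic square is an open condition, so it can be tested on rational approximations
  of the inverse square root.\<close>

lemma local_square_iff:
  assumes q: "q \<noteq> 0"
  shows "padic.local_square q \<longleftrightarrow> (\<exists>s. s \<noteq> 0 \<and> q * s ^ 2 - 1 \<in> padic_ideal l hensel_depth)"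
proof
  assume "padic.local_square q"
  then obtain y where y: "y \<in> carrier (padic_field l)" "y \<noteq> \<zero>\<^bsub>padic_field l\<^esub>"
    "padic_of_rat l q = y \<otimes>\<^bsub>padic_field l\<^esub> y"
    by (auto simp: padic.local_square_def elim!: padic.nonzero_squaresE)
  then obtain Y where Y: "padic_Cauchy l Y" "y = padic_class l Y" by (auto simp: carrier_padic_field[OF l])
  hence "Y \<notin> padic_null l" using y padic_class_eq_0_iff[OF l] by blast
  then obtain k N where N: "\<And>n. n \<ge> N \<Longrightarrow> Y n \<noteq> 0 \<and> padic_val l (Y n) = k"
    using padic_Cauchy_nonnull[OF l Y(1)] by blast
  have "(\<lambda>n. q - Y n * Y n) \<in> padic_null l"
    using y(3) Y l padic_Cauchy_mult[OF l Y(1) Y(1)]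
    by (simp add: padic_of_rat_class padic_class_mult padic_class_eq_iff)
  then obtain M where M: "\<forall>n\<ge>M. q - Y n * Y n \<in> padic_ideal l (2 * k + hensel_depth)"
    using padic_nullD[OF l] by blast
  define n where "n = max M N"
  have Yn: "Y n \<noteq> 0" "padic_val l (Y n) = k" using N by (auto simp: n_def)
  have "q - Y n * Y n \<in> padic_ideal l (2 * k + hensel_depth)" using M by (simp add: n_def)
  moreover have "q * (1 / Y n) ^ 2 - 1 = (q - Y n * Y n) / (Y n * Y n)"
    using Yn by (simp add: field_simps power2_eq_square)
  ultimately have "q * (1 / Y n) ^ 2 - 1 \<in> padic_ideal l hensel_depth"
    using Yn padic_ideal_divide[OF l, of "Y n * Y n" "q - Y n * Y n" hensel_depth]
    by (simp add: padic_val_mult[OF l] add.commute)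
  thus "\<exists>s. s \<noteq> 0 \<and> q * s ^ 2 - 1 \<in> padic_ideal l hensel_depth" using Yn by (intro exI[of _ "1 / Y n"]) simp
next
  assume "\<exists>s. s \<noteq> 0 \<and> q * s ^ 2 - 1 \<in> padic_ideal l hensel_depth"
  then obtain s where s: "s \<noteq> 0" "q * s ^ 2 - 1 \<in> padic_ideal l hensel_depth" by blast
  have "padic.local_square (q * s ^ 2)"
    using square_near_1[OF padic_Cauchy_const[OF l] s(2)]
    by (simp add: padic.local_square_def padic_of_rat_class)
  thus "padic.local_square q"
    using padic.local_square_cancel[OF padic.local_square_square[OF s(1)], of q]
    by (simp add: power2_eq_square mult.commute)
qed

lemma local_square_1_plus: "z \<in> padic_ideal l hensel_depth \<Longrightarrow> padic.local_square (1 + z)"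
  using square_near_1[OF padic_Cauchy_const[OF l], of "1 + z"]
  by (simp add: padic.local_square_def padic_of_rat_class)

lemma local_square_even_val:
  assumes "padic.local_square q" shows "even (padic_val l q)"
proof -
  have q: "q \<noteq> 0" using padic.local_square_nonzero assms by blast
  obtain s where s: "s \<noteq> 0" "q * s ^ 2 - 1 \<in> padic_ideal l hensel_depth"
    using local_square_iff[OF q] assms by blast
  have "q * s ^ 2 - 1 \<in> padic_ideal l (padic_val l 1 + 1)"
    using s(2) hensel_depth_pos by (auto intro: padic_ideal_mono)
  from padic_val_add_eq(2)[OF l _ this] have "padic_val l (q * s ^ 2) = 0" by simp
  hence "padic_val l q = - 2 * padic_val l s" using q s(1) by (simp add: padic_val_mult[OF l] padic_val_power[OF l])
  thus ?thesis by simp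
qed

text \<open>An \<open>l\<close>-adic \<open>x\<close> can be replaced by a rational approximation that shares the square classes of
  \<open>x + p\<close>, \<open>x\<close> and \<open>x - p\<close> with it. The approximation need not be the coordinate of a rational
  point.\<close>

lemma locally_kummer_padic_iff:
  assumes p: "p \<noteq> 0" and abc: "a \<noteq> 0" "b \<noteq> 0" "c \<noteq> 0" "padic.local_square (a * b * c)"
  shows "locally_kummer p (padic_field l) (padic_of_rat l)
      (sqclass class_ring a, sqclass class_ring b, sqclass class_ring c) \<longleftrightarrow>
    (\<exists>(s, t, u) \<in> torsion_classes p.
       padic.local_square (a * s) \<and> padic.local_square (b * t) \<and> padic.local_square (c * u)) \<or>
    (\<exists>x. padic.local_square (a * (x + of_nat p)) \<and> padic.local_square (b * x) \<and>
       padic.local_square (c * (x - of_nat p)))"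
proof -
  let ?Q = "padic_field l" and ?Sq = "nonzero_squares (padic_field l)"
  have "(\<exists>x\<in>carrier ?Q. padic_of_rat l a \<otimes>\<^bsub>?Q\<^esub> (x \<oplus>\<^bsub>?Q\<^esub> padic_of_rat l (of_nat p)) \<in> ?Sq \<and>
        padic_of_rat l b \<otimes>\<^bsub>?Q\<^esub> x \<in> ?Sq \<and>
        padic_of_rat l c \<otimes>\<^bsub>?Q\<^esub> (x \<ominus>\<^bsub>?Q\<^esub> padic_of_rat l (of_nat p)) \<in> ?Sq) \<longleftrightarrow>
    (\<exists>x. padic.local_square (a * (x + of_nat p)) \<and> padic.local_square (b * x) \<and>
       padic.local_square (c * (x - of_nat p)))"
    (is "?L \<longleftrightarrow> ?R")
  proof
    assume ?R
    then obtain x where "padic.local_square (a * (x + of_nat p))" "padic.local_square (b * x)"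
      "padic.local_square (c * (x - of_nat p))" by blast
    thus ?L
      unfolding padic.local_square_def padic.emb_mult padic.emb_add padic.emb_diff
      by (intro bexI[of _ "padic_of_rat l x"] conjI) auto
  next
    assume ?L
    then obtain x where x: "x \<in> carrier ?Q"
      and sq: "padic_of_rat l a \<otimes>\<^bsub>?Q\<^esub> (x \<oplus>\<^bsub>?Q\<^esub> padic_of_rat l (of_nat p)) \<in> ?Sq"
        "padic_of_rat l b \<otimes>\<^bsub>?Q\<^esub> x \<in> ?Sq"
        "padic_of_rat l c \<otimes>\<^bsub>?Q\<^esub> (x \<ominus>\<^bsub>?Q\<^esub> padic_of_rat l (of_nat p)) \<in> ?Sq" by blast
    obtain X where X: "padic_Cauchy l X" "x = padic_class l X" using x carrier_padic_field[OF l] by auto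
    have approx: "\<exists>N. \<forall>n\<ge>N. padic.local_square (d * (X n + r))"
      if d: "padic_of_rat l d \<otimes>\<^bsub>?Q\<^esub> (x \<oplus>\<^bsub>?Q\<^esub> padic_of_rat l r) \<in> ?Sq" for d r
    proof -
      have Y: "padic_Cauchy l (\<lambda>n. X n + r)" "x \<oplus>\<^bsub>?Q\<^esub> padic_of_rat l r = padic_class l (\<lambda>n. X n + r)"
        using X l padic_Cauchy_add[OF l X(1) padic_Cauchy_const[OF l]]
        by (simp_all add: padic_of_rat_class padic_class_add)
      let ?Y = "padic_class l (\<lambda>n. X n + r)"
      have Yc: "?Y \<in> carrier ?Q" by (rule padic_class_closed[OF l Y(1)])
      have nz: "?Y \<noteq> \<zero>\<^bsub>?Q\<^esub>"
        using d padic.nonzero_squares_carrier[OF d] Y by (metis padic.r_null padic.emb_closed)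
      hence "(\<lambda>n. X n + r) \<notin> padic_null l" using padic_class_eq_0_iff[OF l Y(1)] by blast
      then obtain N where N: "\<And>n. n \<ge> N \<Longrightarrow> ?Y \<otimes>\<^bsub>?Q\<^esub> padic_of_rat l (X n + r) \<in> ?Sq"
        using sqclass_approximation[OF Y(1)] by blast
      have "padic.local_square (d * (X n + r))" if "n \<ge> N" for n
      proof -
        have "(padic_of_rat l d \<otimes>\<^bsub>?Q\<^esub> ?Y) \<otimes>\<^bsub>?Q\<^esub> (?Y \<otimes>\<^bsub>?Q\<^esub> padic_of_rat l (X n + r)) \<in> ?Sq"
          using d N[OF that] Y(2) padic.nonzero_squares_mult by simp
        also have "(padic_of_rat l d \<otimes>\<^bsub>?Q\<^esub> ?Y) \<otimes>\<^bsub>?Q\<^esub> (?Y \<otimes>\<^bsub>?Q\<^esub> padic_of_rat l (X n + r)) =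
            (?Y \<otimes>\<^bsub>?Q\<^esub> ?Y) \<otimes>\<^bsub>?Q\<^esub> padic_of_rat l (d * (X n + r))"
          using Yc by (simp add: padic.emb_mult padic.m_ac)
        finally show ?thesis
          using padic.nonzero_squares_cancel[OF padic.nonzero_squaresI[OF Yc nz]]
          by (simp add: padic.local_square_def)
      qed
      thus ?thesis by blast
    qed
    have x0: "x \<oplus>\<^bsub>?Q\<^esub> padic_of_rat l 0 = x" using x by simp
    have xm: "x \<oplus>\<^bsub>?Q\<^esub> padic_of_rat l (- of_nat p) = x \<ominus>\<^bsub>?Q\<^esub> padic_of_rat l (of_nat p)"
      by (simp add: padic.emb_uminus a_minus_def)
    obtain N1 N2 N3 where "\<forall>n\<ge>N1. padic.local_square (a * (X n + of_nat p))"
      "\<forall>n\<ge>N2. padic.local_square (b * (X n + 0))" "\<forall>n\<ge>N3. padic.local_square (c * (X n + - of_nat p))"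
      using approx[of a "of_nat p"] approx[of b 0] approx[of c "- of_nat p"] sq x0 xm by metis
    hence "padic.local_square (a * (X n + of_nat p)) \<and> padic.local_square (b * X n) \<and>
       padic.local_square (c * (X n - of_nat p))" if "n = max N1 (max N2 N3)" for n
      using that by simp
    thus ?R by blast
  qed
  thus ?thesis using padic.locally_kummer_iff[OF p abc] by simp
qed

end

section \<open>The Kummer image at an odd prime of bad reduction\<close>

context finite_place
begin

lemma local_square_scaled_1_plus:
  assumes "r \<noteq> 0" "z \<in> padic_ideal l (hensel_depth + padic_val l r)"
  shows "padic.local_square ((r + z) * r)"
proof -
  have "padic.local_square (r * r * (1 + z / r))"
    using assms padic_ideal_divide[OF l]
    by (intro padic.local_square_mult padic.local_square_square local_square_1_plus) auto
  also have "r * r * (1 + z / r) = (r + z) * r" using assms(1) by (simp add: field_simps)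
  finally show ?thesis .
qed

lemma hensel_depth_odd:
  assumes "l \<noteq> 2" shows "hensel_depth = 1"
proof -
  have "\<not> int l dvd 2 ^ 2"
    using l assms primes_dvd_imp_eq two_is_prime_nat prime_dvd_power_int int_dvd_int_iff
    by (metis of_nat_numeral prime_nat_int_transfer)
  hence "multiplicity (int l) 4 = 0" by (intro not_dvd_imp_multiplicity_0) simp
  thus ?thesis using padic_val_of_int[OF l, of 4] by (simp add: hensel_depth_def)
qed

text \<open>The three ranges of the valuation of \<open>x\<close>, with \<open>p\<close> for \<open>l\<close> and \<open>\<sim>\<close> for equality of square
  classes:

  \<^item> If it is less than 1, then \<open>x + p \<sim> x \<sim> x - p\<close>. The product of the three is a square, so \<open>x\<close> is
    a square and the class is trivial.
  \<^item> If it is greater than 1, then \<open>x + p \<sim> p\<close> and \<open>x - p \<sim> -p\<close>, so \<open>x \<sim> -1\<close>.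
  \<^item> If it is 1, then the valuation of the product shows that \<open>x + p\<close> or \<open>x - p\<close> is divisible by
    \<open>p\<^sup>2\<close>, so that \<open>x \<sim> -p\<close> or \<open>x \<sim> p\<close>.\<close>

lemma kummer_class_odd:
  assumes l2: "l \<noteq> 2" and nz: "x + of_nat l \<noteq> 0" "x \<noteq> 0" "x - of_nat l \<noteq> 0"
    and sq: "padic.local_square ((x + of_nat l) * x * (x - of_nat l))"
  shows "\<exists>(s, t, u) \<in> torsion_classes l. padic.local_square ((x + of_nat l) * s) \<and> padic.local_square (x * t)"
proof -
  let ?p = "of_nat l :: rat"
  note depth = hensel_depth_odd[OF l2]
  have p: "?p \<noteq> 0" "padic_val l ?p = 1" using l padic_val_prime by (auto simp: prime_gt_0_nat)
  have p2: "padic_val l 2 = 0"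
    using depth padic_val_mult[OF l, of 2 2] by (simp add: hensel_depth_def)
  have near: "padic.local_square ((r + z) * r)" if "r \<noteq> 0" "z \<in> padic_ideal l k" "k > padic_val l r" for r z k
    using that by (intro local_square_scaled_1_plus) (auto simp: depth intro: padic_ideal_mono)
  have p_ideal: "?p \<in> padic_ideal l 1" using padic_ideal_val[of ?p l] p by simp
  consider "padic_val l x < 1" | "padic_val l x > 1" | "padic_val l x = 1" by linarith
  thus ?thesis
  proof cases
    case 1
    have a: "padic.local_square ((x + ?p) * x)" "padic.local_square ((x - ?p) * x)"
      using near[OF nz(2) p_ideal 1] near[of x "- ?p" 1] nz(2) p_ideal 1 by (auto simp: padic_ideal_uminus)
    have x: "padic.local_square x"
      by (rule padic.local_square_mod_square[OF padic.local_square_mult[OF sq padic.local_square_mult[OF a]],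
            of "(x + ?p) * x * (x - ?p)"]) (simp add: algebra_simps)
    hence "padic.local_square (x + ?p)" using padic.local_square_cancel[OF x] a(1) by (simp add: mult.commute)
    thus ?thesis using x by (force simp: torsion_classes_def)
  next
    case 2
    have a: "padic.local_square ((x + ?p) * ?p)" "padic.local_square ((x - ?p) * - ?p)"
      using near[OF p(1) padic_ideal_val[of x]] near[of "- ?p" x "padic_val l x"] padic_ideal_val[of x l] p 2
      by (auto simp: add.commute)
    have "padic.local_square (x * - 1)"
      by (rule padic.local_square_mod_square[OF padic.local_square_mult[OF sq padic.local_square_mult[OF a]],
            of "(x + ?p) * ?p * (x - ?p)"]) (simp add: algebra_simps)
    thus ?thesis using a by (force simp: torsion_classes_def)
  next
    case 3
    have x: "x \<in> padic_ideal l 1" using 3 padic_ideal_val[of x l] by simp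
    have "x + ?p \<in> padic_ideal l 1" "x - ?p \<in> padic_ideal l 1"
      using x p_ideal padic_ideal_add[OF l] padic_ideal_diff[OF l] by blast+
    hence v: "padic_val l (x + ?p) \<ge> 1" "padic_val l (x - ?p) \<ge> 1" using nz by (auto simp: padic_ideal_def)
    have "even (padic_val l ((x + ?p) * x * (x - ?p)))" by (rule local_square_even_val[OF sq])
    hence "even (padic_val l (x + ?p) + 1 + padic_val l (x - ?p))"
      using nz 3 by (simp add: padic_val_mult[OF l])
    hence "padic_val l (x + ?p) \<noteq> 1 \<or> padic_val l (x - ?p) \<noteq> 1" by auto
    hence "x + ?p \<in> padic_ideal l 2 \<or> x - ?p \<in> padic_ideal l 2" using v by (auto simp: padic_ideal_def)
    moreover have "padic_val l (2 * ?p) = 1" using p p2 by (simp add: padic_val_mult[OF l])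
    ultimately consider
        (plus) "x + ?p \<in> padic_ideal l 2" "padic_val l (2 * ?p) = 1" 
      | (minus) "x - ?p \<in> padic_ideal l 2" "padic_val l (2 * ?p) = 1" by blast
    thus ?thesis
    proof cases
      case plus
      have a: "padic.local_square (x * - ?p)" "padic.local_square ((x - ?p) * (- (2 * ?p)))"
        using near[of "- ?p" "x + ?p" 2] near[of "- (2 * ?p)" "x + ?p" 2] p plus by (auto simp: algebra_simps)
      have "padic.local_square ((x + ?p) * 2)"
        by (rule padic.local_square_mod_square[OF padic.local_square_mult[OF sq padic.local_square_mult[OF a]],
            of "x * ?p * (x - ?p)"]) (simp add: algebra_simps)
      thus ?thesis using a by (force simp: torsion_classes_def)
    next
      case minus
      have "padic.local_square (x * ?p)" "padic.local_square ((x + ?p) * (2 * ?p))"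
        using near[of "?p" "x - ?p" 2] near[of "2 * ?p" "x - ?p" 2] p minus by (auto simp: algebra_simps)
      thus ?thesis by (force simp: torsion_classes_def)
    qed
  qed
qed

lemma torsion_classes_product: 
  assumes "(s, t, u) \<in> torsion_classes p" "p \<noteq> 0"
  shows "padic.local_square (s * t * u)"
proof -
  have "padic.local_square (1 * 1)" "padic.local_square ((2 * of_nat p) * (2 * of_nat p))"
    "padic.local_square (of_nat p * of_nat p)"
    using assms(2) by (intro padic.local_square_square; simp)+
  thus ?thesis using assms(1) by (auto simp: torsion_classes_def algebra_simps)
qed

text \<open>The third component of a class is determined by the first two, since the product is trivial.\<close>

theorem kummer_image_odd:
  assumes l2: "l \<noteq> 2" and abc: "a \<noteq> 0" "b \<noteq> 0" "c \<noteq> 0" "padic.local_square (a * b * c)"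
  shows "locally_kummer l (padic_field l) (padic_of_rat l)
      (sqclass class_ring a, sqclass class_ring b, sqclass class_ring c) \<longleftrightarrow>
    (\<exists>(s, t, u) \<in> torsion_classes l. padic.local_square (a * s) \<and> padic.local_square (b * t))"
proof -
  have l0: "l \<noteq> 0" using l by auto
  have "\<exists>(s, t, u) \<in> torsion_classes l. padic.local_square (a * s) \<and> padic.local_square (b * t)"
    if x: "padic.local_square (a * (x + of_nat l))" "padic.local_square (b * x)"
      "padic.local_square (c * (x - of_nat l))" for x
  proof -
    have nz: "x + of_nat l \<noteq> 0" "x \<noteq> 0" "x - of_nat l \<noteq> 0"
      using x[THEN padic.local_square_nonzero] by auto
    have "padic.local_square ((x + of_nat l) * x * (x - of_nat l))"
      by (rule padic.local_square_mod_square[OF padic.local_square_mult[OF abc(4)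
            padic.local_square_mult[OF x(1) padic.local_square_mult[OF x(2,3)]]], of "a * b * c"])
         (simp add: algebra_simps)
    from kummer_class_odd[OF l2 nz this] obtain s t u where
      "(s, t, u) \<in> torsion_classes l" "padic.local_square ((x + of_nat l) * s)" "padic.local_square (x * t)"
      by blast
    thus ?thesis using padic.local_square_trans x by blast
  qed
  moreover have "padic.local_square (c * u)"
    if "(s, t, u) \<in> torsion_classes l" "padic.local_square (a * s)" "padic.local_square (b * t)" for s t u
    by (rule padic.local_square_mod_square[OF padic.local_square_mult[OF abc(4)
            padic.local_square_mult[OF torsion_classes_product[OF that(1) l0] padic.local_square_mult[OF that(2,3)]]],
          of "a * b * s * t"])
       (simp add: algebra_simps)
  ultimately show ?thesis
    unfolding locally_kummer_padic_iff[OF l0 abc] by blast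
qed

end

section \<open>The Kummer image at 2\<close>

context finite_place
begin

lemma padic_val_2_eq: "l = 2 \<Longrightarrow> padic_val l 2 = 1"
  using padic_val_prime[OF l] by simp

lemma hensel_depth_2: "l = 2 \<Longrightarrow> hensel_depth = 3"
  unfolding hensel_depth_def using padic_val_mult[OF l, of 2 2] padic_val_2_eq by simp

lemma two_adic_unit:
  assumes "l = 2" "x \<noteq> 0" "padic_val l x = 0"
  obtains a b where "odd a" "odd b" "x = of_int a / of_int b"
proof -
  have "x \<in> padic_ideal l 0" using assms(3) by (simp add: padic_ideal_def)
  then obtain a b where ab: "\<not> int l dvd b" "x = of_int a / of_int b"
    using padic_ideal_0_iff[OF l] by blast
  have "a \<noteq> 0" "b \<noteq> 0" using ab assms by auto
  have b: "odd b" using ab(1) assms(1) by simp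
  have "multiplicity (int l) b = 0" by (rule not_dvd_imp_multiplicity_0[OF ab(1)])
  hence "multiplicity (int l) a = 0"
    using padic_val_quotient[OF l \<open>a \<noteq> 0\<close> \<open>b \<noteq> 0\<close>] ab assms by simp
  hence "odd a" using \<open>a \<noteq> 0\<close> assms(1) by (auto simp: multiplicity_eq_zero_iff)
  thus ?thesis using that b ab by blast
qed

text \<open>The residue field has two elements.\<close>

lemma two_adic_units_add:
  assumes "l = 2" "x \<noteq> 0" "padic_val l x = 0" "y \<noteq> 0" "padic_val l y = 0"
  shows "x + y \<in> padic_ideal l 1"
proof -
  obtain a b where ab: "odd a" "odd b" "x = of_int a / of_int b" using two_adic_unit assms by metis
  obtain c d where cd: "odd c" "odd d" "y = of_int c / of_int d" using two_adic_unit assms by metis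
  have nz: "b \<noteq> 0" "d \<noteq> 0" using ab cd by auto
  have bd: "\<not> int l dvd b * d" using ab cd assms by simp
  have "padic_val l (of_int (b * d)) = 0"
    using padic_val_of_int[OF l, of "b * d"] nz not_dvd_imp_multiplicity_0[OF bd] by simp
  moreover have "of_int (a * d + c * b) \<in> padic_ideal l (int 1)"
    unfolding of_int_in_padic_ideal_iff[OF l] using ab cd assms by simp
  ultimately have "of_int (a * d + c * b) / of_int (b * d) \<in> padic_ideal l 1"
    using nz by (intro padic_ideal_divide[OF l]) auto
  also have "of_int (a * d + c * b) / of_int (b * d) = x + y"
    unfolding ab(3) cd(3) using nz by (simp add: field_simps)
  finally show ?thesis .
qed

text \<open>Here \<open>z = 4 u\<close> with a unit \<open>u\<close>, which is congruent to 1 modulo 2. So \<open>1 + z\<close> differs from 5 by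
  the multiple \<open>4 (u - 1)\<close> of 8.\<close>

lemma sqclass_1_plus_4:
  assumes l2: "l = 2" and z: "z \<noteq> 0" "padic_val l z = 2"
  shows "padic.local_square (5 * (1 + z))"
proof -
  define u where "u = z / 4"
  have v4: "padic_val l 4 = 2" using hensel_depth_2[OF l2] by (simp add: hensel_depth_def)
  have u: "u \<noteq> 0" "padic_val l u = 0" using z v4 by (auto simp: u_def padic_val_divide[OF l])
  have "u + - 1 \<in> padic_ideal l 1" using two_adic_units_add[OF l2 u, of "- 1"] by simp
  hence "4 * (u - 1) \<in> padic_ideal l (2 + 1)"
    using padic_ideal_mult[OF l padic_ideal_val[of 4], of "u - 1" 1] v4 by simp
  hence w: "z - 4 \<in> padic_ideal l (hensel_depth + padic_val l 5)"
    using l2 hensel_depth_2 padic_val_of_int[OF l, of 5] not_dvd_imp_multiplicity_0[of 2 "5::int"]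
    by (simp add: u_def algebra_simps)
  have "padic.local_square ((5 + (z - 4)) * 5)" by (rule local_square_scaled_1_plus[OF _ w]) simp
  thus ?thesis by (simp add: algebra_simps)
qed

text \<open>The units congruent to 1 modulo 4 form the two square classes of 1 and 5, and \<open>1 + z\<close> and \<open>1 - z\<close>
  are congruent modulo 8 when 4 divides \<open>z\<close>.\<close>

lemma sqclass_1_plus_minus:
  assumes l2: "l = 2" and r: "r \<noteq> 0" and z: "z \<in> padic_ideal l (2 + padic_val l r)"
  obtains e where "e \<in> {1, 5}" "padic.local_square ((r + z) * (r * e))" "padic.local_square ((r - z) * (r * e))"
proof (cases "z \<in> padic_ideal l (3 + padic_val l r)")
  case True
  hence "z \<in> padic_ideal l (hensel_depth + padic_val l r)" "- z \<in> padic_ideal l (hensel_depth + padic_val l r)"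
    using hensel_depth_2[OF l2] by (simp_all add: padic_ideal_uminus)
  thus ?thesis using that[of 1] local_square_scaled_1_plus[OF r] by fastforce
next
  case False
  hence z: "z \<noteq> 0" "padic_val l (z / r) = 2" using z r by (auto simp: padic_ideal_def padic_val_divide[OF l])
  have sq: "padic.local_square (r * r * (5 * (1 + z / r)))" "padic.local_square (r * r * (5 * (1 + - z / r)))"
    using z r by (intro padic.local_square_mult padic.local_square_square sqclass_1_plus_4 l2; simp)+
  have eq: "r * r * (5 * (1 + z / r)) = (r + z) * (r * 5)" "r * r * (5 * (1 + - z / r)) = (r - z) * (r * 5)"
    using r by (simp_all add: field_simps)
  show ?thesis by (rule that[of 5]) (use sq[unfolded eq] in simp_all)
qed

text \<open>The three ranges of the valuation of \<open>x\<close>, with \<open>\<sim>\<close> for equality of square classes and \<open>e\<close> for 1 or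
  5. The valuation of the square \<open>(x + p) x (x - p)\<close> is even.

  \<^item> If it is negative, then it is even, hence at most \<open>-2\<close>, and \<open>x + p \<sim> e x \<sim> x - p\<close>. The product of
    the three being a square, so is \<open>x\<close>.
  \<^item> If it is positive, then it is even, hence at least 2, and \<open>x + p \<sim> e p\<close>, \<open>x - p \<sim> -e p\<close>, so
    \<open>x \<sim> -1\<close>.
  \<^item> If it is zero, then \<open>x + p\<close> and \<open>x - p\<close> are even, but only one of them is divisible by 4 as
    their difference is \<open>2 p\<close>. The parity of the valuations forces that one to be divisible by 8,
    so \<open>x \<sim> -p\<close> or \<open>x \<sim> p\<close>, and the other one is \<open>\<sim> -2 e p\<close> or \<open>\<sim> 2 e p\<close>.\<close>

lemma kummer_class_2:
  assumes l2: "l = 2" and p: "odd p"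
    and nz: "x + of_nat p \<noteq> 0" "x \<noteq> 0" "x - of_nat p \<noteq> 0"
    and sq: "padic.local_square ((x + of_nat p) * x * (x - of_nat p))"
  shows "\<exists>(s, t, u) \<in> torsion_classes p. \<exists>e \<in> {1, 5}.
    padic.local_square ((x + of_nat p) * (s * e)) \<and> padic.local_square (x * t)"
proof -
  let ?p = "of_nat p :: rat"
  have "p \<noteq> 0" "odd (int p)" using p by (metis even_zero) (use p in simp)
  hence p0: "?p \<noteq> 0" "padic_val l ?p = 0"
    using padic_val_of_int[OF l, of "int p"] not_dvd_imp_multiplicity_0[of 2 "int p"] l2 by auto
  have v2: "padic_val l 2 = 1" "padic_val l (2 * ?p) = 1"
    using padic_val_2_eq[OF l2] p0 by (simp_all add: padic_val_mult[OF l])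
  have "even (padic_val l ((x + ?p) * x * (x - ?p)))" by (rule local_square_even_val[OF sq])
  hence ev: "even (padic_val l (x + ?p) + padic_val l x + padic_val l (x - ?p))"
    using nz by (simp add: padic_val_mult[OF l])
  have e2: "padic.local_square (e * e)" if "e \<in> {1, 5 :: rat}" for e
    using that by (intro padic.local_square_square) auto
  consider "padic_val l x < 0" | "padic_val l x > 0" | "padic_val l x = 0" by linarith
  thus ?thesis
  proof cases
    case 1
    have pi: "?p \<in> padic_ideal l (padic_val l x + 1)" "- ?p \<in> padic_ideal l (padic_val l x + 1)"
      using p0 1 by (auto simp: padic_ideal_def)
    have "padic_val l (x + ?p) = padic_val l x" "padic_val l (x - ?p) = padic_val l x"
      using padic_val_add_eq(2)[OF l nz(2) pi(1)] padic_val_add_eq(2)[OF l nz(2) pi(2)] by auto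
    hence "even (padic_val l x)" using ev by simp
    hence "padic_val l x \<le> - 2" using 1 by presburger
    hence "?p \<in> padic_ideal l (2 + padic_val l x)" using p0 by (simp add: padic_ideal_def)
    then obtain e where e: "e \<in> {1, 5}" "padic.local_square ((x + ?p) * (x * e))" "padic.local_square ((x - ?p) * (x * e))"
      using sqclass_1_plus_minus[OF l2 nz(2)] by blast
    have x: "padic.local_square x"
      by (rule padic.local_square_mod_square[OF padic.local_square_mult[OF sq padic.local_square_mult[OF e(2,3)]],
            of "(x + ?p) * x * (x - ?p) * e"]) (simp add: algebra_simps)
    have "padic.local_square ((x + ?p) * e)"
      by (rule padic.local_square_cancel[OF x]) (use e(2) in \<open>simp add: algebra_simps\<close>)
    thus ?thesis using x e(1) by (force simp: torsion_classes_def)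
  next
    case 2
    have x1: "x \<in> padic_ideal l (padic_val l ?p + 1)" "x \<in> padic_ideal l (padic_val l (- ?p) + 1)"
      using 2 p0 by (auto simp: padic_ideal_def)
    have "padic_val l (x + ?p) = 0" "padic_val l (x - ?p) = 0"
      using padic_val_add_eq(2)[OF l p0(1) x1(1)] padic_val_add_eq(2)[OF l _ x1(2)] p0 by (auto simp: add.commute)
    hence "even (padic_val l x)" using ev by simp
    hence "padic_val l x \<ge> 2" using 2 by presburger
    hence "x \<in> padic_ideal l (2 + padic_val l ?p)" using p0 by (simp add: padic_ideal_def)
    then obtain e where e: "e \<in> {1, 5}" "padic.local_square ((?p + x) * (?p * e))" "padic.local_square ((?p - x) * (?p * e))"
      using sqclass_1_plus_minus[OF l2 p0(1)] by blast
    have "padic.local_square (x * - 1)"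
      by (rule padic.local_square_mod_square[OF padic.local_square_mult[OF sq padic.local_square_mult[OF e(2,3)]],
            of "(x + ?p) * ?p * (x - ?p) * e"]) (simp add: algebra_simps)
    thus ?thesis using e(1,2) by (force simp: torsion_classes_def add.commute)
  next
    case 3
    have "x + ?p \<in> padic_ideal l 1" "x + - ?p \<in> padic_ideal l 1"
      using two_adic_units_add[OF l2 nz(2) 3, of ?p] two_adic_units_add[OF l2 nz(2) 3, of "- ?p"] p0 by auto
    hence v: "padic_val l (x + ?p) \<ge> 1" "padic_val l (x - ?p) \<ge> 1" using nz by (auto simp: padic_ideal_def)
    have ev': "even (padic_val l (x + ?p) + padic_val l (x - ?p))" using ev 3 by simp
    have not_both: False if "padic_val l (x + ?p) = 1" "padic_val l (x - ?p) = 1"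
    proof -
      have "(x + ?p) / 2 + (x - ?p) / 2 \<in> padic_ideal l 1"
        using that v2 nz by (intro two_adic_units_add l2) (auto simp: padic_val_divide[OF l])
      hence "x \<in> padic_ideal l 1" by (simp add: field_simps)
      thus False using nz(2) 3 by (simp add: padic_ideal_def)
    qed
    have one: "padic_val l (x - ?p) = 1" if "padic_val l (x + ?p) \<ge> 2"
    proof -
      have "x + ?p \<in> padic_ideal l (padic_val l (- (2 * ?p)) + 1)" using that v2 by (simp add: padic_ideal_def)
      from padic_val_add_eq(2)[OF l _ this] show ?thesis using p0 v2 by (simp add: algebra_simps)
    qed
    have "x + ?p \<in> padic_ideal l 3 \<or> x - ?p \<in> padic_ideal l 3"
    proof (cases "padic_val l (x + ?p) \<ge> 2")
      case True
      hence "padic_val l (x + ?p) \<ge> 3" using one ev' by presburger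
      thus ?thesis by (simp add: padic_ideal_def)
    next
      case False
      hence "padic_val l (x + ?p) = 1" using v by linarith
      hence "padic_val l (x - ?p) \<ge> 3" using not_both v ev' by presburger
      thus ?thesis by (simp add: padic_ideal_def)
    qed
    thus ?thesis
    proof
      assume *: "x + ?p \<in> padic_ideal l 3"
      hence "x + ?p \<in> padic_ideal l (hensel_depth + padic_val l (- ?p))"
        using p0 by (simp add: hensel_depth_2[OF l2])
      hence x: "padic.local_square (x * - ?p)"
        using local_square_scaled_1_plus[of "- ?p" "x + ?p"] p0 by simp
      obtain e where e: "e \<in> {1, 5}" "padic.local_square ((- (2 * ?p) + (x + ?p)) * (- (2 * ?p) * e))"
        using sqclass_1_plus_minus[OF l2, of "- (2 * ?p)" "x + ?p"] * v2 p0 by auto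
      have "- (2 * ?p) + (x + ?p) = x - ?p" by simp
      with e(2) have e': "padic.local_square ((x - ?p) * (- (2 * ?p) * e))" by metis
      have "padic.local_square ((x + ?p) * (2 * e))"
        by (rule padic.local_square_mod_square[OF padic.local_square_mult[OF sq padic.local_square_mult[OF x e']],
            of "x * ?p * (x - ?p)"]) (simp add: algebra_simps)
      thus ?thesis using e(1) x by (force simp: torsion_classes_def)
    next
      assume *: "x - ?p \<in> padic_ideal l 3"
      hence "x - ?p \<in> padic_ideal l (hensel_depth + padic_val l ?p)"
        using p0 by (simp add: hensel_depth_2[OF l2])
      hence x: "padic.local_square (x * ?p)"
        using local_square_scaled_1_plus[of ?p "x - ?p"] p0 by simp
      obtain e where e: "e \<in> {1, 5}" "padic.local_square ((2 * ?p + (x - ?p)) * (2 * ?p * e))"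
        using sqclass_1_plus_minus[OF l2, of "2 * ?p" "x - ?p"] * v2 p0 by auto
      have "2 * ?p + (x - ?p) = x + ?p" by simp
      with e(2) have "padic.local_square ((x + ?p) * (2 * ?p * e))" by metis
      thus ?thesis using e(1) x by (force simp: torsion_classes_def)
    qed
  qed
qed

text \<open>Besides the torsion there is the point with \<open>x = 1/4\<close>, whose right-hand side
  \<open>(1 - 16 p\<^sup>2) / 64\<close> is a 2-adic square. The four witnesses are the \<open>x\<close>-coordinates of its
  translates by the torsion points.\<close>

lemma two_adic_points:
  assumes l2: "l = 2" and p: "odd p" and stu: "(s, t, u) \<in> torsion_classes p"
  obtains x where "padic.local_square ((x + of_nat p) * (s * 5))" "padic.local_square (x * t)"
    "padic.local_square ((x - of_nat p) * (u * 5))"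
proof -
  let ?p = "of_nat p :: rat"
  have "p \<noteq> 0" "odd (int p)" using p by (metis even_zero) (use p in simp)
  hence p0: "?p \<noteq> 0" "padic_val l ?p = 0"
    using padic_val_of_int[OF l, of "int p"] not_dvd_imp_multiplicity_0[of 2 "int p"] l2 by auto
  have v4: "padic_val l 4 = 2" using hensel_depth_2[OF l2] by (simp add: hensel_depth_def)
  have plus: "padic.local_square (5 * (1 + 4 * ?p))" and minus: "padic.local_square (5 * (1 + - 4 * ?p))"
    using p0 v4 padic_val_uminus[of l "4 * ?p"]
    by (intro sqclass_1_plus_4[OF l2]; simp add: padic_val_mult[OF l])+
  have nz: "1 + 4 * ?p \<noteq> 0" "1 - 4 * ?p \<noteq> 0"
    using padic.local_square_nonzero[OF plus] padic.local_square_nonzero[OF minus] by auto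
  have prod: "padic.local_square ((1 + 4 * ?p) * (1 - 4 * ?p))"
    by (rule padic.local_square_mod_square[OF padic.local_square_mult[OF plus minus], of 5])
       (simp add: algebra_simps)
  have scale: "padic.local_square q" if "w \<noteq> 0" "q = w * w * r" "padic.local_square r" for q w r
    using that padic.local_square_mult[OF padic.local_square_square] by blast
  consider "(s, t, u) = (1, 1, 1)" | "(s, t, u) = (2, - ?p, - 2 * ?p)"
    | "(s, t, u) = (?p, - 1, - ?p)" | "(s, t, u) = (2 * ?p, ?p, 2)"
    using stu by (auto simp: torsion_classes_def)
  thus ?thesis
  proof cases
    case 1
    show ?thesis
    proof (rule that[of "1 / 4"])
      show "padic.local_square ((1 / 4 + ?p) * (s * 5))"
        by (rule scale[OF _ _ plus, of "1 / 2"]) (use 1 in \<open>simp_all add: field_simps\<close>)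
      show "padic.local_square ((1 / 4 - ?p) * (u * 5))"
        by (rule scale[OF _ _ minus, of "1 / 2"]) (use 1 in \<open>simp_all add: field_simps\<close>)
      show "padic.local_square (1 / 4 * t)"
        using padic.local_square_square[of "1 / 2"] 1 by simp
    qed
  next
    case 2
    \<comment> \<open>In terms of \<open>d\<close> alone, the identities to be checked are ones of rational functions.\<close>
    define d where "d = 1 + 4 * ?p"
    have d: "d \<noteq> 0" "?p = (d - 1) / 4" using nz by (auto simp: d_def)
    have stu: "s = 2" "t = - ((d - 1) / 4)" "u = - 2 * ((d - 1) / 4)" using 2 d(2) by simp_all
    have sq: "padic.local_square (5 * d)" "padic.local_square (d * (2 - d))"
      using plus prod by (simp_all add: d_def)
    show ?thesis
    proof (rule that[of "- ?p * (2 - d) / d"])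
      show "padic.local_square ((- ?p * (2 - d) / d + ?p) * (s * 5))"
        by (rule scale[OF _ _ sq(1), of "4 * ?p / d"])
           (use p0 d in simp, use d(1) in \<open>simp add: stu d(2) field_simps\<close>)
      show "padic.local_square ((- ?p * (2 - d) / d - ?p) * (u * 5))"
        by (rule scale[OF _ _ sq(1), of "2 * ?p / d"])
           (use p0 d in simp, use d(1) in \<open>simp add: stu d(2) field_simps\<close>)
      show "padic.local_square (- ?p * (2 - d) / d * t)"
        by (rule scale[OF _ _ sq(2), of "?p / d"])
           (use p0 d in simp, use d(1) in \<open>simp add: stu d(2) field_simps\<close>)
    qed
  next
    case 3
    show ?thesis
    proof (rule that[of "- 4 * ?p * ?p"])
      show "padic.local_square ((- 4 * ?p * ?p + ?p) * (s * 5))"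
        by (rule scale[OF _ _ minus, of ?p]) (use 3 p0 in \<open>simp_all add: field_simps\<close>)
      show "padic.local_square ((- 4 * ?p * ?p - ?p) * (u * 5))"
        by (rule scale[OF _ _ plus, of ?p]) (use 3 p0 in \<open>simp_all add: field_simps\<close>)
      show "padic.local_square (- 4 * ?p * ?p * t)"
        using padic.local_square_square[of "2 * ?p"] 3 p0 by (simp add: mult.assoc)
    qed
  next
    case 4
    define d where "d = 1 - 4 * ?p"
    have d: "d \<noteq> 0" "?p = (1 - d) / 4" using nz by (auto simp: d_def)
    have stu: "s = 2 * ((1 - d) / 4)" "t = (1 - d) / 4" "u = 2" using 4 d(2) by simp_all
    have sq: "padic.local_square (5 * d)" "padic.local_square ((2 - d) * d)"
      using minus prod by (simp_all add: d_def)
    show ?thesis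
    proof (rule that[of "?p * (2 - d) / d"])
      show "padic.local_square ((?p * (2 - d) / d + ?p) * (s * 5))"
        by (rule scale[OF _ _ sq(1), of "2 * ?p / d"])
           (use p0 d in simp, use d(1) in \<open>simp add: stu d(2) field_simps\<close>)
      show "padic.local_square ((?p * (2 - d) / d - ?p) * (u * 5))"
        by (rule scale[OF _ _ sq(1), of "4 * ?p / d"])
           (use p0 d in simp, use d(1) in \<open>simp add: stu d(2) field_simps\<close>)
      show "padic.local_square (?p * (2 - d) / d * t)"
        by (rule scale[OF _ _ sq(2), of "?p / d"])
           (use p0 d in simp, use d(1) in \<open>simp add: stu d(2) field_simps\<close>)
    qed
  qed
qed

text \<open>The class of a torsion point corresponds to \<open>e = 1\<close>, that of its translate by the point with
  \<open>x = 1/4\<close> to \<open>e = 5\<close>.\<close>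

theorem kummer_image_2:
  assumes l2: "l = 2" and p: "odd p" and abc: "a \<noteq> 0" "b \<noteq> 0" "c \<noteq> 0" "padic.local_square (a * b * c)"
  shows "locally_kummer p (padic_field l) (padic_of_rat l)
      (sqclass class_ring a, sqclass class_ring b, sqclass class_ring c) \<longleftrightarrow>
    (\<exists>(s, t, u) \<in> torsion_classes p. \<exists>e \<in> {1, 5}.
      padic.local_square (a * (s * e)) \<and> padic.local_square (b * t))"
    (is "_ \<longleftrightarrow> ?R")
proof -
  have p0: "p \<noteq> 0" using p by (metis even_zero)
  have ?R
    if x: "padic.local_square (a * (x + of_nat p))" "padic.local_square (b * x)"
      "padic.local_square (c * (x - of_nat p))" for x
  proof -
    have nz: "x + of_nat p \<noteq> 0" "x \<noteq> 0" "x - of_nat p \<noteq> 0"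
      using x[THEN padic.local_square_nonzero] by auto
    have "padic.local_square ((x + of_nat p) * x * (x - of_nat p))"
      by (rule padic.local_square_mod_square[OF padic.local_square_mult[OF abc(4)
            padic.local_square_mult[OF x(1) padic.local_square_mult[OF x(2,3)]]], of "a * b * c"])
         (simp add: algebra_simps)
    from kummer_class_2[OF l2 p nz this] obtain s t u e where
      "(s, t, u) \<in> torsion_classes p" "e \<in> {1, 5}"
      "padic.local_square ((x + of_nat p) * (s * e))" "padic.local_square (x * t)"
      by blast
    thus ?thesis using padic.local_square_trans x by blast
  qed
  moreover have ?R if stu: "(s, t, u) \<in> torsion_classes p" "padic.local_square (a * s)" "padic.local_square (b * t)" for s t u
    using that by force
  moreover have "(\<exists>(s, t, u) \<in> torsion_classes p.
       padic.local_square (a * s) \<and> padic.local_square (b * t) \<and> padic.local_square (c * u)) \<or>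
    (\<exists>x. padic.local_square (a * (x + of_nat p)) \<and> padic.local_square (b * x) \<and>
       padic.local_square (c * (x - of_nat p)))" if R: ?R
  proof -
    obtain s t u e where stu: "(s, t, u) \<in> torsion_classes p" and e: "e \<in> {1, 5}"
      and sq: "padic.local_square (a * (s * e))" "padic.local_square (b * t)" using R by blast
    have c: "padic.local_square (c * (u * e))"
      by (rule padic.local_square_mod_square[OF padic.local_square_mult[OF abc(4)
            padic.local_square_mult[OF torsion_classes_product[OF stu p0] padic.local_square_mult[OF sq]]],
          of "a * b * s * t"], insert e)
         (auto simp: algebra_simps)
    show ?thesis
    proof (cases "e = 1")
      case True
      thus ?thesis using stu sq c by force
    next
      case False
      hence e: "e = 5" using e by simp
      obtain x where x: "padic.local_square ((x + of_nat p) * (s * 5))" "padic.local_square (x * t)"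
        "padic.local_square ((x - of_nat p) * (u * 5))" using two_adic_points[OF l2 p stu] by blast
      have "padic.local_square (a * (x + of_nat p)) \<and> padic.local_square (b * x) \<and>
       padic.local_square (c * (x - of_nat p))"
        using padic.local_square_trans[of a "s * 5" "x + of_nat p"] padic.local_square_trans[of b t x]
          padic.local_square_trans[of c "u * 5" "x - of_nat p"] sq c x e by (simp add: mult.commute)
      thus ?thesis by blast
    qed
  qed
  ultimately show ?thesis
    unfolding locally_kummer_padic_iff[OF p0 abc] by blast
qed

end

section \<open>Integers that are local squares\<close>

context finite_place
begin

text \<open>By \<open>local_square_iff\<close> the number \<open>n\<close> is a local square if and only if \<open>n s\<^sup>2\<close> is congruent to 1
  modulo \<open>l\<close> for some \<open>s\<close>, which must be a unit. Writing \<open>s = a / b\<close> turns this into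
  \<open>n \<equiv> (b / a)\<^sup>2\<close>.\<close>

lemma local_square_int_odd:
  assumes l2: "l \<noteq> 2" and n: "\<not> int l dvd n"
  shows "padic.local_square (of_int n) \<longleftrightarrow> QuadRes (int l) n"
proof
  have pl: "prime (int l)" using l by simp
  have n0: "n \<noteq> 0" using n by auto
  assume "padic.local_square (of_int n)"
  then obtain s where s: "s \<noteq> 0" "of_int n * s ^ 2 - 1 \<in> padic_ideal l 1"
    using local_square_iff[of "of_int n"] n0 by (auto simp: hensel_depth_odd[OF l2])
  have vn: "padic_val l (of_int n) = 0"
    using padic_val_of_int[OF l n0] not_dvd_imp_multiplicity_0[OF n] by simp
  have "of_int n * s ^ 2 - 1 \<in> padic_ideal l (padic_val l 1 + 1)" using s(2) by simp
  from padic_val_add_eq(2)[OF l _ this] have "padic_val l s = 0"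
    using s(1) n0 vn by (simp add: padic_val_mult[OF l] padic_val_power[OF l])
  hence "s \<in> padic_ideal l 0" by (simp add: padic_ideal_def)
  then obtain a b where ab: "\<not> int l dvd b" "s = of_int a / of_int b"
    using padic_ideal_0_iff[OF l] by blast
  have b0: "b \<noteq> 0" using ab by auto
  have "(of_int n * s ^ 2 - 1) * of_int (b ^ 2) \<in> padic_ideal l (1 + 0)"
    by (rule padic_ideal_mult[OF l s(2) of_int_in_padic_ideal[OF l]])
  also have "(of_int n * s ^ 2 - 1) * of_int (b ^ 2) = (of_int (n * a ^ 2 - b ^ 2) :: rat)"
    using b0 by (simp add: ab(2) field_simps)
  finally have "(of_int (n * a ^ 2 - b ^ 2) :: rat) \<in> padic_ideal l (int 1)"
    by (simp only: add_0_right of_nat_1)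
  hence dvd: "int l dvd n * a ^ 2 - b ^ 2"
    using of_int_in_padic_ideal_iff[OF l] by (metis power_one_right)
  have "\<not> int l dvd a"
  proof
    assume "int l dvd a"
    hence "int l dvd n * a ^ 2" by (simp add: power2_eq_square)
    hence "int l dvd b ^ 2" using dvd by (metis dvd_diff_right_iff)
    thus False using ab(1) pl prime_dvd_power by blast
  qed
  hence "coprime a (int l)" using pl by (metis coprime_commute prime_imp_coprime)
  then obtain c where c: "[a * c = 1] (mod int l)" using cong_solve_coprime_int by blast
  have "[b ^ 2 = n * a ^ 2] (mod int l)" using dvd by (simp add: cong_iff_dvd_diff dvd_diff_commute)
  hence "[b ^ 2 * c ^ 2 = n * a ^ 2 * c ^ 2] (mod int l)" by (rule cong_scalar_right)
  also have "n * a ^ 2 * c ^ 2 = n * (a * c) ^ 2" by (simp add: power_mult_distrib)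
  also have "[n * (a * c) ^ 2 = n * 1 ^ 2] (mod int l)" by (intro cong_mult cong_pow c cong_refl)
  finally show "QuadRes (int l) n" unfolding QuadRes_def by (intro exI[of _ "b * c"]) (simp add: power_mult_distrib)
next
  have pl: "prime (int l)" using l by simp
  assume "QuadRes (int l) n"
  then obtain y where y: "[y ^ 2 = n] (mod int l)" by (auto simp: QuadRes_def)
  have ny: "\<not> int l dvd y"
    using y n by (metis cong_dvd_iff dvd_power zero_less_numeral dvd_trans)
  hence y0: "y \<noteq> 0" by auto
  have vy: "padic_val l (of_int (y * y)) = 0"
    using padic_val_of_int[OF l, of "y * y"] y0 not_dvd_imp_multiplicity_0[OF ny] pl
    by (simp add: prime_elem_multiplicity_mult_distrib)
  have "int l ^ 1 dvd n - y * y" using y by (simp add: cong_iff_dvd_diff dvd_diff_commute power2_eq_square)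
  hence "of_int (n - y * y) \<in> padic_ideal l (int 1)" using of_int_in_padic_ideal_iff[OF l] by blast
  hence "of_int (n - y * y) \<in> padic_ideal l (hensel_depth + padic_val l (of_int (y * y)))"
    by (simp add: vy hensel_depth_odd[OF l2] del: of_int_diff of_int_mult)
  hence "padic.local_square ((of_int (y * y) + of_int (n - y * y)) * of_int (y * y))"
    using y0 by (intro local_square_scaled_1_plus) auto
  also have "(of_int (y * y) + of_int (n - y * y)) * of_int (y * y) = (of_int y * of_int y * of_int n :: rat)"
    by simp
  finally show "padic.local_square (of_int n)" by (rule padic.local_square_mod_square) (rule refl)
qed

end

lemma odd_square_mod_8: 
  fixes a :: int assumes "odd a" shows "[a ^ 2 = 1] (mod 8)"
proof -
  obtain k where k: "a = 2 * k + 1" using assms by (auto elim: oddE)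
  have "even (k * (k + 1))" by simp
  then obtain m where "k * (k + 1) = 2 * m" by (rule evenE)
  hence "a ^ 2 - 1 = 8 * m" by (simp add: k power2_eq_square algebra_simps)
  thus ?thesis by (simp add: cong_iff_dvd_diff)
qed

text \<open>As at odd primes, but modulo 8, where 1 is the only odd square.\<close>

lemma (in finite_place) local_square_int_2:
  assumes l2: "l = 2" and n: "odd n"
  shows "padic.local_square (of_int n) \<longleftrightarrow> [n = 1] (mod 8)"
proof
  have n0: "n \<noteq> 0" using n by auto
  have nd: "\<not> int l dvd n" using n l2 by simp
  assume "padic.local_square (of_int n)"
  then obtain s where s: "s \<noteq> 0" "of_int n * s ^ 2 - 1 \<in> padic_ideal l 3"
    using local_square_iff[of "of_int n"] n0 hensel_depth_2[OF l2] by auto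
  have vn: "padic_val l (of_int n) = 0"
    using padic_val_of_int[OF l n0] not_dvd_imp_multiplicity_0[OF nd] by simp
  have "of_int n * s ^ 2 - 1 \<in> padic_ideal l (padic_val l 1 + 1)"
    using s(2) by (auto intro: padic_ideal_mono)
  from padic_val_add_eq(2)[OF l _ this] have "padic_val l s = 0"
    using s(1) n0 vn by (simp add: padic_val_mult[OF l] padic_val_power[OF l])
  then obtain a b where ab: "odd a" "odd b" "s = of_int a / of_int b" using two_adic_unit[OF l2 s(1)] by metis
  have b0: "b \<noteq> 0" using ab by auto
  have "(of_int n * s ^ 2 - 1) * of_int (b ^ 2) \<in> padic_ideal l (3 + 0)"
    by (rule padic_ideal_mult[OF l s(2) of_int_in_padic_ideal[OF l]])
  also have "(of_int n * s ^ 2 - 1) * of_int (b ^ 2) = (of_int (n * a ^ 2 - b ^ 2) :: rat)"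
    using b0 by (simp add: ab(3) field_simps)
  finally have "(of_int (n * a ^ 2 - b ^ 2) :: rat) \<in> padic_ideal l (int 3)"
    by (simp only: add_0_right of_nat_numeral)
  hence "int l ^ 3 dvd n * a ^ 2 - b ^ 2" using of_int_in_padic_ideal_iff[OF l] by blast
  hence "[n * a ^ 2 = b ^ 2] (mod 8)" by (simp add: l2 cong_iff_dvd_diff)
  moreover have "[n * a ^ 2 = n * 1] (mod 8)" by (intro cong_mult cong_refl odd_square_mod_8 ab)
  ultimately show "[n = 1] (mod 8)"
    using odd_square_mod_8[OF ab(2)] by (metis cong_sym cong_trans mult.right_neutral)
next
  assume "[n = 1] (mod 8)"
  hence "int l ^ 3 dvd n - 1" by (simp add: l2 cong_iff_dvd_diff)
  hence "(of_int (n - 1) :: rat) \<in> padic_ideal l (int 3)" using of_int_in_padic_ideal_iff[OF l] by blast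
  hence "padic.local_square (1 + of_int (n - 1))"
    using hensel_depth_2[OF l2] by (intro local_square_1_plus) simp
  thus "padic.local_square (of_int n)" by simp
qed

lemma QuadRes_eq_Legendre: "\<not> int p dvd n \<Longrightarrow> QuadRes (int p) n \<longleftrightarrow> Legendre n (int p) = 1"
  by (simp add: Legendre_def cong_0_iff)

lemma cong_pm1_imp_eq:
  fixes p :: nat and a b :: int
  assumes "2 < p" "[a = b] (mod int p)" "a \<in> {-1, 1}" "b \<in> {-1, 1}"
  shows "a = b"
proof -
  have "\<not> int p dvd 2" "\<not> int p dvd - 2" using assms(1) by (auto dest: zdvd_imp_le)
  thus ?thesis using assms(2-4) by (auto simp: cong_iff_dvd_diff)
qed

lemma Legendre_values: "\<not> int p dvd n \<Longrightarrow> Legendre n (int p) \<in> {-1, 1}"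
  by (simp add: Legendre_def cong_0_iff)

lemma Legendre_minus_1:
  assumes p: "prime p" "2 < p" shows "Legendre (- 1) (int p) = (- 1) ^ ((p - 1) div 2)"
proof (rule cong_pm1_imp_eq[OF p(2)])
  show "[Legendre (- 1) (int p) = (- 1) ^ ((p - 1) div 2)] (mod int p)" by (rule euler_criterion[OF p])
  show "Legendre (- 1) (int p) \<in> {-1, 1}" using p by (intro Legendre_values) (auto dest: zdvd_imp_le)
  show "(- 1) ^ ((p - 1) div 2) \<in> {-1, 1 :: int}" by (metis insertCI neg_one_even_power neg_one_odd_power)
qed

lemma Legendre_mult:
  assumes p: "prime p" "2 < p" and ab: "\<not> int p dvd a" "\<not> int p dvd b"
  shows "Legendre (a * b) (int p) = Legendre a (int p) * Legendre b (int p)"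
proof (rule cong_pm1_imp_eq[OF p(2)])
  have "[Legendre (a * b) (int p) = a ^ ((p - 1) div 2) * b ^ ((p - 1) div 2)] (mod int p)"
    using euler_criterion[OF p, of "a * b"] by (simp add: power_mult_distrib)
  also have "[a ^ ((p - 1) div 2) * b ^ ((p - 1) div 2) = Legendre a (int p) * Legendre b (int p)] (mod int p)"
    by (intro cong_mult; rule cong_sym, rule euler_criterion[OF p])
  finally show "[Legendre (a * b) (int p) = Legendre a (int p) * Legendre b (int p)] (mod int p)" .
  have "\<not> int p dvd a * b" using p ab by (simp add: prime_dvd_mult_iff)
  thus "Legendre (a * b) (int p) \<in> {-1, 1}" by (rule Legendre_values)
  show "Legendre a (int p) * Legendre b (int p) \<in> {-1, 1}"
    using Legendre_values[OF ab(1)] Legendre_values[OF ab(2)] by auto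
qed

text \<open>By the lemma of Gauss the symbol is determined by the number of \<open>x \<le> (p - 1) / 2\<close> with
  \<open>2 x > (p - 1) / 2\<close>.\<close>

lemma Legendre_2:
  assumes p: "prime p" "2 < p" shows "Legendre 2 (int p) = (- 1) ^ ((p - 1) div 2 - (p - 1) div 2 div 2)"
proof -
  interpret GAUSS p 2
    using p by unfold_locales (auto simp: cong_0_iff dest: zdvd_imp_le)
  define n where "n = (p - 1) div 2"
  have n: "(int p - 1) div 2 = int n" "2 * n < p" using p by (auto simp: n_def)
  have "E = (\<lambda>x. int (2 * x)) ` {n div 2<..n}"
  proof (intro equalityI subsetI)
    fix y assume "y \<in> E"
    then obtain x where x: "0 < x" "x \<le> int n" "y = (x * 2) mod int p" "y > int n"
      by (auto simp: E_def C_def B_def A_def n)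
    have "y = x * 2" using x n(2) by simp
    hence "y = int (2 * nat x)" "nat x \<in> {n div 2<..n}" using x by auto
    thus "y \<in> (\<lambda>x. int (2 * x)) ` {n div 2<..n}" by blast
  next
    fix y assume "y \<in> (\<lambda>x. int (2 * x)) ` {n div 2<..n}"
    then obtain x where x: "y = int (2 * x)" "n div 2 < x" "x \<le> n" by auto
    have "y = (int x * 2) mod int p" using x n(2) by simp
    moreover have "int x \<in> {0<..int n}" "y > int n" using x by auto
    ultimately show "y \<in> E" by (auto simp: E_def C_def B_def A_def n)
  qed
  hence "card E = n - n div 2" by (simp add: card_image inj_on_def)
  thus ?thesis using gauss_lemma by (simp add: n_def)
qed

lemma QuadRes_minus_1_2:
  assumes p: "prime p" "odd p"
  shows "QuadRes (int p) (- 1) \<longleftrightarrow> p mod 8 \<in> {1, 5}"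
    and "QuadRes (int p) 2 \<longleftrightarrow> p mod 8 \<in> {1, 7}"
    and "QuadRes (int p) (- 2) \<longleftrightarrow> p mod 8 \<in> {1, 3}"
proof -
  have p2: "2 < p" using p prime_gt_1_nat[OF p(1)] by (cases "p = 2") auto
  have nd: "\<not> int p dvd - 1" "\<not> int p dvd 2" "\<not> int p dvd - 2" using p2 by (auto dest: zdvd_imp_le)
  note L = Legendre_minus_1[OF p(1) p2] Legendre_2[OF p(1) p2]
    Legendre_mult[OF p(1) p2 nd(1,2)]
  have pm1: "(- 1) ^ k = (1 :: int) \<longleftrightarrow> even k" for k by (metis neg_one_even_power neg_one_odd_power one_neq_neg_one)
  define k where "k = p div 8"
  have pk: "p = 8 * k + p mod 8" by (simp add: k_def)
  have "p mod 8 = 1 \<or> p mod 8 = 3 \<or> p mod 8 = 5 \<or> p mod 8 = 7" using p(2) by presburger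
  hence cases: "(p mod 8 = 1 \<and> (p - 1) div 2 = 4 * k) \<or> (p mod 8 = 3 \<and> (p - 1) div 2 = 4 * k + 1) \<or>
      (p mod 8 = 5 \<and> (p - 1) div 2 = 4 * k + 2) \<or> (p mod 8 = 7 \<and> (p - 1) div 2 = 4 * k + 3)"
    by (elim disjE) (use pk in \<open>simp_all add: algebra_simps\<close>)
  have par: "(4 * k) div 2 = 2 * k" "(4 * k + 1) div 2 = 2 * k" "(4 * k + 2) div 2 = 2 * k + 1"
    "(4 * k + 3) div 2 = 2 * k + 1" by presburger+
  show "QuadRes (int p) (- 1) \<longleftrightarrow> p mod 8 \<in> {1, 5}"
    using cases by (auto simp: QuadRes_eq_Legendre[OF nd(1)] L)
  show "QuadRes (int p) 2 \<longleftrightarrow> p mod 8 \<in> {1, 7}"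
    using cases par by (auto simp: QuadRes_eq_Legendre[OF nd(2)] L pm1)
  have "Legendre (- 2) (int p) = (- 1) ^ ((p - 1) div 2) * (- 1) ^ ((p - 1) div 2 - (p - 1) div 2 div 2)"
    using L by simp
  also have "\<dots> = (- 1) ^ ((p - 1) div 2 + ((p - 1) div 2 - (p - 1) div 2 div 2))" by (simp only: power_add)
  finally show "QuadRes (int p) (- 2) \<longleftrightarrow> p mod 8 \<in> {1, 3}"
    using cases par by (auto simp: QuadRes_eq_Legendre[OF nd(3)] pm1)
qed

section \<open>Vector spaces over the field with two elements\<close>

text \<open>Every vector has unique coordinates in a basis.\<close>

lemma (in vectorspace) card_carrier_eq_power_dim:
  assumes "fin_dim"
  shows "card (carrier V) = card (carrier K) ^ dim"
proof -
  obtain A where A: "finite A" "basis A" using finite_basis_exists[OF assms] by blast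
  hence AV: "A \<subseteq> carrier V" by (simp add: basis_def)
  have ex1: "\<exists>!a. a \<in> A \<rightarrow>\<^sub>E carrier K \<and> lincomb a A = v" if "v \<in> carrier V" for v
    using basis_criterion[OF A(1) AV] A(2) that by blast
  have closed: "lincomb a A \<in> carrier V" if "a \<in> A \<rightarrow>\<^sub>E carrier K" for a
    using that AV by (intro lincomb_closed) auto
  have "bij_betw (\<lambda>a. lincomb a A) (A \<rightarrow>\<^sub>E carrier K) (carrier V)"
    unfolding bij_betw_def inj_on_def using ex1 closed by (auto simp: image_iff) metis+
  hence "card (carrier V) = card (A \<rightarrow>\<^sub>E carrier K)" by (simp add: bij_betw_same_card)
  thus ?thesis using A dim_basis by (simp add: card_PiE)
qed

lemma field_residue_ring_2: "field (residue_ring 2)"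
proof -
  interpret residues_prime 2 "residue_ring 2" by unfold_locales simp_all
  show ?thesis by (rule is_field)
qed

lemma carrier_residue_ring_2: "carrier (residue_ring 2) = {0, 1}"
  by (auto simp: residue_ring_def)

lemma vectorspace_F2_module:
  assumes "comm_group G" and sq: "\<And>x. x \<in> carrier G \<Longrightarrow> x \<otimes>\<^bsub>G\<^esub> x = \<one>\<^bsub>G\<^esub>"
  shows "vectorspace (residue_ring 2) (F2_module G)"
proof -
  interpret comm_group G by fact
  have sel: "carrier (F2_module G) = carrier G" "add (F2_module G) = mult G"
      "zero (F2_module G) = one G" "smult (F2_module G) = (\<lambda>k x. x [^]\<^bsub>G\<^esub> k)"
    by (simp_all add: F2_module_def)
  have R: "a \<oplus>\<^bsub>residue_ring 2\<^esub> b = (a + b) mod 2" "a \<otimes>\<^bsub>residue_ring 2\<^esub> b = a * b mod 2"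
    "\<one>\<^bsub>residue_ring 2\<^esub> = 1" for a b
    by (simp_all add: residue_ring_def)
  have "module (residue_ring 2) (F2_module G)"
  proof (rule moduleI)
    show "cring (residue_ring 2)" using field_residue_ring_2 by (simp add: field_def domain_def)
    show "abelian_group (F2_module G)"
    proof (rule abelian_groupI)
      fix x assume "x \<in> carrier (F2_module G)"
      thus "\<exists>y\<in>carrier (F2_module G). y \<oplus>\<^bsub>F2_module G\<^esub> x = \<zero>\<^bsub>F2_module G\<^esub>"
        using sq by (auto simp: sel)
    qed (auto simp: sel m_ac)
  qed (auto simp: sel R carrier_residue_ring_2 sq int_pow_int[of G _ 1, simplified] int_pow_1)
  thus ?thesis using field_residue_ring_2 by (intro vectorspace.intro)
qed

lemma F2_module_fin_dim_dim:
  assumes vs: "vectorspace (residue_ring 2) (F2_module G)"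
    and finite_G: "finite (carrier G)" and card: "card (carrier G) = 2 ^ n"
  shows "vectorspace.fin_dim (residue_ring 2) (F2_module G)"
    and "vectorspace.dim (residue_ring 2) (F2_module G) = n"
proof -
  interpret vectorspace "residue_ring 2" "F2_module G" by fact
  have carrier: "carrier (F2_module G) = carrier G" by (simp add: F2_module_def)
  have "gen_set (carrier (F2_module G))"
    using span_is_subset2[of "carrier (F2_module G)"] in_own_span[of "carrier (F2_module G)"] by auto
  thus fd: "fin_dim"
    unfolding fin_dim_def using finite_G carrier by (intro exI[of _ "carrier (F2_module G)"]) simp
  have "card (carrier (residue_ring 2)) = 2" by (simp add: carrier_residue_ring_2)
  hence "2 ^ n = (2 :: nat) ^ dim"
    using card_carrier_eq_power_dim[OF fd] card by (simp add: carrier)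
  thus "dim = n" by simp
qed

section \<open>Global square classes\<close>

context rat_extension
begin

lemma comm_group_mult_of: "comm_group (mult_of R)"
  using units_comm_group by (simp add: mult_of_is_Units)

lemma subgroup_nonzero_squares: "subgroup (nonzero_squares R) (mult_of R)"
proof -
  interpret mult: comm_group "mult_of R" by (rule comm_group_mult_of)
  show ?thesis
  proof (rule mult.subgroupI)
    fix s assume s: "s \<in> nonzero_squares R"
    hence sc: "s \<in> carrier (mult_of R)" using nonzero_squares_carrier by simp
    have "inv\<^bsub>mult_of R\<^esub> s \<in> carrier R" "s \<otimes> inv\<^bsub>mult_of R\<^esub> s = \<one>"
      using mult.inv_closed[OF sc] mult.r_inv[OF sc] by simp_all
    thus "inv\<^bsub>mult_of R\<^esub> s \<in> nonzero_squares R"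
      using nonzero_squares_cancel[OF s] one_nonzero_square by metis
  qed (use nonzero_squares_carrier nonzero_squares_mult one_nonzero_square in auto)
qed

lemma carrier_sqclass_group: "carrier (sqclass_group R) = sqclass R ` (carrier R - {\<zero>})"
  by (auto simp: sqclass_group_def sqclass_def FactGroup_def RCOSETS_def)

lemma sqclass_mult:
  assumes "x \<in> carrier R - {\<zero>}" "y \<in> carrier R - {\<zero>}"
  shows "sqclass R x \<otimes>\<^bsub>sqclass_group R\<^esub> sqclass R y = sqclass R (x \<otimes> y)"
proof -
  interpret mult: comm_group "mult_of R" by (rule comm_group_mult_of)
  interpret normal "nonzero_squares R" "mult_of R"
    by (rule mult.subgroup_imp_normal[OF subgroup_nonzero_squares])
  show ?thesis using assms rcos_sum[of x y] by (simp add: sqclass_group_def sqclass_def FactGroup_def)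
qed

lemma sqclass_one: "\<one>\<^bsub>sqclass_group R\<^esub> = sqclass R \<one>"
proof -
  interpret mult: comm_group "mult_of R" by (rule comm_group_mult_of)
  have "nonzero_squares R #>\<^bsub>mult_of R\<^esub> \<one>\<^bsub>mult_of R\<^esub> = nonzero_squares R"
    by (rule mult.coset_mult_one) (use nonzero_squares_carrier in auto)
  thus ?thesis by (simp add: sqclass_group_def sqclass_def FactGroup_def)
qed

end

lemma rat_extension_rat: "rat_extension (class_ring :: rat ring) (\<lambda>q. q)"
  by (rule rat_extension.intro[OF class_field], rule rat_extension_axioms.intro) simp_all

lemma rat_extension_real: "rat_extension (class_ring :: real ring) of_rat"
  by (rule rat_extension.intro[OF class_field], rule rat_extension_axioms.intro)
     (simp_all add: of_rat_add of_rat_mult)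

interpretation rat: rat_extension "class_ring :: rat ring" "\<lambda>q. q"
  by (rule rat_extension_rat)

\<comment> \<open>For the identity embedding these equations rewrite terms to themselves.\<close>
declare rat.emb_eq_iff [simp del] rat.emb_eq_0_iff [simp del] rat.emb_0 [simp del] rat.emb_1 [simp del]

interpretation real: rat_extension "class_ring :: real ring" of_rat
  by (rule rat_extension_real)

abbreviation rat_sqclass :: "rat \<Rightarrow> rat set" where
  "rat_sqclass \<equiv> sqclass class_ring"

lemma rat_sqclass_eq_iff:
  "q \<noteq> 0 \<Longrightarrow> r \<noteq> 0 \<Longrightarrow> rat_sqclass q = rat_sqclass r \<longleftrightarrow> (\<exists>w. w \<noteq> 0 \<and> q * r = w * w)"
  using rat.sqclass_emb_eq_iff[of q r] by (auto simp: rat.local_square_def nonzero_squares_def)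

lemma rat_sqclass_mult:
  "q \<noteq> 0 \<Longrightarrow> r \<noteq> 0 \<Longrightarrow> rat_sqclass q \<otimes>\<^bsub>sqclass_group class_ring\<^esub> rat_sqclass r = rat_sqclass (q * r)"
  using rat.sqclass_mult[of q r] by simp

text \<open>For \<open>x = a / b\<close> the integer \<open>a b = x b\<^sup>2\<close> has even multiplicity at each prime, like \<open>x\<close>.\<close>

lemma rat_square_up_to_sign:
  fixes x :: rat
  assumes x: "x \<noteq> 0" and even: "\<And>l. prime l \<Longrightarrow> even (padic_val l x)"
  obtains w where "w \<noteq> 0" "x = w * w \<or> x = - (w * w)"
proof -
  obtain a b where ab: "b > 0" "x = of_int a / of_int b" by (rule rat_as_quotient)
  have a: "a \<noteq> 0" using x ab by auto
  have "even (multiplicity q (a * b))" if q: "prime q" for q :: int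
  proof -
    obtain l where l: "q = int l" "prime l" using q prime_ge_0_int[OF q] by (metis int_nat_eq prime_nat_int_transfer)
    have "int (multiplicity q (a * b)) = padic_val l x + 2 * int (multiplicity q b)"
      using a ab l by (simp add: ab(2) padic_val_quotient prime_elem_multiplicity_mult_distrib)
    thus ?thesis using even[OF l(2)] by (metis dvd_triv_left even_add even_of_nat)
  qed
  hence "is_nth_power 2 (normalize (a * b))" by (subst is_nth_power_conv_multiplicity) auto
  then obtain m where m: "\<bar>a * b\<bar> = m * m" by (auto simp: power2_eq_square elim!: is_nth_powerE)
  define w where "w = (of_int m / of_int b :: rat)"
  have "a * b = m * m \<or> a * b = - (m * m)" using m by linarith
  hence "(of_int (a * b) :: rat) = of_int m * of_int m \<or> (of_int (a * b) :: rat) = - (of_int m * of_int m)"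
    by (metis of_int_minus of_int_mult)
  moreover have "x * (of_int b * of_int b) = of_int (a * b)" using ab by simp
  moreover have "w * w * (of_int b * of_int b) = of_int m * of_int m" using ab by (simp add: w_def)
  ultimately have "x * (of_int b * of_int b) = w * w * (of_int b * of_int b) \<or>
      x * (of_int b * of_int b) = - (w * w) * (of_int b * of_int b)" by (simp only: mult_minus_left)
  moreover have bb: "(of_int b * of_int b :: rat) \<noteq> 0" using ab(1) by simp
  ultimately have "x = w * w \<or> x = - (w * w)" unfolding mult_right_cancel[OF bb] by blast
  thus ?thesis using x by (intro that[of w]) auto
qed

text \<open>The square classes unramified outside \<open>2\<close> and \<open>p\<close> have unique representatives
  \<open>\<plusminus> 2\<^sup>j p\<^sup>k\<close> with \<open>j, k \<in> {0, 1}\<close>, encoded by three bits.\<close>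

type_synonym bits = "bool \<times> bool \<times> bool"

fun rep :: "nat \<Rightarrow> bits \<Rightarrow> int" where
  "rep p (i, j, k) = (if i then - 1 else 1) * (if j then 2 else 1) * (if k then int p else 1)"

fun xor_bits :: "bits \<Rightarrow> bits \<Rightarrow> bits" where
  "xor_bits (i, j, k) (i', j', k') = (i \<noteq> i', j \<noteq> j', k \<noteq> k')"

lemma xor_bits_self: "xor_bits u u = (False, False, False)"
  by (cases u) simp

locale odd_prime =
  fixes p :: nat
  assumes p: "prime p" "odd p"
begin

sublocale two: finite_place 2 by unfold_locales simp
sublocale at_p: finite_place p by unfold_locales (rule p)

lemma p_gt_2: "p > 2"
  using p prime_gt_1_nat[OF p(1)] by (cases "p = 2") auto

abbreviation rep_class :: "bits \<Rightarrow> rat set" where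
  "rep_class u \<equiv> rat_sqclass (of_int (rep p u))"

lemma rep_nonzero [simp]: "rep p u \<noteq> 0"
  using p_gt_2 by (cases u) auto

lemma rep_mult: "\<exists>w. w \<noteq> 0 \<and> rep p u * rep p v = w * w * rep p (xor_bits u v)"
proof -
  obtain i j k i' j' k' where uv: "u = (i, j, k)" "v = (i', j', k')" by (metis prod_cases3)
  show ?thesis
    by (rule exI[of _ "(if j \<and> j' then 2 else 1) * (if k \<and> k' then int p else 1)"])
       (use p_gt_2 in \<open>auto simp: uv\<close>)
qed

lemma rep_mult_rat:
  obtains w :: rat where "w \<noteq> 0" "of_int (rep p u) * of_int (rep p v) = w * w * of_int (rep p (xor_bits u v))"
proof -
  obtain w where "w \<noteq> 0" "rep p u * rep p v = w * w * rep p (xor_bits u v)" using rep_mult by blast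
  thus ?thesis using that[of "of_int w"] by (metis of_int_0_eq_iff of_int_mult)
qed

lemma rep_class_mult:
  "rep_class u \<otimes>\<^bsub>sqclass_group class_ring\<^esub> rep_class v = rep_class (xor_bits u v)"
proof -
  obtain w :: rat where w: "w \<noteq> 0" "of_int (rep p u) * of_int (rep p v) = w * w * of_int (rep p (xor_bits u v))"
    by (rule rep_mult_rat)
  have "of_int (rep p u) * of_int (rep p v) * of_int (rep p (xor_bits u v)) =
      (w * of_int (rep p (xor_bits u v))) * (w * of_int (rep p (xor_bits u v)))"
    unfolding w(2) by (simp add: algebra_simps)
  hence "rat_sqclass (of_int (rep p u) * of_int (rep p v)) = rep_class (xor_bits u v)"
    using w(1) by (subst rat_sqclass_eq_iff) (auto intro!: exI[of _ "w * of_int (rep p (xor_bits u v))"])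
  thus ?thesis by (simp add: rat_sqclass_mult)
qed

lemma padic_val_rep:
  assumes l: "prime l"
  shows "padic_val l (of_int (rep p (i, j, k))) = (if j \<and> l = 2 then 1 else 0) + (if k \<and> l = p then 1 else 0)"
proof -
  have v: "padic_val l (of_nat q) = (if l = q then 1 else 0)" if q: "prime q" for q
  proof -
    have "\<not> int l dvd int q" if "l \<noteq> q"
      using that l q primes_dvd_imp_eq int_dvd_int_iff by metis
    thus ?thesis
      using padic_val_prime[OF l] padic_val_of_int[OF l, of "int q"] prime_gt_0_nat[OF q]
      by (auto simp: not_dvd_imp_multiplicity_0)
  qed
  have "padic_val l 2 = (if l = 2 then 1 else 0)" using v[of 2] by simp
  thus ?thesis
    using v[OF p(1)] l p_gt_2 by (cases i; cases j; cases k) (auto simp: padic_val_mult)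
qed

lemma padic_val_rep_2: "padic_val 2 (of_int (rep p (i, j, k))) = of_bool j"
  and padic_val_rep_p: "padic_val p (of_int (rep p (i, j, k))) = of_bool k"
  using p_gt_2 padic_val_rep[of 2 i j k] padic_val_rep[OF p(1), of i j k] by (simp_all del: rep.simps)

lemma inj_rep_class: "inj rep_class"
proof (rule injI)
  fix u v assume eq: "rep_class u = rep_class v"
  obtain i j k i' j' k' where uv: "u = (i, j, k)" "v = (i', j', k')" by (metis prod_cases3)
  obtain w :: rat where w: "w \<noteq> 0" "of_int (rep p u) * of_int (rep p v) = w * w"
    using eq rat_sqclass_eq_iff[of "of_int (rep p u)" "of_int (rep p v)"] by auto
  have parity: "even (padic_val l (of_int (rep p u)) + padic_val l (of_int (rep p v)))" if l: "prime l" for l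
  proof -
    have "padic_val l (of_int (rep p u)) + padic_val l (of_int (rep p v)) = 2 * padic_val l w"
      using padic_val_mult[OF l, of "of_int (rep p u)" "of_int (rep p v)"] w by (simp add: padic_val_mult[OF l])
    thus ?thesis by (metis dvd_triv_left)
  qed
  have of_bool_parity: "b = c" if "even (of_bool b + of_bool c :: int)" for b c
    using that by (cases b; cases c) simp_all
  have "j = j'"
    by (rule of_bool_parity) (rule parity[OF two_is_prime_nat, unfolded uv padic_val_rep_2])
  moreover have "k = k'"
    by (rule of_bool_parity) (rule parity[OF p(1), unfolded uv padic_val_rep_p])
  moreover have "0 < w * w" using w(1) by (auto simp: zero_less_mult_iff neq_iff)
  hence "(0 :: rat) < of_int (rep p u * rep p v)" unfolding of_int_mult w(2) .
  hence "rep p u * rep p v > 0" by (simp only: of_int_0_less_iff)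
  hence "i = i'" using p_gt_2 by (auto simp: uv zero_less_mult_iff mult_less_0_iff split: if_splits)
  ultimately show "u = v" by (simp add: uv)
qed

text \<open>The bits \<open>j\<close> and \<open>k\<close> of a class are the parities of its valuations at 2 and \<open>p\<close>. Multiplying by
  \<open>2\<^sup>j p\<^sup>k\<close> makes all valuations even, which leaves a square up to sign.\<close>

lemma rat_sqclasses_outside_eq: "rat_sqclasses_outside {2, p} = range rep_class"
proof (intro equalityI subsetI)
  fix X assume X: "X \<in> rat_sqclasses_outside {2, p}"
  then obtain x where x: "x \<noteq> 0" "X = rat_sqclass x"
    by (auto simp: rat_sqclasses_outside_def rat.carrier_sqclass_group)
  have "x \<in> X"
    unfolding x(2) sqclass_def r_coset_def using rat.one_nonzero_square by (auto intro!: bexI[of _ 1])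
  hence even: "even (padic_val l x)" if "prime l" "l \<noteq> 2" "l \<noteq> p" for l
    using X that by (auto simp: rat_sqclasses_outside_def)
  define j k where "j = odd (padic_val 2 x)" and "k = odd (padic_val p x)"
  let ?r = "of_int (rep p (False, j, k)) :: rat"
  have "even (padic_val l (x * ?r))" if l: "prime l" for l
  proof -
    have "padic_val l (x * ?r) = padic_val l x + padic_val l ?r" using x by (intro padic_val_mult l) (simp_all del: rep.simps)
    thus ?thesis
      using even[OF l] p_gt_2 by (auto simp: padic_val_rep[OF l] j_def k_def simp del: rep.simps)
  qed
  moreover have "x * ?r \<noteq> 0" using x rep_nonzero by (metis mult_eq_0_iff of_int_eq_0_iff)
  ultimately obtain w where w: "w \<noteq> 0" "x * ?r = w * w \<or> x * ?r = - (w * w)"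
    using rat_square_up_to_sign by blast
  have "X = rep_class (x * ?r < 0, j, k)"
  proof -
    have sign: "of_int (rep p (i, j, k)) = (if i then - ?r else ?r)" for i by simp
    have "w * w > 0" using w(1) by (auto simp: zero_less_mult_iff neq_iff)
    hence "x * of_int (rep p (x * ?r < 0, j, k)) = w * w"
      using w(2) by (subst sign, elim disjE) (simp_all del: rep.simps)
    hence "rat_sqclass x = rep_class (x * ?r < 0, j, k)"
      using w(1) x(1) by (subst rat_sqclass_eq_iff) (simp_all del: rep.simps, blast)
    thus ?thesis using x(2) by simp
  qed
  thus "X \<in> range rep_class" by blast
next
  fix X assume "X \<in> range rep_class"
  then obtain u where u: "X = rep_class u" by blast
  obtain i j k where ijk: "u = (i, j, k)" by (metis prod_cases3)
  have "even (padic_val l x)" if l: "prime l" "l \<notin> {2, p}" and x: "x \<in> X" for l x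
  proof -
    obtain s where s: "s \<noteq> 0" "x = s * s * of_int (rep p u)"
      using x u by (auto simp: sqclass_def r_coset_def nonzero_squares_def)
    thus ?thesis using l by (simp add: padic_val_mult ijk padic_val_rep del: rep.simps)
  qed
  moreover have "X \<in> carrier (sqclass_group class_ring)"
    using u by (auto simp: rat.carrier_sqclass_group)
  ultimately show "X \<in> rat_sqclasses_outside {2, p}" by (auto simp: rat_sqclasses_outside_def)
qed

end

section \<open>The Kummer image over the reals\<close>

lemma real_nonzero_squares_iff: "x \<in> nonzero_squares (class_ring :: real ring) \<longleftrightarrow> x > 0"
proof
  assume "x > 0"
  hence "sqrt x * sqrt x \<in> nonzero_squares class_ring" using real.nonzero_squaresI[of "sqrt x"] by simp
  thus "x \<in> nonzero_squares class_ring" using \<open>x > 0\<close> by simp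
qed (auto simp: nonzero_squares_def zero_less_mult_iff neq_iff)

lemma real_local_square_iff: "real.local_square q \<longleftrightarrow> q > 0"
  by (simp add: real.local_square_def real_nonzero_squares_iff)

text \<open>For \<open>y \<noteq> 0\<close> the product \<open>(x + p) x (x - p)\<close> is positive, hence so is its largest factor \<open>x + p\<close>.
  Conversely the trivial class and \<open>(2, -p, -2p)\<close> realise both possible signs of \<open>b\<close>.\<close>

theorem kummer_image_real:
  assumes p: "p \<noteq> 0" and abc: "a * b * c > 0"
  shows "locally_kummer p (class_ring :: real ring) of_rat (rat_sqclass a, rat_sqclass b, rat_sqclass c) \<longleftrightarrow> a > 0"
proof -
  have nz: "a \<noteq> 0" "b \<noteq> 0" "c \<noteq> 0" using abc by auto
  have p0: "(of_nat p :: rat) > 0" "real p > 0" using p by auto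
  have iff: "locally_kummer p (class_ring :: real ring) of_rat (rat_sqclass a, rat_sqclass b, rat_sqclass c) \<longleftrightarrow>
    (\<exists>(s, t, u)\<in>torsion_classes p. a * s > 0 \<and> b * t > 0 \<and> c * u > 0) \<or>
    (\<exists>x. real_of_rat a * (x + real p) > 0 \<and> real_of_rat b * x > 0 \<and> real_of_rat c * (x - real p) > 0)"
    using real.locally_kummer_iff[OF p nz] abc
    by (simp add: real_local_square_iff real_nonzero_squares_iff class_ring_simps)
  show ?thesis
    unfolding iff
  proof
    assume a: "a > 0"
    hence "(b > 0 \<and> c > 0) \<or> (b < 0 \<and> c < 0)" using abc by (auto simp: zero_less_mult_iff mult_less_0_iff)
    hence "\<exists>(s, t, u)\<in>torsion_classes p. a * s > 0 \<and> b * t > 0 \<and> c * u > 0"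
    proof
      assume "b > 0 \<and> c > 0"
      thus ?thesis using a by (intro bexI[of _ "(1, 1, 1)"]) (simp_all add: torsion_classes_def)
    next
      assume "b < 0 \<and> c < 0"
      thus ?thesis using a p0
        by (intro bexI[of _ "(2, - of_nat p, - 2 * of_nat p)"])
           (simp_all add: torsion_classes_def zero_less_mult_iff mult_less_0_iff)
    qed
    thus "(\<exists>(s, t, u)\<in>torsion_classes p. a * s > 0 \<and> b * t > 0 \<and> c * u > 0) \<or>
      (\<exists>x. real_of_rat a * (x + real p) > 0 \<and> real_of_rat b * x > 0 \<and> real_of_rat c * (x - real p) > 0)" ..
  next
    assume "(\<exists>(s, t, u)\<in>torsion_classes p. a * s > 0 \<and> b * t > 0 \<and> c * u > 0) \<or>
      (\<exists>x. real_of_rat a * (x + real p) > 0 \<and> real_of_rat b * x > 0 \<and> real_of_rat c * (x - real p) > 0)"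
    thus "a > 0"
    proof
      assume "\<exists>(s, t, u)\<in>torsion_classes p. a * s > 0 \<and> b * t > 0 \<and> c * u > 0"
      then obtain s t u where s: "(s, t, u) \<in> torsion_classes p" "a * s > 0" by blast
      have "s > 0" using s(1) p0 by (auto simp: torsion_classes_def)
      thus ?thesis using s(2) by (simp add: zero_less_mult_iff)
    next
      assume "\<exists>x. real_of_rat a * (x + real p) > 0 \<and> real_of_rat b * x > 0 \<and> real_of_rat c * (x - real p) > 0"
      then obtain x where x: "real_of_rat a * (x + real p) > 0" "real_of_rat b * x > 0"
        "real_of_rat c * (x - real p) > 0" by blast
      show ?thesis
      proof (rule ccontr)
        assume "\<not> a > 0"
        hence a: "a < 0" using nz(1) by simp
        hence "x + real p < 0" using x(1) by (simp add: zero_less_mult_iff)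
        hence "x < 0" "x - real p < 0" using p0 by auto
        hence "b < 0" "c < 0" using x by (auto simp: zero_less_mult_iff)
        thus False using a abc by (simp add: zero_less_mult_iff mult_less_0_iff)
      qed
    qed
  qed
qed

section \<open>The Selmer group\<close>

context odd_prime
begin

abbreviation triple :: "bits \<times> bits \<Rightarrow> rat set \<times> rat set \<times> rat set" where
  "triple \<equiv> \<lambda>(u, v). (rep_class u, rep_class v, rep_class (xor_bits u v))"

lemma rep_class_one: "\<one>\<^bsub>sqclass_group class_ring\<^esub> = rep_class (False, False, False)"
  using rat.sqclass_one by simp

lemma rep_class_eq_iff: "rep_class u = rep_class v \<longleftrightarrow> u = v"
  using inj_rep_class by (auto dest: injD)

lemma selmer_ambient_eq: "selmer_ambient p = range triple"
proof -
  have xor: "xor_bits (xor_bits u v) w = (False, False, False) \<longleftrightarrow> w = xor_bits u v" for u v w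
    by (cases u; cases v; cases w) auto
  have iff: "(rep_class u, rep_class v, rep_class w) \<in> selmer_ambient p \<longleftrightarrow> w = xor_bits u v" for u v w
    by (simp add: selmer_ambient_def Let_def rat_sqclasses_outside_eq rep_class_mult rep_class_one
        rep_class_eq_iff xor del: rep.simps xor_bits.simps)
  have ex: "\<exists>u v w. c = (rep_class u, rep_class v, rep_class w)" if "c \<in> selmer_ambient p" for c
    using that by (cases c) (auto simp: selmer_ambient_def Let_def rat_sqclasses_outside_eq simp del: rep.simps)
  show ?thesis
  proof (intro equalityI subsetI)
    fix c assume c: "c \<in> selmer_ambient p"
    then obtain u v w where uvw: "c = (rep_class u, rep_class v, rep_class w)" using ex by blast
    hence "w = xor_bits u v" using c iff by blast
    hence "c = triple (u, v)" using uvw by simp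
    thus "c \<in> range triple" by (rule range_eqI)
  next
    fix c assume "c \<in> range triple"
    then obtain uv where "c = triple uv" by (rule rangeE)
    moreover obtain u v where "uv = (u, v)" by (rule prod.exhaust)
    ultimately have "c = (rep_class u, rep_class v, rep_class (xor_bits u v))" by (simp only: prod.case)
    thus "c \<in> selmer_ambient p" using iff by blast
  qed
qed

lemma inj_triple: "inj triple"
  by (rule injI) (simp add: rep_class_eq_iff split: prod.splits del: rep.simps xor_bits.simps)

lemma local_square_rep_mult:
  assumes "rat_extension K \<phi>"
  shows "rat_extension.local_square K \<phi> (of_int (rep p u) * of_int (rep p v)) \<longleftrightarrow>
    rat_extension.local_square K \<phi> (of_int (rep p (xor_bits u v)))"
proof -
  interpret K: rat_extension K \<phi> by fact
  obtain w :: rat where w: "w \<noteq> 0" "of_int (rep p u) * of_int (rep p v) = w * w * of_int (rep p (xor_bits u v))"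
    by (rule rep_mult_rat)
  show ?thesis
    using K.local_square_mult[OF K.local_square_square[OF w(1)]] K.local_square_mod_square w(2) by metis
qed

lemma local_square_triple:
  assumes "rat_extension K \<phi>"
  shows "rat_extension.local_square K \<phi> (of_int (rep p u) * of_int (rep p v) * of_int (rep p (xor_bits u v)))"
proof -
  interpret K: rat_extension K \<phi> by fact
  obtain w :: rat where w: "w \<noteq> 0" "of_int (rep p u) * of_int (rep p v) = w * w * of_int (rep p (xor_bits u v))"
    by (rule rep_mult_rat)
  have "w * of_int (rep p (xor_bits u v)) \<noteq> 0" using w(1) by (simp del: rep.simps)
  from K.local_square_square[OF this] show ?thesis unfolding w(2) by (simp only: mult.assoc mult.left_commute)
qed

text \<open>The points \<open>(-p, 0)\<close> and \<open>(0, 0)\<close> generate the torsion; \<open>s1\<close> and \<open>s2\<close> are the exponents of their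
  classes.\<close>

lemma bex_torsion_classes:
  "(\<exists>(s, t, u) \<in> torsion_classes p. P s t) \<longleftrightarrow>
   (\<exists>s1 s2. P (of_int (rep p (False, s1, s2))) (of_int (rep p (s1 \<noteq> s2, False, s1))))"
  by (auto simp: torsion_classes_def ex_bool_eq)

lemma locally_kummer_real_iff:
  "locally_kummer p (class_ring :: real ring) of_rat (triple ((i, j, k), v)) \<longleftrightarrow> \<not> i"
proof -
  have p0: "p \<noteq> 0" using p_gt_2 by auto
  have "of_int (rep p (i, j, k)) * of_int (rep p v) * of_int (rep p (xor_bits (i, j, k) v)) > (0 :: rat)"
    using local_square_triple[OF rat_extension_real] by (simp only: real_local_square_iff)
  from kummer_image_real[OF p0 this]
  have "locally_kummer p (class_ring :: real ring) of_rat (triple ((i, j, k), v)) \<longleftrightarrow>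
      (0 :: rat) < of_int (rep p (i, j, k))"
    by (simp only: prod.case)
  also have "\<dots> \<longleftrightarrow> \<not> i" using p_gt_2 by (auto simp: zero_less_mult_iff)
  finally show ?thesis .
qed

lemma local_square_p_rep:
  "at_p.padic.local_square (of_int (rep p (i, j, k))) \<longleftrightarrow> \<not> k \<and> QuadRes (int p) (rep p (i, j, False))"
proof (cases k)
  case True
  thus ?thesis
    using at_p.local_square_even_val[of "of_int (rep p (i, j, k))"] by (auto simp: padic_val_rep_p simp del: rep.simps)
next
  case False
  have "\<not> int p dvd rep p (i, j, False)" using p_gt_2 by (auto dest: zdvd_imp_le)
  thus ?thesis using at_p.local_square_int_odd False p_gt_2 by (simp del: rep.simps)
qed

lemma local_square_2_rep:
  assumes "odd e"
  shows "two.padic.local_square (of_int (rep p (i, j, k)) * of_int e) \<longleftrightarrow> \<not> j \<and> [e * rep p (i, False, k) = 1] (mod 8)"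
proof (cases j)
  case True
  have "e \<noteq> 0" using assms by auto
  hence "padic_val 2 (of_int e) = 0"
    using padic_val_of_int[OF two_is_prime_nat, of e] assms by (simp add: not_dvd_imp_multiplicity_0)
  hence "padic_val 2 (of_int (rep p (i, j, k)) * of_int e) = 1"
    using True \<open>e \<noteq> 0\<close> by (subst padic_val_mult) (simp_all add: padic_val_rep_2 del: rep.simps)
  thus ?thesis using two.local_square_even_val True by fastforce
next
  case False
  have "odd (e * rep p (i, False, k))" using assms p by simp
  from two.local_square_int_2[OF refl this] show ?thesis using False by (simp add: mult.commute del: rep.simps)
qed

text \<open>A local square has even valuation, so the bits for \<open>p\<close> determine the torsion point: \<open>s1 = k'\<close> and
  \<open>s2 = k\<close>. The remaining conditions concern units.\<close>

lemma locally_kummer_p_iff: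
  "locally_kummer p (padic_field p) (padic_of_rat p) (triple ((i, j, k), (i', j', k'))) \<longleftrightarrow>
   QuadRes (int p) (rep p (i, j \<noteq> k', False)) \<and> QuadRes (int p) (rep p (i' \<noteq> (k' \<noteq> k), j', False))"
proof -
  note ext = at_p.padic.rat_extension_axioms
  have p2: "p \<noteq> 2" using p by auto
  have "locally_kummer p (padic_field p) (padic_of_rat p) (triple ((i, j, k), (i', j', k'))) \<longleftrightarrow>
    (\<exists>(s, t, u) \<in> torsion_classes p. at_p.padic.local_square (of_int (rep p (i, j, k)) * s) \<and>
      at_p.padic.local_square (of_int (rep p (i', j', k')) * t))"
    unfolding prod.case
    by (rule at_p.kummer_image_odd[OF p2 _ _ _ local_square_triple[OF ext]]) (simp_all del: rep.simps)
  also have "\<dots> \<longleftrightarrow> (\<exists>s1 s2. at_p.padic.local_square (of_int (rep p (i, j \<noteq> s1, k \<noteq> s2))) \<and>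
      at_p.padic.local_square (of_int (rep p (i' \<noteq> (s1 \<noteq> s2), j', k' \<noteq> s1))))"
    unfolding bex_torsion_classes local_square_rep_mult[OF ext] by (simp del: rep.simps)
  also have "\<dots> \<longleftrightarrow> QuadRes (int p) (rep p (i, j \<noteq> k', False)) \<and>
      QuadRes (int p) (rep p (i' \<noteq> (k' \<noteq> k), j', False))"
    unfolding local_square_p_rep by (cases k; cases k') (simp_all add: ex_bool_eq del: rep.simps)
  finally show ?thesis .
qed

text \<open>The bits for 2 give \<open>s1 = j\<close> and the condition on \<open>j'\<close>; the exponent \<open>s2\<close>, here \<open>s\<close>, and the
  factor \<open>e\<close> remain to be chosen.\<close>

lemma locally_kummer_2_iff:
  "locally_kummer p (padic_field 2) (padic_of_rat 2) (triple ((i, j, k), (i', j', k'))) \<longleftrightarrow>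
   \<not> j' \<and> (\<exists>s. (\<exists>e \<in> {1, 5}. [e * rep p (i, False, k \<noteq> s) = 1] (mod 8)) \<and>
     [rep p (i' \<noteq> (j \<noteq> s), False, k' \<noteq> j) = 1] (mod 8))"
proof -
  note ext = two.padic.rat_extension_axioms
  have 5: "two.padic.local_square (of_int (rep p u) * (of_int (rep p v) * of_int e)) \<longleftrightarrow>
      two.padic.local_square (of_int (rep p (xor_bits u v)) * of_int e)" for u v e
  proof -
    obtain w :: rat where w: "w \<noteq> 0" "of_int (rep p u) * of_int (rep p v) = w * w * of_int (rep p (xor_bits u v))"
      by (rule rep_mult_rat)
    show ?thesis unfolding mult.assoc[symmetric] w(2)
      using two.padic.local_square_mult[OF two.padic.local_square_square[OF w(1)]]
        two.padic.local_square_mod_square by (metis mult.assoc)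
  qed
  have e: "(\<exists>e\<in>{1, 5}. two.padic.local_square (of_int (rep p u) * (of_int (rep p v) * e))) \<longleftrightarrow>
      (\<exists>e\<in>{1, 5}. two.padic.local_square (of_int (rep p (xor_bits u v)) * of_int e))" for u v
    using 5[of u v 1] 5[of u v 5] by (simp del: rep.simps xor_bits.simps)
  have "locally_kummer p (padic_field 2) (padic_of_rat 2) (triple ((i, j, k), (i', j', k'))) \<longleftrightarrow>
    (\<exists>(s, t, u) \<in> torsion_classes p. \<exists>e\<in>{1, 5}.
      two.padic.local_square (of_int (rep p (i, j, k)) * (s * e)) \<and>
      two.padic.local_square (of_int (rep p (i', j', k')) * t))"
    unfolding prod.case
    by (rule two.kummer_image_2[OF refl p(2) _ _ _ local_square_triple[OF ext]]) (simp_all del: rep.simps)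
  also have "\<dots> \<longleftrightarrow> (\<exists>s1 s2. (\<exists>e\<in>{1, 5}. two.padic.local_square
        (of_int (rep p (i, j, k)) * (of_int (rep p (False, s1, s2)) * e))) \<and>
      two.padic.local_square (of_int (rep p (i', j', k')) * of_int (rep p (s1 \<noteq> s2, False, s1))))"
    unfolding bex_torsion_classes by (simp only: bex_simps)
  also have "\<dots> \<longleftrightarrow> (\<exists>s1 s2. (\<exists>e\<in>{1, 5}. two.padic.local_square
        (of_int (rep p (i, j \<noteq> s1, k \<noteq> s2)) * of_int e)) \<and>
      two.padic.local_square (of_int (rep p (i' \<noteq> (s1 \<noteq> s2), j', k' \<noteq> s1)) * of_int 1))"
    unfolding e local_square_rep_mult[OF ext] by (simp del: rep.simps)
  also have "\<dots> \<longleftrightarrow> (\<exists>s1 s2. (\<exists>e\<in>{1, 5}. \<not> (j \<noteq> s1) \<and> [e * rep p (i, False, k \<noteq> s2) = 1] (mod 8)) \<and>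
      \<not> j' \<and> [1 * rep p (i' \<noteq> (s1 \<noteq> s2), False, k' \<noteq> s1) = 1] (mod 8))"
    by (intro ex_cong1 arg_cong2[of _ _ _ _ "(\<and>)"] bex_cong refl local_square_2_rep) auto
  also have "\<dots> \<longleftrightarrow> \<not> j' \<and> (\<exists>s. (\<exists>e \<in> {1, 5}. [e * rep p (i, False, k \<noteq> s) = 1] (mod 8)) \<and>
     [rep p (i' \<noteq> (j \<noteq> s), False, k' \<noteq> j) = 1] (mod 8))"
    by (cases j; cases j') (simp_all add: ex_bool_eq del: rep.simps)
  finally show ?thesis .
qed

end

text \<open>The equations of the Selmer group in terms of the bits of \<open>c\<^sub>1\<close> and \<open>c\<^sub>2\<close>, for \<open>r\<close> the residue of \<open>p\<close>
  modulo 8. The inequalities of bits are their sums over the field with two elements.\<close>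

fun selmer_bits :: "nat \<Rightarrow> bits \<times> bits \<Rightarrow> bool" where
  "selmer_bits r ((i, j, k), (i', j', k')) \<longleftrightarrow> \<not> i \<and> \<not> j' \<and>
     (r = 1 \<or> r = 3 \<and> k' = j \<and> i' = (j \<noteq> k) \<or> r = 5 \<and> k' = j \<or> r = 7 \<and> i' = (k \<noteq> k'))"

context odd_prime
begin

lemma p_mod_8: "p mod 8 \<in> {1, 3, 5, 7}"
  using p(2) by simp presburger

lemma QuadRes_rep:
  "QuadRes (int p) (rep p (i, j, False)) \<longleftrightarrow>
    (if i then p mod 8 \<in> (if j then {1, 3} else {1, 5}) else j \<longrightarrow> p mod 8 \<in> {1, 7})"
proof -
  have "QuadRes (int p) 1" unfolding QuadRes_def by (intro exI[of _ 1]) simp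
  thus ?thesis using QuadRes_minus_1_2[OF p] by simp
qed

text \<open>The representatives for \<open>p mod 8\<close> in place of \<open>p\<close> are explicit numbers.\<close>

lemma rep_cong_8: "[e * rep p (i, False, k) = 1] (mod 8) \<longleftrightarrow> [e * rep (p mod 8) (i, False, k) = 1] (mod 8)"
proof -
  have "[int p = int (p mod 8)] (mod 8)" by (simp add: cong_def zmod_int)
  hence "[e * rep p (i, False, k) = e * rep (p mod 8) (i, False, k)] (mod 8)"
    unfolding rep.simps by (intro cong_mult cong_refl) (auto simp: cong_refl)
  thus ?thesis by (meson cong_sym cong_trans)
qed

text \<open>The conditions at 2, at \<open>p\<close> and at \<open>\<infinity>\<close> are compared with \<open>selmer_bits\<close> by inspection of all
  values of the six bits.\<close>

lemma local_conditions_iff: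
  assumes "r \<in> {1, 3, 5, 7}"
  shows "(\<not> j' \<and> (\<exists>s. (\<exists>e \<in> {1, 5}. [e * rep r (i, False, k \<noteq> s) = 1] (mod 8)) \<and>
      [rep r (i' \<noteq> (j \<noteq> s), False, k' \<noteq> j) = 1] (mod 8))) \<and>
    ((if i then r \<in> (if j \<noteq> k' then {1, 3} else {1, 5}) else j \<noteq> k' \<longrightarrow> r \<in> {1, 7}) \<and>
     (if i' \<noteq> (k' \<noteq> k) then r \<in> (if j' then {1, 3} else {1, 5}) else j' \<longrightarrow> r \<in> {1, 7})) \<and>
    \<not> i \<longleftrightarrow> selmer_bits r ((i, j, k), (i', j', k'))"
proof -
  consider "r = 1" | "r = 3" | "r = 5" | "r = 7" using assms by blast
  thus ?thesis
    by cases (cases i; cases j'; cases j; cases k; cases i'; cases k'; simp add: ex_bool_eq cong_def)+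
qed

lemma triple_in_selmer_set_iff: "triple uv \<in> selmer_set p \<longleftrightarrow> selmer_bits (p mod 8) uv"
proof -
  obtain i j k i' j' k' where uv: "uv = ((i, j, k), (i', j', k'))" by (metis prod_cases3 surj_pair)
  have amb: "triple uv \<in> selmer_ambient p" unfolding selmer_ambient_eq by blast
  have "triple uv \<in> selmer_set p \<longleftrightarrow>
      locally_kummer p (padic_field 2) (padic_of_rat 2) (triple uv) \<and>
      locally_kummer p (padic_field p) (padic_of_rat p) (triple uv) \<and>
      locally_kummer p (class_ring :: real ring) of_rat (triple uv)"
    using amb by (simp only: selmer_set_def mem_Collect_eq ball_simps) blast
  also have "\<dots> \<longleftrightarrow> selmer_bits (p mod 8) uv"
    unfolding uv locally_kummer_2_iff locally_kummer_p_iff locally_kummer_real_iff QuadRes_rep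
      rep_cong_8 rep_cong_8[of 1, unfolded mult_1]
    by (rule local_conditions_iff[OF p_mod_8])
  finally show ?thesis .
qed

lemma selmer_set_eq: "selmer_set p = triple ` Collect (selmer_bits (p mod 8))"
proof (intro equalityI subsetI)
  fix c assume c: "c \<in> selmer_set p"
  hence "c \<in> selmer_ambient p" by (simp add: selmer_set_def)
  then obtain uv where "c = triple uv" unfolding selmer_ambient_eq by (rule rangeE)
  thus "c \<in> triple ` Collect (selmer_bits (p mod 8))" using c triple_in_selmer_set_iff by blast
next
  fix c assume "c \<in> triple ` Collect (selmer_bits (p mod 8))"
  thus "c \<in> selmer_set p" using triple_in_selmer_set_iff by blast
qed

lemma selmer_group_mult:
  "triple (u, v) \<otimes>\<^bsub>selmer_group p\<^esub> triple (u', v') = triple (xor_bits u u', xor_bits v v')"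
proof -
  have "xor_bits (xor_bits u v) (xor_bits u' v') = xor_bits (xor_bits u u') (xor_bits v v')"
    by (cases u; cases v; cases u'; cases v') auto
  thus ?thesis
    by (simp add: selmer_group_def Let_def DirProd_def rep_class_mult del: rep.simps xor_bits.simps)
qed

lemma selmer_group_one: "\<one>\<^bsub>selmer_group p\<^esub> = triple ((False, False, False), (False, False, False))"
  by (simp add: selmer_group_def Let_def DirProd_def rep_class_one del: rep.simps)

lemma carrier_selmer_group: "carrier (selmer_group p) = selmer_set p"
  by (simp add: selmer_group_def Let_def)

lemma selmer_group_cases:
  assumes "x \<in> carrier (selmer_group p)"
  obtains u v where "x = triple (u, v)" "selmer_bits (p mod 8) (u, v)"
proof -
  have "x \<in> triple ` Collect (selmer_bits (p mod 8))"
    using assms by (simp only: carrier_selmer_group selmer_set_eq)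
  then obtain uv where "x = triple uv" "uv \<in> Collect (selmer_bits (p mod 8))" by (rule imageE)
  moreover obtain u v where "uv = (u, v)" by (rule prod.exhaust)
  ultimately show ?thesis using that[of u v] by (simp only: mem_Collect_eq)
qed

lemma selmer_group_exponent_2:
  assumes "x \<in> carrier (selmer_group p)" shows "x \<otimes>\<^bsub>selmer_group p\<^esub> x = \<one>\<^bsub>selmer_group p\<^esub>"
proof -
  obtain u v where "x = triple (u, v)" using assms by (rule selmer_group_cases)
  thus ?thesis by (simp only: selmer_group_mult selmer_group_one xor_bits_self)
qed

lemma selmer_bits_xor:
  "selmer_bits r (u, v) \<Longrightarrow> selmer_bits r (u', v') \<Longrightarrow> selmer_bits r (xor_bits u u', xor_bits v v')"
  by (cases u; cases v; cases u'; cases v') auto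

lemma comm_group_selmer_group: "comm_group (selmer_group p)"
proof -
  have rep: "\<exists>u v. x = triple (u, v) \<and> selmer_bits (p mod 8) (u, v)" if "x \<in> carrier (selmer_group p)" for x
    using that by (rule selmer_group_cases) blast
  have mem: "triple (u, v) \<in> carrier (selmer_group p)" if "selmer_bits (p mod 8) (u, v)" for u v
    using that triple_in_selmer_set_iff by (simp only: carrier_selmer_group)
  have xor: "xor_bits u v = xor_bits v u" "xor_bits (xor_bits u v) w = xor_bits u (xor_bits v w)"
    "xor_bits (False, False, False) u = u" for u v w
    by (cases u; cases v; cases w; auto)+
  have one: "selmer_bits (p mod 8) ((False, False, False), (False, False, False))"
    using p_mod_8 by auto
  show ?thesis
  proof (rule comm_groupI)
    fix x y assume "x \<in> carrier (selmer_group p)" "y \<in> carrier (selmer_group p)"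
    then obtain u v u' v' where *: "x = triple (u, v)" "selmer_bits (p mod 8) (u, v)"
      "y = triple (u', v')" "selmer_bits (p mod 8) (u', v')" using rep by meson
    show "x \<otimes>\<^bsub>selmer_group p\<^esub> y \<in> carrier (selmer_group p)"
      unfolding *(1,3) selmer_group_mult by (rule mem[OF selmer_bits_xor[OF *(2,4)]])
    show "x \<otimes>\<^bsub>selmer_group p\<^esub> y = y \<otimes>\<^bsub>selmer_group p\<^esub> x"
      unfolding *(1,3) selmer_group_mult by (simp only: xor(1))
    fix z assume "z \<in> carrier (selmer_group p)"
    then obtain u'' v'' where z: "z = triple (u'', v'')" using rep by meson
    show "x \<otimes>\<^bsub>selmer_group p\<^esub> y \<otimes>\<^bsub>selmer_group p\<^esub> z = x \<otimes>\<^bsub>selmer_group p\<^esub> (y \<otimes>\<^bsub>selmer_group p\<^esub> z)"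
      unfolding *(1,3) z selmer_group_mult by (simp only: xor(2))
  next
    show "\<one>\<^bsub>selmer_group p\<^esub> \<in> carrier (selmer_group p)"
      unfolding selmer_group_one by (rule mem[OF one])
  next
    fix x assume x: "x \<in> carrier (selmer_group p)"
    then obtain u v where "x = triple (u, v)" using rep by meson
    thus "\<one>\<^bsub>selmer_group p\<^esub> \<otimes>\<^bsub>selmer_group p\<^esub> x = x"
      by (simp only: selmer_group_one selmer_group_mult xor(3))
    show "\<exists>y\<in>carrier (selmer_group p). y \<otimes>\<^bsub>selmer_group p\<^esub> x = \<one>\<^bsub>selmer_group p\<^esub>"
      using x selmer_group_exponent_2[OF x] by blast
  qed
qed

end

lemma card_selmer_bits:
  "card (Collect (selmer_bits 1)) = 2 ^ 4" "card (Collect (selmer_bits 3)) = 2 ^ 2"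
  "card (Collect (selmer_bits 5)) = 2 ^ 3" "card (Collect (selmer_bits 7)) = 2 ^ 3"
proof -
  have card_bits: "card (UNIV :: (bool \<times> bool) set) = 2 ^ 2" "card (UNIV :: (bool \<times> bool \<times> bool) set) = 2 ^ 3"
    "card (UNIV :: (bool \<times> bool \<times> bool \<times> bool) set) = 2 ^ 4"
    by (simp_all only: UNIV_Times_UNIV[symmetric] card_cartesian_product card_UNIV_bool) simp_all
  let ?f1 = "\<lambda>(j, k, i', k'). ((False, j, k), (i', False, k'))"
  have 1: "Collect (selmer_bits 1) = range ?f1" "inj ?f1" by (auto simp: inj_def image_iff)
  show "card (Collect (selmer_bits 1)) = 2 ^ 4"
    unfolding 1(1) card_image[OF 1(2)] by (rule card_bits(3))
  let ?f3 = "\<lambda>(j, k). ((False, j, k), (j \<noteq> k, False, j))"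
  have 3: "Collect (selmer_bits 3) = range ?f3" "inj ?f3" by (auto simp: inj_def image_iff)
  show "card (Collect (selmer_bits 3)) = 2 ^ 2"
    unfolding 3(1) card_image[OF 3(2)] by (rule card_bits(1))
  let ?f5 = "\<lambda>(j, k, i'). ((False, j, k), (i', False, j))"
  have 5: "Collect (selmer_bits 5) = range ?f5" "inj ?f5" by (auto simp: inj_def image_iff)
  show "card (Collect (selmer_bits 5)) = 2 ^ 3"
    unfolding 5(1) card_image[OF 5(2)] by (rule card_bits(2))
  let ?f7 = "\<lambda>(j, k, k'). ((False, j, k), (k \<noteq> k', False, k'))"
  have 7: "Collect (selmer_bits 7) = range ?f7" "inj ?f7" by (auto simp: inj_def image_iff)
  show "card (Collect (selmer_bits 7)) = 2 ^ 3"
    unfolding 7(1) card_image[OF 7(2)] by (rule card_bits(2))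
qed

theorem proposition2p3:
  fixes p :: nat
  assumes "prime p" and "odd p"
  shows "vectorspace (residue_ring 2) (selmer_space p) \<and>
    vectorspace.fin_dim (residue_ring 2) (selmer_space p) \<and>
    (p mod 8 = 1 \<longrightarrow> vectorspace.dim (residue_ring 2) (selmer_space p) = 4) \<and>
    (p mod 8 = 3 \<longrightarrow> vectorspace.dim (residue_ring 2) (selmer_space p) = 2) \<and>
    (p mod 8 = 5 \<or> p mod 8 = 7 \<longrightarrow>
      vectorspace.dim (residue_ring 2) (selmer_space p) = 3)"
proof -
  interpret odd_prime p by unfold_locales (fact assms)+
  define n :: nat where "n = (if p mod 8 = 1 then 4 else if p mod 8 = 3 then 2 else 3)"
  have vs: "vectorspace (residue_ring 2) (F2_module (selmer_group p))"
    by (rule vectorspace_F2_module[OF comm_group_selmer_group selmer_group_exponent_2])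
  have "card (carrier (selmer_group p)) = card (Collect (selmer_bits (p mod 8)))"
    unfolding carrier_selmer_group selmer_set_eq by (rule card_image[OF inj_on_subset[OF inj_triple]]) simp
  also have "\<dots> = 2 ^ n" using p_mod_8 card_selmer_bits by (auto simp: n_def)
  finally have card: "card (carrier (selmer_group p)) = 2 ^ n" .
  have "finite (carrier (selmer_group p))" unfolding carrier_selmer_group selmer_set_eq by simp
  from F2_module_fin_dim_dim[OF vs this card] vs show ?thesis
    unfolding selmer_space_def n_def by auto
qed

end
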